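(* Let $q\in\mathbb{C}$ with $0<|q|<1$, let $r,s\ge 0$ be integers with $r>s+1$, and put $k=r-s-1$ and $p=q^k$. Let $\bm{a}=(a_1,\ldots,a_r)\in(\mathbb{C}^* )^r$ and $\bm{b}=(b_1,\ldots,b_s)\in(\mathbb{C}^* )^s$ with $b_1,\ldots,b_s\notin\{q^{-n}: n=0,1,2,\ldots\}$, and assume $a_i/a_j\notin q^{\mathbb{Z}}$ for $i\ne j$. Then, for any $\lambda\in\mathbb{C}^*\setminus[(-1)^k;q]$, the basic hypergeometric series $\hat f(x)={}_r\varphi_s(\bm{a};\bm{b};q,x)$ is $[\lambda;p]$-summable, and its $[\lambda;p]$-sum $${}_rf_s(\bm{a};\bm{b};\lambda;q,x)=\big(\mathcal{L}_{p;1}^{[\lambda;p]}\circ\hat{\mathcal{B}}_{p;1}\hat f\big)(x)$$ is given by $${}_rf_s(\bm{a};\bm{b};\lambda;q,x)=\sum_{j=1}^r\left(\prod_{\substack{1\le i\le r\\ i\ne j}}\frac{(a_i;q)_\infty}{(a_i/a_j;q)_\infty}\right)\left(\prod_{l=1}^s\frac{(b_l/a_j;q)_\infty}{(b_l;q)_\infty}\right)\frac{\theta_p\big(p\,a_j^k x/\lambda\big)}{\theta_p(p\,x/\lambda)}\,\frac{\theta_q\big((-1)^{1-k}a_j\lambda\big)}{\theta_q\big((-1)^{1-k}\lambda\big)}\,\Phi_j(x),$$ where $$\Phi_j(x)={}_r\varphi_{r-1}\left(\begin{matrix}a_j,\ a_jq/b_1,\ldots,a_jq/b_s,\ \bm{0}_k\\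 (a_jq/a_i)_{1\le i\le r,\, i\ne j}\end{matrix};q,\frac{q\,b_1\cdots b_s}{a_1\cdots a_r\,x}\right),$$ for $x\in\mathbb{C}^*\setminus[-\lambda;p]$ with $\left|\dfrac{q\,b_1\cdots b_s}{a_1\cdots a_r\,x}\right|<1$. The function ${}_rf_s(\bm{a};\bm{b};\lambda;q,x)$ has simple poles on the $p$-spiral $[-\lambda;p]$.
   Context: Notation. For a base $q\in\mathbb{C}$ with $0<|q|<1$: $(a;q)_n=\prod_{j=0}^{n-1}(1-aq^j)$, $(a;q)_\infty=\prod_{j\ge0}(1-aq^j)$, and $(a_1,\ldots,a_m;q)_n=\prod_{j=1}^m(a_j;q)_n$ for $n\in\{0,1,2,\ldots\}\cup\{\infty\}$. The basic hypergeometric series is $${}_r\varphi_s(\bm{a};\bm{b};q,x)={}_r\varphi_s\left(\begin{matrix}\bm{a}\\ \bm{b}\end{matrix};q,x\right)=\sum_{n\ge0}\frac{(a_1,\ldots,a_r;q)_n}{(b_1,\ldots,b_s;q)_n(q;q)_n}\Big\{(-1)^nq^{\frac{n(n-1)}2}\Big\}^{1+s-r}x^n,$$ regarded as a formal power series in $x$ when $r>s+1$. $\bm{0}_k$ denotes $k$ entries equal to $0$. The theta function is $\theta_q(x)=\sum_{n\in\mathbb{Z}}q^{\frac{n(n-1)}2}x^n$, $x\in\mathbb{C}^*=\mathbb{C}\setminus\{0\}$; $\theta_p$ is the same with base $p$ in place of $q$. For $\lambda\in\mathbb{C}^*$, the $q$-spiral is $[\lambda;q]=\{\lambda q^n: n\in\mathbb{Z}\}$,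 and likewise $[\lambda;p]=\{\lambda p^n:n\in\mathbb{Z}\}$. $p$-Borel summability (for a base $p$ with $0<|p|<1$). The $p$-Borel transform of $\hat f(x)=\sum_{n\ge0}c_nx^n\in\mathbb{C}[[x]]$ is $(\hat{\mathcal{B}}_{p;1}\hat f)(\xi)=\sum_{n\ge0}c_n\,p^{\frac{n(n-1)}2}\xi^n$. A function $f$ analytic on some punctured neighborhood of $0$ is said to belong to $\mathbb{H}_{p;1}^{[\lambda;p]}$ if there exist $\varepsilon>0$ and a domain $\Omega\subset\mathbb{C}$ such that $\bigcup_{m\in\mathbb{Z}}\{x\in\mathbb{C}^*:|x-\lambda p^m|<\varepsilon|p^m\lambda|\}\subset\Omega$ and $f$ can be continued to an analytic function on $\Omega$ with $p$-exponential growth at infinity, meaning there exist $L,M>0$ with $|f(x)|<L\,\theta_{|p|}(M|x|)$ for all $x\in\Omega\setminus\{0\}$. For $f\in\mathbb{H}_{p;1}^{[\lambda;p]}$, its $p$-Laplace transform is $$\big(\mathcal{L}_{p;1}^{[\lambda;p]}f\big)(x)=\sum_{n\in\mathbb{Z}}\frac{f(\lambda p^n)}{\theta_p\big(\frac{\lambda p^n}{x}\big)},$$ which defines a meromorphic function of $x$ on some punctured neighborhood of $0$. A formal series $\hat f$ is called $[\lambda;p]$-summable if $\hat{\mathcal{B}}_{p;1}\hat f\in\mathbb{H}_{p;1}^{[\lambda;p]}$; then $\mathcal{L}_{p;1}^{[\lambda;p]}\circ\hat{\mathcal{B}}_{p;1}\hat f$ is called the $[\lambda;p]$-sum of $\hat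 f$. The displayed formula for the $[\lambda;p]$-sum gives its analytic continuation to a neighborhood of infinity.
   Formalization: "Has simple poles on [-λ;p]" fails literally (a_1=1 gives the constant sum 1); the formal version says each point of [-λ;p] is a simple pole exactly when the Laplace numerator Σ f(λp^n)p^{n(n-1)/2}(λ/x)^n is nonzero there, and otherwise the singularity is removable. *)

theory Defs
  imports "HOL-Complex_Analysis.Complex_Analysis"
begin

definition qpoch :: "complex \<Rightarrow> complex \<Rightarrow> nat \<Rightarrow> complex" where
  "qpoch a q n = (\<Prod>j<n. 1 - a * q ^ j)"

definition qpoch_inf :: "complex \<Rightarrow> complex \<Rightarrow> complex" where
  "qpoch_inf a q = (\<Prod>j. 1 - a * q ^ j)"

text \<open>The basic hypergeometric series as a formal power series, the lengths of the parameter
  lists being the indices $r$ and $s$. The exponent $1+s-r$ may be negative.\<close>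

definition qhyp_fps :: "complex list \<Rightarrow> complex list \<Rightarrow> complex \<Rightarrow> complex fps" where
  "qhyp_fps a b q = Abs_fps (\<lambda>n.
     (\<Prod>c\<leftarrow>a. qpoch c q n) / ((\<Prod>c\<leftarrow>b. qpoch c q n) * qpoch q q n)
     * ((-1) ^ n * q ^ (n * (n - 1) div 2)) powi (1 + int (length b) - int (length a)))"

text \<open>Polymorphic because it is used with complex base and with the real base $|p|$.\<close>

definition qtheta :: "'a :: real_normed_field \<Rightarrow> 'a \<Rightarrow> 'a" where
  "qtheta q x = (\<Sum>\<^sub>\<infinity>n::int. q powi (n * (n - 1) div 2) * x powi n)"

definition qspiral :: "complex \<Rightarrow> complex \<Rightarrow> complex set" where
  "qspiral lam q = {lam * q powi n | n::int. True}"

definition pborel :: "complex \<Rightarrow> complex fps \<Rightarrow> complex fps" where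
  "pborel p f = Abs_fps (\<lambda>n. fps_nth f n * p ^ (n * (n - 1) div 2))"

text \<open>\<open>g\<close> is an analytic continuation of \<open>f\<close> witnessing that \<open>f\<close> lies in the space
  $\mathbb{H}_{p;1}^{[\lambda;p]}$: near the origin \<open>g\<close> agrees with \<open>f\<close> on all of \<open>\<Omega>\<close>.\<close>

definition spiral_continuation ::
  "complex \<Rightarrow> complex \<Rightarrow> (complex \<Rightarrow> complex) \<Rightarrow> (complex \<Rightarrow> complex) \<Rightarrow> bool" where
  "spiral_continuation p lam f g \<longleftrightarrow>
     (\<exists>\<delta>>0. f analytic_on (ball 0 \<delta> - {0}) \<and>
       (\<exists>\<epsilon>>0. \<exists>\<Omega>. open \<Omega> \<and> connected \<Omega> \<and>
          (\<Union>m::int. {x. x \<noteq> 0 \<and> cmod (x - lam * p powi m) < \<epsilon> * cmod (p powi m * lam)}) \<subseteq> \<Omega> \<and>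
          g analytic_on \<Omega> \<and>
          (\<forall>x\<in>\<Omega> \<inter> (ball 0 \<delta> - {0}). g x = f x) \<and>
          (\<exists>L>0. \<exists>M>0. \<forall>x\<in>\<Omega> - {0}. cmod (g x) < L * qtheta (cmod p) (M * cmod x))))"

definition H_space :: "complex \<Rightarrow> complex \<Rightarrow> (complex \<Rightarrow> complex) set" where
  "H_space p lam = {f. \<exists>g. spiral_continuation p lam f g}"

text \<open>The Laplace transform evaluates the continuation of \<open>f\<close>, not \<open>f\<close> itself, along the
  spiral. The choice is harmless when the continuation is unique at those points, for
  instance when \<open>f\<close> extends meromorphically to the plane.\<close>

definition continued :: "complex \<Rightarrow> complex \<Rightarrow> (complex \<Rightarrow> complex) \<Rightarrow> complex \<Rightarrow> complex" where
  "continued p lam f = (SOME g. spiral_continuation p lam f g)"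

definition plaplace_term ::
  "complex \<Rightarrow> complex \<Rightarrow> (complex \<Rightarrow> complex) \<Rightarrow> complex \<Rightarrow> int \<Rightarrow> complex" where
  "plaplace_term p lam f x n =
     continued p lam f (lam * p powi n) / qtheta p (lam * p powi n / x)"

definition plaplace :: "complex \<Rightarrow> complex \<Rightarrow> (complex \<Rightarrow> complex) \<Rightarrow> complex \<Rightarrow> complex" where
  "plaplace p lam f x = (\<Sum>\<^sub>\<infinity>n::int. plaplace_term p lam f x n)"

text \<open>Since $\theta_p(p^n y) = p^{-n(n-1)/2} y^{-n} \theta_p(y)$, the Laplace transform at $x$ equals
  this sum divided by $\theta_p(\lambda/x)$, which vanishes exactly on $[-\lambda;p]$.\<close>

definition plaplace_numerator ::
  "complex \<Rightarrow> complex \<Rightarrow> (complex \<Rightarrow> complex) \<Rightarrow> complex \<Rightarrow> complex" where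
  "plaplace_numerator p lam f x =
     (\<Sum>\<^sub>\<infinity>n::int. continued p lam f (lam * p powi n)
        * p powi (n * (n - 1) div 2) * (lam / x) powi n)"

text \<open>The radius condition says that the Borel transform converges near the origin, so that
  \<open>eval_fps\<close> is meaningful there.\<close>

definition spiral_summable :: "complex \<Rightarrow> complex \<Rightarrow> complex fps \<Rightarrow> bool" where
  "spiral_summable p lam f \<longleftrightarrow>
     fps_conv_radius (pborel p f) > 0 \<and> eval_fps (pborel p f) \<in> H_space p lam"

definition spiral_sum :: "complex \<Rightarrow> complex \<Rightarrow> complex fps \<Rightarrow> complex \<Rightarrow> complex" where
  "spiral_sum p lam f = plaplace p lam (eval_fps (pborel p f))"

definition Phi :: "complex list \<Rightarrow> complex list \<Rightarrow> complex \<Rightarrow> nat \<Rightarrow> complex \<Rightarrow> complex" where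
  "Phi a b q j x =
     eval_fps
       (qhyp_fps
          (a ! j # map (\<lambda>c. a ! j * q / c) b @ replicate (length a - length b - 1) 0)
          (map (\<lambda>i. a ! j * q / a ! i) (filter (\<lambda>i. i \<noteq> j) [0..<length a]))
          q)
       (q * prod_list b / (prod_list a * x))"

end

theory Submission
  imports Defs
begin

text \<open>
  The Borel transform of the series is $\varphi((-1)^k \xi)$ with
  $\varphi(z) = \sum_n R(q^n) z^n / R(1)$, where
  $R(t) = (qt;q)_\infty \prod_l (b_l t;q)_\infty / \prod_i (a_i t;q)_\infty$.
  Lagrange interpolation of truncated products and Tannery's theorem expand $R$ into the partial
  fractions $1/(1 - a_j q^m t)$. If no $a_i$ is a power of $q$, then $R(q^n) = 0$ for $n < 0$, so
  summing $R(q^n) z^n$ over all $n \in \mathbb{Z}$ turns each partial fraction into a Kronecker sum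
  $\sum_n z^n / (1 - c q^n)$, a quotient of theta functions. This is a connection formula that
  expresses $\varphi$ on an annulus by series in $1/z$; the scaling $a \mapsto c a$ with
  $c \to 1$ removes the genericity assumption. As those series converge for all $z \neq 0$, the formula
  continues $\varphi$ to the punctured plane without the powers of $q$, with polynomial growth at
  infinity along spirals. In the Laplace transform of the formula each power of $1/z$ contributes a shifted
  value of $\theta_p$, and these values sum to $\Phi_j$.
\<close>

section \<open>Tannery's theorem and the q-Pochhammer symbol\<close>

text \<open>No contour integral enters: every analytic identity is a dominated limit of an identity
  between rational functions. Truncating all products of R after N factors gives a proper fraction
  because r > s + 1, so no polynomial part disturbs the interpolation. The k surplus denominator
  factors leave q^(k m(m+1)/2) in the residue at 1/(a_j q^m). This one factor does two jobs. It
  makes the series in 1/z converge for all z except 0. It also equals p^(m(m+1)/2), and in the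
  Laplace transform it completes the exponent n(n-1)/2 to that of n - m. Hence theta_p comes out
  with the same value for every m, and what is left of the series has radius of convergence 1; this
  is the origin of the condition on x. The Kronecker sum runs over all integers, so it needs 1 - a_j
  q^n nonzero for each of them; its coefficient in the final formula has no such denominator, which
  is why a limit removes the restriction. The Laplace transform reads a continuation picked by a
  choice operator, so any two admissible continuations must be shown to agree on the spiral, over
  domains about which little is known. Countability of the singular set settles this.\<close>

lemma infsum_tannery:
  fixes f :: "nat \<Rightarrow> 'a \<Rightarrow> complex"
  assumes lim: "\<And>x. x \<in> A \<Longrightarrow> (\<lambda>n. f n x) \<longlonglongrightarrow> g x"
    and bound: "\<And>n x. x \<in> A \<Longrightarrow> norm (f n x) \<le> M x"
    and M: "M summable_on A"
  shows "(\<lambda>n. infsum (f n) A) \<longlonglongrightarrow> infsum g A"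
proof (rule LIMSEQ_I)
  fix e :: real assume e: "0 < e"
  have gM: "norm (g x) \<le> M x" if "x \<in> A" for x
    by (rule LIMSEQ_le_const2[OF tendsto_norm[OF lim[OF that]]]) (use bound that in auto)
  obtain F where F: "finite F" "F \<subseteq> A" "dist (sum M F) (infsum M A) \<le> e / 4"
    using infsum_finite_approximation[OF M, of "e/4"] e by auto
  have MF: "M summable_on (A - F)" by (rule summable_on_subset_banach[OF M]) auto
  have "infsum M A = sum M F + infsum M (A - F)"
    using infsum_Un_disjoint[of M F "A - F"] F MF by (simp add: Un_absorb1)
  then have tail: "infsum M (A - F) \<le> e / 4"
    using F(3) by (simp add: dist_real_def)
  \<comment> \<open>The estimate uses h only through the majorant \<open>M\<close>, so one finite
    set \<open>F\<close> serves every \<open>f n\<close> and the limit \<open>g\<close>.\<close>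
  have est: "norm (infsum h A - sum h F) \<le> e / 4" if h: "\<And>x. x \<in> A \<Longrightarrow> norm (h x) \<le> M x" for h :: "'a \<Rightarrow> complex"
  proof -
    have hs: "(\<lambda>x. norm (h x)) summable_on (A - F)"
      by (rule Infinite_Sum.abs_summable_on_comparison_test'[OF MF]) (use h in auto)
    have "infsum h A = sum h F + infsum h (A - F)"
      using infsum_Un_disjoint[of h F "A - F"] F abs_summable_summable[OF hs] by (simp add: Un_absorb1)
    moreover have "norm (infsum h (A - F)) \<le> infsum M (A - F)"
      using norm_infsum_le[OF has_sum_infsum[OF abs_summable_summable[OF hs]] has_sum_infsum[OF MF]] h by auto
    ultimately show ?thesis using tail by simp
  qed
  have "(\<lambda>n. sum (f n) F) \<longlonglongrightarrow> sum g F"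
    by (rule tendsto_sum) (use lim F in auto)
  then obtain N where N: "\<And>n. n \<ge> N \<Longrightarrow> norm (sum (f n) F - sum g F) < e / 4"
    using LIMSEQ_D[of _ _ "e/4"] e by fastforce
  have "norm (infsum (f n) A - infsum g A) < e" if "n \<ge> N" for n
  proof -
    have 1: "norm (infsum (f n) A - sum (f n) F) \<le> e / 4" by (rule est) (rule bound)
    have 2: "norm (infsum g A - sum g F) \<le> e / 4" by (rule est) (rule gM)
    have "infsum (f n) A - infsum g A = (infsum (f n) A - sum (f n) F) + (sum (f n) F - sum g F) - (infsum g A - sum g F)"
      by simp
    also have "norm \<dots> \<le> norm (infsum (f n) A - sum (f n) F) + norm (sum (f n) F - sum g F) + norm (infsum g A - sum g F)"
      by (meson add_right_mono norm_triangle_ineq norm_triangle_ineq4 order_trans)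
    also have "\<dots> < e" using 1 2 N[OF that] e by linarith
    finally show ?thesis .
  qed
  then show "\<exists>no. \<forall>n\<ge>no. norm (infsum (f n) A - infsum g A) < e" by blast
qed

lemma qpoch_0 [simp]: "qpoch a q 0 = 1"
  by (simp add: qpoch_def)

lemma qpoch_Suc: "qpoch a q (Suc n) = qpoch a q n * (1 - a * q ^ n)"
  by (simp add: qpoch_def)

lemma qpoch_zero_left [simp]: "qpoch 0 q n = 1"
  by (simp add: qpoch_def)

lemma qpoch_add: "qpoch a q (m + n) = qpoch a q m * qpoch (a * q ^ m) q n"
  by (induction n) (simp_all add: qpoch_Suc power_add mult.assoc)

lemma qpoch_Suc_left: "qpoch a q (Suc n) = (1 - a) * qpoch (a * q) q n"
  using qpoch_add[of a q 1 n] by (simp add: qpoch_Suc)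

lemma qpoch_eq_0_iff: "qpoch a q n = 0 \<longleftrightarrow> (\<exists>j<n. a * q ^ j = 1)"
  by (auto simp: qpoch_def)

lemma tri_Suc: "Suc m * m div 2 = m * (m - 1) div 2 + m" for m :: nat
proof -
  have "Suc m * m = m * (m - 1) + m * 2" by (cases m) (auto simp: algebra_simps)
  then show ?thesis by (metis div_mult_self1 zero_neq_numeral add.commute)
qed

text \<open>Factor by factor, 1 - c/q^i = -(c/q^i) (1 - q^i/c) for i = 1, ..., m; the powers of q
  add up to m(m+1)/2 and stay on the left as a multiplier. The lemma evaluates Pochhammer symbols at
  the nodes of the partial fractions, which involve negative powers of q.\<close>

lemma qpoch_reflect:
  assumes "c \<noteq> 0" "q \<noteq> 0"
  shows "qpoch (c / q ^ m) q m * q ^ (Suc m * m div 2) = (- c) ^ m * qpoch (q / c) q m"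
proof (induction m)
  case (Suc m)
  have "qpoch (c / q ^ Suc m) q (Suc m) = (1 - c / q ^ Suc m) * qpoch (c / q ^ m) q m"
    using assms by (simp add: qpoch_Suc_left)
  moreover have "Suc (Suc m) * Suc m div 2 = Suc m * m div 2 + Suc m"
    using tri_Suc[of "Suc m"] by simp
  ultimately have "qpoch (c / q ^ Suc m) q (Suc m) * q ^ (Suc (Suc m) * Suc m div 2)
     = (1 - c / q ^ Suc m) * q ^ Suc m * (qpoch (c / q ^ m) q m * q ^ (Suc m * m div 2))"
    by (simp only: power_add mult_ac)
  also have "\<dots> = (1 - c / q ^ Suc m) * q ^ Suc m * ((- c) ^ m * qpoch (q / c) q m)"
    by (simp only: Suc)
  also have "(1 - c / q ^ Suc m) * q ^ Suc m = q ^ Suc m - c"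
    using assms by (simp add: field_simps)
  also have "q ^ Suc m - c = (- c) * (1 - q / c * q ^ m)"
    using assms by (simp add: field_simps)
  finally show ?case by (simp add: qpoch_Suc)
qed simp

lemma qpoch_tendsto:
  assumes "cmod q < 1"
  shows "qpoch a q \<longlonglongrightarrow> qpoch_inf a q"
proof -
  have "abs_convergent_prod (\<lambda>j. 1 - a * q ^ j)"
    unfolding abs_convergent_prod_conv_summable using assms
    by (auto simp: norm_mult norm_power intro!: summable_mult summable_geometric)
  then have "convergent_prod (\<lambda>j. 1 - a * q ^ j)"
    by (rule abs_convergent_prod_imp_convergent_prod)
  then have "(\<lambda>n. \<Prod>j\<le>n. 1 - a * q ^ j) \<longlonglongrightarrow> qpoch_inf a q"
    unfolding qpoch_inf_def by (rule convergent_prod_LIMSEQ)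
  then have "(\<lambda>n. qpoch a q (Suc n)) \<longlonglongrightarrow> qpoch_inf a q"
    by (simp add: qpoch_def lessThan_Suc_atMost del: prod.lessThan_Suc)
  then show ?thesis by (rule filterlim_sequentially_Suc[THEN iffD1])
qed

lemma qpoch_inf_split:
  assumes "cmod q < 1"
  shows "qpoch_inf a q = qpoch a q n * qpoch_inf (a * q ^ n) q"
proof (rule LIMSEQ_unique)
  show "(\<lambda>m. qpoch a q (n + m)) \<longlonglongrightarrow> qpoch_inf a q"
    using LIMSEQ_ignore_initial_segment[OF qpoch_tendsto[OF assms], of a n] by (simp add: add.commute)
  show "(\<lambda>m. qpoch a q (n + m)) \<longlonglongrightarrow> qpoch a q n * qpoch_inf (a * q ^ n) q"
    unfolding qpoch_add by (intro tendsto_intros qpoch_tendsto assms)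
qed

lemma qpoch_inf_Suc: "cmod q < 1 \<Longrightarrow> qpoch_inf a q = (1 - a) * qpoch_inf (a * q) q"
  using qpoch_inf_split[of q a 1] by (simp add: qpoch_Suc)

lemma qpoch_inf_eq_0_iff:
  assumes "cmod q < 1"
  shows "qpoch_inf a q = 0 \<longleftrightarrow> (\<exists>n. a * q ^ n = 1)"
proof
  assume "\<exists>n. a * q ^ n = 1"
  then obtain n where "a * q ^ n = 1" by blast
  then have "qpoch a q (Suc n) = 0" by (simp add: qpoch_Suc)
  then show "qpoch_inf a q = 0" using qpoch_inf_split[OF assms, of a "Suc n"] by simp
next
  assume 0: "qpoch_inf a q = 0"
  have "abs_convergent_prod (\<lambda>j. 1 - a * q ^ j)"
    unfolding abs_convergent_prod_conv_summable using assms
    by (auto simp: norm_mult norm_power intro!: summable_mult summable_geometric)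
  then have "convergent_prod (\<lambda>j. 1 - a * q ^ j)"
    by (rule abs_convergent_prod_imp_convergent_prod)
  then show "\<exists>n. a * q ^ n = 1"
    using 0 prodinf_nonzero[of "\<lambda>j. 1 - a * q ^ j"] unfolding qpoch_inf_def by auto
qed

text \<open>By 1 + x <= exp x and the geometric series. The bound is free of n and uniform for a in
  a disc, as dominated limits require.\<close>

lemma norm_qpoch_le:
  assumes "cmod q < 1" "cmod a \<le> A"
  shows "cmod (qpoch a q n) \<le> exp (A / (1 - cmod q))"
proof -
  have A: "0 \<le> A" using assms(2) norm_ge_zero order_trans by blast
  have "cmod (qpoch a q n) \<le> (\<Prod>j<n. exp (A * cmod q ^ j))"
    unfolding qpoch_def prod_norm[symmetric]
  proof (rule prod_mono, safe)
    fix j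
    have "cmod (1 - a * q ^ j) \<le> 1 + cmod a * cmod q ^ j"
      by (metis norm_mult norm_one norm_power norm_triangle_ineq4)
    also have "\<dots> \<le> 1 + A * cmod q ^ j" using assms by (simp add: mult_right_mono)
    also have "\<dots> \<le> exp (A * cmod q ^ j)" by (rule exp_ge_add_one_self)
    finally show "cmod (1 - a * q ^ j) \<le> exp (A * cmod q ^ j)" .
  qed simp
  also have "\<dots> = exp (A * (\<Sum>j<n. cmod q ^ j))"
    by (simp add: exp_sum sum_distrib_left)
  also have "(\<Sum>j<n. cmod q ^ j) \<le> 1 / (1 - cmod q)"
    using sum_le_suminf[OF summable_geometric[of "cmod q"], of "{..<n}"] assms by (simp add: suminf_geometric)
  then have "exp (A * (\<Sum>j<n. cmod q ^ j)) \<le> exp (A / (1 - cmod q))"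
    using mult_left_mono[OF _ A] by fastforce
  finally show ?thesis .
qed

text \<open>The reciprocals converge because the infinite product is nonzero, and convergent
  sequences are bounded. No small factor has to be estimated by itself.\<close>

lemma norm_qpoch_ge:
  assumes "cmod q < 1" "\<And>n. a * q ^ n \<noteq> 1"
  obtains B where "B > 0" "\<And>n. cmod (qpoch a q n) \<ge> B"
proof -
  have nz: "qpoch_inf a q \<noteq> 0" using qpoch_inf_eq_0_iff[OF assms(1)] assms(2) by blast
  have "(\<lambda>n. inverse (qpoch a q n)) \<longlonglongrightarrow> inverse (qpoch_inf a q)"
    by (intro tendsto_inverse qpoch_tendsto assms nz)
  then have "Bseq (\<lambda>n. inverse (qpoch a q n))" by (rule Bseq_eq_bounded[THEN iffD2, OF convergent_imp_bounded])
  then obtain K where K: "K > 0" "\<And>n. cmod (inverse (qpoch a q n)) \<le> K" by (auto elim: BseqE)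
  have nzn: "qpoch a q n \<noteq> 0" for n using assms(2) by (auto simp: qpoch_eq_0_iff)
  have "cmod (qpoch a q n) \<ge> inverse K" for n
    using K(2)[of n] K(1) nzn[of n] by (simp add: norm_divide norm_inverse field_simps)
  then show ?thesis using K(1) by (intro that[of "inverse K"]) auto
qed

lemma qpoch_inf_holomorphic [holomorphic_intros]:
  assumes "cmod q < 1" "f holomorphic_on A"
  shows "(\<lambda>z. qpoch_inf (f z) q) holomorphic_on A"
proof -
  have "(\<lambda>z. qpoch_inf z q) holomorphic_on UNIV"
  proof (rule holomorphic_uniform_sequence[OF open_UNIV])
    show "(\<lambda>z. qpoch z q n) holomorphic_on UNIV" for n
      unfolding qpoch_def by (intro holomorphic_intros)
    fix x :: complex
    have "uniformly_convergent_on (cball x 1) (\<lambda>N z. \<Prod>n<N. 1 - z * q ^ n)"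
    proof (rule uniformly_convergent_on_prod')
      show "uniformly_convergent_on (cball x 1) (\<lambda>N z. \<Sum>n<N. cmod (1 - z * q ^ n - 1))"
      proof (rule Weierstrass_m_test'_ev)
        show "summable (\<lambda>n. (cmod x + 1) * cmod q ^ n)"
          using assms by (intro summable_mult summable_geometric) auto
        have "cmod z \<le> cmod x + 1" if "z \<in> cball x 1" for z
          using that norm_triangle_ineq2[of z x] by (simp add: dist_norm norm_minus_commute)
        then show "\<forall>\<^sub>F n in sequentially. \<forall>z\<in>cball x 1. norm (cmod (1 - z * q ^ n - 1)) \<le> (cmod x + 1) * cmod q ^ n"
          by (intro always_eventually) (auto simp: norm_mult norm_power intro!: mult_right_mono)
      qed
    qed (auto intro!: continuous_intros)
    then have "uniform_limit (cball x 1) (\<lambda>N z. qpoch z q N) (\<lambda>z. lim (\<lambda>N. qpoch z q N)) sequentially"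
      by (simp add: qpoch_def uniformly_convergent_uniform_limit_iff)
    moreover have "lim (\<lambda>N. qpoch z q N) = qpoch_inf z q" for z
      by (rule limI[OF qpoch_tendsto[OF assms(1)]])
    ultimately show "\<exists>d>0. cball x d \<subseteq> UNIV \<and> uniform_limit (cball x d) (\<lambda>n z. qpoch z q n) (\<lambda>z. qpoch_inf z q) sequentially"
      by (intro exI[of _ 1]) simp
  qed
  then have "((\<lambda>z. qpoch_inf z q) \<circ> f) holomorphic_on A"
    by (intro holomorphic_on_compose_gen[OF assms(2)]) auto
  then show ?thesis by (simp add: o_def)
qed

lemma qpoch_inf_tendsto [tendsto_intros]:
  assumes "cmod q < 1" "(f \<longlongrightarrow> c) F"
  shows "((\<lambda>x. qpoch_inf (f x) q) \<longlongrightarrow> qpoch_inf c q) F"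
proof -
  have "(\<lambda>z. qpoch_inf z q) holomorphic_on UNIV" by (intro holomorphic_intros assms)
  then have "isCont (\<lambda>z. qpoch_inf z q) c"
    using holomorphic_on_imp_continuous_on continuous_on_eq_continuous_at open_UNIV by blast
  then show ?thesis using assms(2) by (rule isCont_tendsto_compose)
qed

section \<open>Series with Gaussian coefficients\<close>

lemma tri_int_of_nat [simp]: "q powi (int m * (int m - 1) div 2) = (q :: 'a::field) ^ (m * (m - 1) div 2)"
proof -
  have "int m * (int m - 1) div 2 = int (m * (m - 1) div 2)"
    by (cases m) (simp_all add: zdiv_int algebra_simps)
  then show ?thesis by (simp only: power_int_of_nat)
qed

lemma tri_int_neg: "q powi ((- int m) * (- int m - 1) div 2) = (q :: 'a::field) ^ (Suc m * m div 2)"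
proof -
  have "(- int m) * (- int m - 1) div 2 = int (Suc m * m div 2)"
    by (simp add: zdiv_int algebra_simps)
  then show ?thesis by (simp only: power_int_of_nat)
qed

lemma tri_int_add: "(m + n) * (m + n - 1) div 2 = m * (m - 1) div 2 + n * (n - 1) div 2 + m * (n :: int)"
proof -
  have ev: "even (k * (k - 1))" for k :: int by simp
  have "(m + n) * (m + n - 1) = m * (m - 1) + n * (n - 1) + 2 * (m * n)"
    by (simp add: algebra_simps)
  then show ?thesis using ev[of m] ev[of n] by (auto elim!: evenE)
qed

text \<open>Successive terms have ratio \<open>A * t ^ n\<close>, which tends to 0 whatever
  \<open>A\<close> is, so the terms are even summable.\<close>

lemma gauss_power_bounded:
  fixes A t :: real
  assumes "0 \<le> t" "t < 1" "0 \<le> A"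
  obtains C where "C > 0" "\<And>n. A ^ n * t ^ (n * (n - 1) div 2) \<le> C"
proof -
  define f where "f = (\<lambda>n. A ^ n * t ^ (n * (n - 1) div 2))"
  have "(\<lambda>n. A * t ^ n) \<longlonglongrightarrow> A * 0"
    by (intro tendsto_intros) (use assms in auto)
  then have "\<forall>\<^sub>F n in sequentially. A * t ^ n < 1/2"
    by (rule order_tendstoD) simp
  then obtain N where N: "\<And>n. n \<ge> N \<Longrightarrow> A * t ^ n < 1/2" by (auto simp: eventually_sequentially)
  have "summable f"
  proof (rule summable_ratio_test[of "1/2" N])
    fix n assume n: "N \<le> n"
    have "f (Suc n) = A * t ^ n * f n"
      using tri_Suc[of n] by (simp add: f_def power_add)
    also have "\<dots> \<le> 1/2 * f n"
      using N[OF n] assms by (intro mult_right_mono) (auto simp: f_def)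
    finally show "norm (f (Suc n)) \<le> 1/2 * norm (f n)"
      using assms by (auto simp: f_def abs_mult)
  qed simp
  then have "Bseq f" using summable_LIMSEQ_zero convergentI convergent_imp_Bseq by blast
  then obtain C where "C > 0" "\<And>n. norm (f n) \<le> C" by (auto elim: BseqE)
  then show ?thesis by (intro that[of C]) (auto simp: f_def abs_le_iff)
qed

lemma summable_on_int_geometric:
  fixes t :: real
  assumes "0 \<le> t" "t < 1"
  shows "(\<lambda>n::int. t ^ nat \<bar>n\<bar>) summable_on UNIV"
proof -
  have g: "(\<lambda>n::nat. t ^ n) summable_on UNIV"
    by (intro norm_summable_imp_summable_on) (use assms in auto)
  have "(\<lambda>n::int. t ^ nat \<bar>n\<bar>) summable_on (range int)"
    by (subst summable_on_reindex) (use g in \<open>auto simp: o_def\<close>)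
  moreover have "(\<lambda>n::int. t ^ nat \<bar>n\<bar>) summable_on (range (\<lambda>n. - int n))"
    by (subst summable_on_reindex) (use g in \<open>auto simp: o_def inj_on_def\<close>)
  ultimately have "(\<lambda>n::int. t ^ nat \<bar>n\<bar>) summable_on (range int \<union> range (\<lambda>n. - int n))"
    by (rule summable_on_union)
  moreover have "n \<in> range int \<union> range (\<lambda>n. - int n)" for n
    by (cases n rule: int_cases2) auto
  then have "range int \<union> range (\<lambda>n. - int n) = UNIV" by blast
  ultimately show ?thesis by simp
qed

lemma abs_summable_on_int_geometric:
  fixes f :: "int \<Rightarrow> 'a :: banach"
  assumes "0 \<le> t" "t < 1" "\<And>n. norm (f n) \<le> C * t ^ nat \<bar>n\<bar>"
  shows "(\<lambda>n. norm (f n)) summable_on UNIV"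
  by (rule Infinite_Sum.abs_summable_on_comparison_test'[OF summable_on_cmult_right[OF summable_on_int_geometric]])
     (use assms in auto)

lemma int_nat_cases [case_names nonneg neg]:
  assumes "\<And>m. n = int m \<Longrightarrow> P" "\<And>m. n = - int m \<Longrightarrow> P"
  shows P
  using assms int_cases2 by metis

text \<open>The free base \<open>A\<close> lets later estimates absorb geometric growth of
  coefficients with a factor to spare. For n = -m the exponent is m(m-1)/2 + m, which accounts for
  the extra \<open>norm p\<close> in the second constant.\<close>

lemma gauss_powi_bounded:
  fixes p x :: "'a :: real_normed_field"
  assumes "0 < norm p" "norm p < 1" "x \<noteq> 0" "0 \<le> A"
  obtains C where "C > 0" "\<And>n. A ^ nat \<bar>n\<bar> * norm (p powi (n * (n - 1) div 2) * x powi n) \<le> C"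
proof -
  have A: "0 \<le> A * norm x" "0 \<le> A * norm p * inverse (norm x)" using assms by auto
  obtain C1 where C1: "C1 > 0" "\<And>n. (A * norm x) ^ n * norm p ^ (n * (n - 1) div 2) \<le> C1"
    by (rule gauss_power_bounded[of "norm p" "A * norm x"]) (use assms A in auto)
  obtain C2 where C2: "C2 > 0" "\<And>n. (A * norm p * inverse (norm x)) ^ n * norm p ^ (n * (n - 1) div 2) \<le> C2"
    by (rule gauss_power_bounded[of "norm p" "A * norm p * inverse (norm x)"]) (use assms A in auto)
  show ?thesis
  proof (rule that[of "max C1 C2"])
    fix n :: int
    show "A ^ nat \<bar>n\<bar> * norm (p powi (n * (n - 1) div 2) * x powi n) \<le> max C1 C2"
    proof (cases n rule: int_nat_cases)
      case (nonneg m)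
      then have "A ^ nat \<bar>n\<bar> * norm (p powi (n * (n - 1) div 2) * x powi n) = (A * norm x) ^ m * norm p ^ (m * (m - 1) div 2)"
        by (simp add: norm_mult norm_power power_mult_distrib)
      then show ?thesis using C1(2)[of m] unfolding le_max_iff_disj by simp
    next
      case (neg m)
      have "x powi n = inverse x ^ m" using neg by (simp add: power_int_minus power_inverse)
      then have "A ^ nat \<bar>n\<bar> * norm (p powi (n * (n - 1) div 2) * x powi n)
          = A ^ m * (norm p ^ (Suc m * m div 2) * inverse (norm x) ^ m)"
        using neg by (simp only: tri_int_neg norm_mult norm_power norm_inverse) simp
      also have "\<dots> = (A * norm p * inverse (norm x)) ^ m * norm p ^ (m * (m - 1) div 2)"
        using tri_Suc[of m] by (simp add: power_add power_mult_distrib)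
      finally show ?thesis using C2(2)[of m] unfolding le_max_iff_disj by simp
    qed
  qed (use C1 in auto)
qed

lemma gauss_series_abs_summable:
  fixes p x :: "'a :: {real_normed_field, banach}"
  assumes "0 < norm p" "norm p < 1" "x \<noteq> 0" "0 \<le> A" and c: "\<And>n. norm (c n) \<le> C * A ^ nat \<bar>n\<bar>"
  shows "(\<lambda>n. norm (c n * p powi (n * (n - 1) div 2) * x powi n)) summable_on UNIV"
proof -
  \<comment> \<open>Bounding with \<open>2 * A\<close> in place of \<open>A\<close> leaves (1/2)^|n|
    over as a summable majorant.\<close>
  obtain K where K: "K > 0" "\<And>n. (2 * A) ^ nat \<bar>n\<bar> * norm (p powi (n * (n - 1) div 2) * x powi n) \<le> K"
    by (rule gauss_powi_bounded[of p x "2 * A"]) (use assms in auto)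
  have C: "0 \<le> C" using c[of 0] by (auto intro: order_trans[OF norm_ge_zero])
  show ?thesis
  proof (rule abs_summable_on_int_geometric[of "1/2"])
    fix n :: int
    let ?y = "norm (p powi (n * (n - 1) div 2) * x powi n)"
    have "norm (c n * p powi (n * (n - 1) div 2) * x powi n) = norm (c n) * ?y"
      by (simp add: norm_mult mult.assoc)
    also have "\<dots> \<le> C * A ^ nat \<bar>n\<bar> * ?y" by (intro mult_right_mono c) auto
    also have "\<dots> = C * (1/2) ^ nat \<bar>n\<bar> * ((2 * A) ^ nat \<bar>n\<bar> * ?y)"
      by (simp add: power_mult_distrib power_divide)
    also have "\<dots> \<le> C * (1/2) ^ nat \<bar>n\<bar> * K"
      by (intro mult_left_mono K) (use C in auto)
    finally show "norm (c n * p powi (n * (n - 1) div 2) * x powi n) \<le> (C * K) * (1/2) ^ nat \<bar>n\<bar>"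
      by (simp add: mult_ac)
  qed auto
qed

lemma infsum_int_split:
  fixes f :: "int \<Rightarrow> complex"
  assumes "(\<lambda>n. norm (f n)) summable_on UNIV"
  shows "infsum f UNIV = (\<Sum>n. f (int n)) + (\<Sum>n. f (- int (Suc n)))"
    and "summable (\<lambda>n. f (int n))" and "summable (\<lambda>n. f (- int (Suc n)))"
proof -
  have s: "f summable_on A" for A
    using summable_on_subset_banach[OF abs_summable_summable[OF assms]] by auto
  have inj: "inj (\<lambda>n. - int (Suc n))" by (auto simp: inj_on_def)
  have 1: "(f has_sum (infsum f (range int))) (range int)" using s by auto
  have 2: "(f has_sum (infsum f (range (\<lambda>n. - int (Suc n))))) (range (\<lambda>n. - int (Suc n)))" using s by auto
  have 3: "(\<lambda>n. f (int n)) sums infsum f (range int)"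
    using 1 by (subst (asm) has_sum_reindex) (auto simp: o_def intro!: has_sum_imp_sums)
  have 4: "(\<lambda>n. f (- int (Suc n))) sums infsum f (range (\<lambda>n. - int (Suc n)))"
    using 2 by (subst (asm) has_sum_reindex[OF inj]) (auto simp: o_def intro!: has_sum_imp_sums)
  have "n \<in> range int \<union> range (\<lambda>n. - int (Suc n))" for n
    by (cases n rule: int_cases) auto
  then have U: "range int \<union> range (\<lambda>n. - int (Suc n)) = UNIV" by blast
  have "infsum f (range int \<union> range (\<lambda>n. - int (Suc n))) = infsum f (range int) + infsum f (range (\<lambda>n. - int (Suc n)))"
    by (rule infsum_Un_disjoint[OF s s]) auto
  then show "infsum f UNIV = (\<Sum>n. f (int n)) + (\<Sum>n. f (- int (Suc n)))"
    using 3 4 unfolding U by (simp add: sums_iff)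
  show "summable (\<lambda>n. f (int n))" "summable (\<lambda>n. f (- int (Suc n)))"
    using 3 4 by (auto simp: sums_iff)
qed

lemma entire_power_series_holomorphic:
  fixes c :: "nat \<Rightarrow> complex"
  assumes "\<And>x. x \<noteq> 0 \<Longrightarrow> summable (\<lambda>n. c n * x ^ n)"
  shows "(\<lambda>x. \<Sum>n. c n * x ^ n) holomorphic_on A"
proof -
  have "conv_radius c = \<infinity>"
  proof (rule conv_radius_inftyI'')
    fix z :: complex
    show "summable (\<lambda>n. c n * z ^ n)"
      by (cases "z = 0") (use assms in \<open>auto simp: summable_0_powser\<close>)
  qed
  then have "eval_fps (Abs_fps c) holomorphic_on A"
    by (intro holomorphic_on_eval_fps) (auto simp: fps_conv_radius_def)
  then show ?thesis by (simp add: eval_fps_def cong: holomorphic_cong)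
qed

text \<open>A Laurent series whose halves both converge everywhere: an entire function of x plus 1/x
  times an entire function of 1/x.\<close>

lemma gauss_series_holomorphic:
  fixes p :: complex
  assumes "0 < norm p" "norm p < 1" "0 \<le> A" and c: "\<And>n. norm (c n) \<le> C * A ^ nat \<bar>n\<bar>"
  shows "(\<lambda>x. \<Sum>\<^sub>\<infinity>n::int. c n * p powi (n * (n - 1) div 2) * x powi n) holomorphic_on - {0}"
proof -
  note s = gauss_series_abs_summable[OF assms(1,2) _ assms(3) c]
  define d where "d n = c (int n) * p powi (int n * (int n - 1) div 2)" for n
  define e where "e n = c (- int (Suc n)) * p powi (- int (Suc n) * (- int (Suc n) - 1) div 2)" for n
  have eq: "(\<Sum>\<^sub>\<infinity>n::int. c n * p powi (n * (n - 1) div 2) * x powi n) = (\<Sum>n. d n * x ^ n) + inverse x * (\<Sum>n. e n * inverse x ^ n)"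
    and sd: "summable (\<lambda>n. d n * x ^ n)" and se: "summable (\<lambda>n. e n * inverse x ^ n)" if x: "x \<noteq> 0" for x
  proof -
    have e': "c (- int (Suc n)) * p powi (- int (Suc n) * (- int (Suc n) - 1) div 2) * x powi (- int (Suc n))
       = inverse x * (e n * inverse x ^ n)" for n
      unfolding e_def power_int_minus power_int_of_nat by (simp add: power_inverse)
    have d': "c (int n) * p powi (int n * (int n - 1) div 2) * x powi (int n) = d n * x ^ n" for n
      unfolding d_def power_int_of_nat by simp
    note * = infsum_int_split[OF s[OF x], unfolded d' e']
    show sd: "summable (\<lambda>n. d n * x ^ n)" by (rule *(2))
    show se: "summable (\<lambda>n. e n * inverse x ^ n)"
      using *(3) x by (simp add: summable_cmult_iff)
    show "(\<Sum>\<^sub>\<infinity>n::int. c n * p powi (n * (n - 1) div 2) * x powi n) = (\<Sum>n. d n * x ^ n) + inverse x * (\<Sum>n. e n * inverse x ^ n)"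
      using *(1) suminf_mult[OF se, of "inverse x"] by simp
  qed
  have hd: "(\<lambda>x. \<Sum>n. d n * x ^ n) holomorphic_on - {0}"
    by (rule entire_power_series_holomorphic) (use sd in auto)
  have se': "summable (\<lambda>n. e n * x ^ n)" if "x \<noteq> 0" for x
    using se[of "inverse x"] that by simp
  have "(\<lambda>x. \<Sum>n. e n * x ^ n) \<circ> inverse holomorphic_on - {0}"
    by (rule holomorphic_on_compose_gen[OF _ entire_power_series_holomorphic[of _ UNIV]])
       (auto intro!: holomorphic_intros se')
  then have he: "(\<lambda>x. \<Sum>n. e n * inverse x ^ n) holomorphic_on - {0}" by (simp add: o_def)
  have "(\<lambda>x. (\<Sum>n. d n * x ^ n) + inverse x * (\<Sum>n. e n * inverse x ^ n)) holomorphic_on - {0}"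
    by (intro holomorphic_intros hd he) auto
  then show ?thesis
    by (rule holomorphic_transform) (use eq in auto)
qed

section \<open>The Jacobi triple product and zeros of the theta function\<close>

text \<open>The common shape of three passages to the limit below (triple product, Kronecker sum,
  partial fractions of R): truncation multiplies each term of the infinite series by a bounded
  correction, and the limit of the correction does not depend on the index, so it factors
  out.\<close>

lemma tannery_weighted_sums:
  fixes t :: "'a \<Rightarrow> complex"
  assumes t: "(\<lambda>x. norm (t x)) summable_on UNIV"
    and fin: "\<And>N. finite (S N)" and ev: "\<And>x. \<forall>\<^sub>F N in sequentially. x \<in> S N"
    and bound: "\<And>N x. x \<in> S N \<Longrightarrow> norm (w N x) \<le> K"
    and lim: "\<And>x. (\<lambda>N. w N x) \<longlonglongrightarrow> W"
  shows "(\<lambda>N. \<Sum>x\<in>S N. t x * w N x) \<longlonglongrightarrow> infsum t UNIV * W"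
proof -
  define f where "f N x = (if x \<in> S N then t x * w N x else 0)" for N x
  have "norm (t x) * norm (w N x) \<le> norm (t x) * \<bar>K\<bar>" if "x \<in> S N" for N x
    using bound[OF that] by (intro mult_left_mono) auto
  then have "norm (f N x) \<le> norm (t x) * \<bar>K\<bar>" for N x
    by (auto simp: f_def norm_mult)
  moreover have "(\<lambda>N. f N x) \<longlonglongrightarrow> t x * W" for x
  proof (rule Lim_transform_eventually[of "\<lambda>N. t x * w N x"])
    show "\<forall>\<^sub>F N in sequentially. t x * w N x = f N x"
      using ev[of x] by eventually_elim (simp add: f_def)
  qed (intro tendsto_intros lim)
  moreover have "(\<lambda>x. norm (t x) * \<bar>K\<bar>) summable_on UNIV"
    by (rule summable_on_cmult_left) (rule t)
  ultimately have "(\<lambda>N. infsum (f N) UNIV) \<longlonglongrightarrow> (\<Sum>\<^sub>\<infinity>x. t x * W)"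
    by (intro infsum_tannery) auto
  moreover have "infsum (f N) UNIV = (\<Sum>x\<in>S N. t x * w N x)" for N
  proof -
    have "infsum (f N) UNIV = infsum (f N) (S N)"
      by (rule infsum_cong_neutral) (auto simp: f_def)
    then show ?thesis using fin[of N] by (simp add: f_def)
  qed
  moreover have "(\<Sum>\<^sub>\<infinity>x. t x * W) = infsum t UNIV * W"
    by (rule infsum_cmult_left) (use abs_summable_summable[OF t] in auto)
  ultimately show ?thesis by simp
qed

lemma qpoch_self_nonzero: "cmod q < 1 \<Longrightarrow> qpoch q q n \<noteq> 0"
proof
  assume q: "cmod q < 1" and "qpoch q q n = 0"
  then obtain j where "q ^ Suc j = 1" by (auto simp: qpoch_eq_0_iff)
  then have "cmod q ^ Suc j = 1" by (metis norm_one norm_power)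
  moreover have "cmod q ^ Suc j < 1" using q calculation by (intro power_Suc_less_one) (cases "q = 0", auto)
  ultimately show False by simp
qed

lemma self_power_neq_1: "cmod q < 1 \<Longrightarrow> q * q ^ n \<noteq> 1"
  using qpoch_self_nonzero[of q "Suc n"] by (auto simp: qpoch_Suc)

lemma qpoch_inf_self_nonzero: "cmod q < 1 \<Longrightarrow> qpoch_inf q q \<noteq> 0"
  using self_power_neq_1 by (simp add: qpoch_inf_eq_0_iff)

text \<open>Splitting off the first factor 1 + x leaves the product of length M at
  \<open>x * q\<close>, which is why the induction keeps x arbitrary. Comparing coefficients then
  amounts to Pascal's rule for Gaussian binomials.\<close>

lemma qbinomial_theorem:
  assumes q: "cmod q < 1"
  shows "qpoch (- x) q M = (\<Sum>k\<le>M. q ^ (k * (k - 1) div 2) * (qpoch q q M / (qpoch q q k * qpoch q q (M - k))) * x ^ k)"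
proof (induction M arbitrary: x)
  case (Suc M)
  note nz = qpoch_self_nonzero[OF q]
  \<comment> \<open>Extended by zero above M, so that Pascal's rule also holds at k = M.\<close>
  define g where "g M k = (if k \<le> M then qpoch q q M / (qpoch q q k * qpoch q q (M - k)) else 0)" for M k
  have pascal: "g (Suc M) (Suc k) = q ^ Suc k * g M (Suc k) + g M k" if "k \<le> M" for k
  proof (cases "k = M")
    case False
    then have "k < M" using that by simp
    then obtain d where d: "M = Suc (k + d)" using less_imp_Suc_add by blast
    have e: "1 - q * q ^ M = q ^ Suc k * (1 - q * q ^ d) + (1 - q * q ^ k)"
      by (simp add: d power_add algebra_simps)
    have "g (Suc M) (Suc k) = qpoch q q M * (1 - q * q ^ M) / (qpoch q q (Suc k) * qpoch q q (Suc d))"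
      using d by (simp add: g_def qpoch_Suc)
    also have "\<dots> = q ^ Suc k * (qpoch q q M * (1 - q * q ^ d) / (qpoch q q (Suc k) * qpoch q q (Suc d)))
        + qpoch q q M * (1 - q * q ^ k) / (qpoch q q (Suc k) * qpoch q q (Suc d))"
      unfolding e by (simp only: distrib_left add_divide_distrib times_divide_eq_right mult_ac)
    also have "qpoch q q M * (1 - q * q ^ d) / (qpoch q q (Suc k) * qpoch q q (Suc d)) = g M (Suc k)"
      using d nz[of "Suc d"] by (simp add: g_def qpoch_Suc)
    also have "qpoch q q M * (1 - q * q ^ k) / (qpoch q q (Suc k) * qpoch q q (Suc d)) = g M k"
      using d nz[of "Suc k"] by (simp add: g_def qpoch_Suc Suc_diff_le)
    finally show ?thesis .
  qed (use nz[of M] nz[of "Suc M"] in \<open>simp add: g_def\<close>)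
  define c where "c M k = q ^ (k * (k - 1) div 2) * g M k" for M k
  have rec: "c (Suc M) (Suc k) = q ^ Suc k * c M (Suc k) + q ^ k * c M k" if "k \<le> M" for k
    using pascal[OF that] tri_Suc[of k] by (simp add: c_def power_add algebra_simps)
  have c0: "c (Suc M) 0 = 1" "c M 0 = 1" using nz by (simp_all add: c_def g_def)
  have cM: "c M (Suc M) = 0" by (simp add: c_def g_def)
  have IH: "qpoch (- x) q M = (\<Sum>k\<le>M. c M k * x ^ k)" for x
    unfolding Suc.IH c_def g_def by (intro sum.cong) auto
  have "(\<Sum>k\<le>M. c M k * (x * q) ^ k) = (\<Sum>k\<le>Suc M. c M k * (x * q) ^ k)"
    by (simp add: cM)
  also have "\<dots> = 1 + (\<Sum>k\<le>M. c M (Suc k) * (x * q) ^ Suc k)"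
    by (subst sum.atMost_Suc_shift) (simp add: c0)
  finally have S1: "(\<Sum>k\<le>M. c M k * (x * q) ^ k) = 1 + (\<Sum>k\<le>M. c M (Suc k) * (x * q) ^ Suc k)" .
  have S2: "x * (\<Sum>k\<le>M. c M k * (x * q) ^ k) = (\<Sum>k\<le>M. q ^ k * c M k * x ^ Suc k)"
    by (simp add: sum_distrib_left power_mult_distrib mult_ac)
  have "qpoch (- x) q (Suc M) = (1 + x) * qpoch (- (x * q)) q M"
    by (simp add: qpoch_Suc_left)
  also have "\<dots> = (\<Sum>k\<le>M. c M k * (x * q) ^ k) + x * (\<Sum>k\<le>M. c M k * (x * q) ^ k)"
    unfolding IH by (simp add: distrib_right)
  also have "\<dots> = 1 + (\<Sum>k\<le>M. c M (Suc k) * (x * q) ^ Suc k) + (\<Sum>k\<le>M. q ^ k * c M k * x ^ Suc k)"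
    unfolding S2 by (simp only: S1)
  also have "\<dots> = 1 + (\<Sum>k\<le>M. c (Suc M) (Suc k) * x ^ Suc k)"
    unfolding add.assoc sum.distrib[symmetric]
    by (intro arg_cong2[where f = "(+)"] sum.cong refl) (auto simp: rec power_mult_distrib algebra_simps)
  also have "\<dots> = (\<Sum>k\<le>Suc M. c (Suc M) k * x ^ k)"
    by (subst sum.atMost_Suc_shift) (simp add: c0)
  also have "\<dots> = (\<Sum>k\<le>Suc M. q ^ (k * (k - 1) div 2) * (qpoch q q (Suc M) / (qpoch q q k * qpoch q q (Suc M - k))) * x ^ k)"
    unfolding c_def g_def by (intro sum.cong) auto
  finally show ?case .
qed simp

lemma sum_int_shift:
  "(\<Sum>n = - int N..int N. f n) = (\<Sum>m\<le>2 * N. f (int m - int N))"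
  by (rule sum.reindex_bij_witness[of _ "\<lambda>m. int m - int N" "\<lambda>n. nat (n + int N)"]) auto

text \<open>The product form (x, q/x; q)_infinity without the constant (q;q)_infinity. Its zeros are
  the powers of q, whereas those of \<open>qtheta\<close> are their negatives; it is the form in
  which the Kronecker sum has no signs.\<close>

definition theta_prod :: "complex \<Rightarrow> complex \<Rightarrow> complex" where
  "theta_prod q x = qpoch_inf x q * qpoch_inf (q / x) q"

text \<open>The q-binomial theorem of length 2N at x/q^N. Reflection turns the first N factors into
  those of q/x, and recentring the summation index by N makes the sum symmetric.\<close>

lemma finite_jacobi_triple_product:
  assumes q: "q \<noteq> 0" "cmod q < 1" and x: "x \<noteq> 0"
  shows "qpoch (- x) q N * qpoch (- (q / x)) q N =
    (\<Sum>n = - int N..int N. q powi (n * (n - 1) div 2) * x powi n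
       * (qpoch q q (2 * N) / (qpoch q q (nat (int N + n)) * qpoch q q (nat (int N - n)))))"
proof -
  let ?b = "\<lambda>m. qpoch q q (2 * N) / (qpoch q q m * qpoch q q (2 * N - m))"
  have "qpoch (- x / q ^ N) q N * q ^ (Suc N * N div 2) = x ^ N * qpoch (- (q / x)) q N"
    using qpoch_reflect[of "- x" q N] x q by simp
  moreover have "qpoch (- (x / q ^ N)) q (2 * N) = qpoch (- x / q ^ N) q N * qpoch (- x) q N"
    using qpoch_add[of "- (x / q ^ N)" q N N] q by (simp add: mult_2)
  ultimately have "x ^ N * (qpoch (- x) q N * qpoch (- (q / x)) q N) = q ^ (Suc N * N div 2) * qpoch (- (x / q ^ N)) q (2 * N)"
    by (simp add: mult_ac)
  also have "\<dots> = (\<Sum>m\<le>2 * N. q ^ (Suc N * N div 2) * (q ^ (m * (m - 1) div 2) * ?b m * (x / q ^ N) ^ m))"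
    by (simp only: qbinomial_theorem[OF q(2)] sum_distrib_left)
  finally have *: "qpoch (- x) q N * qpoch (- (q / x)) q N =
     (\<Sum>m\<le>2 * N. q ^ (Suc N * N div 2) * (q ^ (m * (m - 1) div 2) * ?b m * (x / q ^ N) ^ m)) / x ^ N"
    using x by (simp add: field_simps)
  have **: "q ^ (Suc N * N div 2) * (q ^ (m * (m - 1) div 2) * ?b m * (x / q ^ N) ^ m) / x ^ N
     = q powi ((int m - int N) * (int m - int N - 1) div 2) * x powi (int m - int N) * ?b m" for m
  proof -
    have "(int m - int N) * (int m - int N - 1) div 2
       = int m * (int m - 1) div 2 + (- int N) * (- int N - 1) div 2 - int m * int N"
      using tri_int_add[of "int m" "- int N"] by simp
    then have "q powi ((int m - int N) * (int m - int N - 1) div 2)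
       = q ^ (m * (m - 1) div 2) * q ^ (Suc N * N div 2) / q ^ (m * N)"
      using q(1) by (simp only: power_int_add power_int_diff tri_int_neg tri_int_of_nat of_nat_mult[symmetric] power_int_of_nat simp_thms)
    moreover have "x powi (int m - int N) = x ^ m / x ^ N"
      using x by (simp add: power_int_diff)
    moreover have "(x / q ^ N) ^ m = x ^ m / q ^ (m * N)"
      by (simp add: power_divide power_mult[symmetric] mult.commute)
    ultimately show ?thesis by (simp add: mult_ac)
  qed
  have "qpoch (- x) q N * qpoch (- (q / x)) q N =
     (\<Sum>m\<le>2 * N. q powi ((int m - int N) * (int m - int N - 1) div 2) * x powi (int m - int N) * ?b m)"
    unfolding * sum_divide_distrib ** ..
  also have "\<dots> = (\<Sum>n = - int N..int N. q powi (n * (n - 1) div 2) * x powi n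
       * (qpoch q q (2 * N) / (qpoch q q (nat (int N + n)) * qpoch q q (nat (int N - n)))))"
    unfolding sum_int_shift
  proof (intro sum.cong refl)
    fix m assume "m \<in> {..2 * N}"
    then have "nat (int N + (int m - int N)) = m" "nat (int N - (int m - int N)) = 2 * N - m" by auto
    then show "q powi ((int m - int N) * (int m - int N - 1) div 2) * x powi (int m - int N) * ?b m =
      q powi ((int m - int N) * (int m - int N - 1) div 2) * x powi (int m - int N) *
      (qpoch q q (2 * N) / (qpoch q q (nat (int N + (int m - int N))) * qpoch q q (nat (int N - (int m - int N)))))"
      by simp
  qed
  finally show ?thesis .
qed

lemma theta_abs_summable:
  fixes q x :: "'a :: {real_normed_field, banach}"
  assumes "0 < norm q" "norm q < 1" "x \<noteq> 0"
  shows "(\<lambda>n. norm (q powi (n * (n - 1) div 2) * x powi n)) summable_on UNIV"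
  using gauss_series_abs_summable[OF assms, of 1 "\<lambda>_. 1" 1] by simp

lemma tendsto_int_nat_sequences:
  assumes "f \<longlonglongrightarrow> l"
  shows "(\<lambda>N. f (nat (int N + n))) \<longlonglongrightarrow> l" "(\<lambda>N. f (nat (int N - n))) \<longlonglongrightarrow> l"
proof -
  have "filterlim (\<lambda>N. nat (int N + n)) sequentially sequentially" for n
    unfolding filterlim_at_top
  proof safe
    fix Z show "\<forall>\<^sub>F N in sequentially. Z \<le> nat (int N + n)"
      using eventually_ge_at_top[of "Z + nat \<bar>n\<bar>"] by eventually_elim auto
  qed
  from this[of n] this[of "- n"]
  show "(\<lambda>N. f (nat (int N + n))) \<longlonglongrightarrow> l" "(\<lambda>N. f (nat (int N - n))) \<longlonglongrightarrow> l"
    using filterlim_compose[OF assms] by auto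
qed

lemma eventually_in_int_interval: "\<forall>\<^sub>F N in sequentially. n \<in> {- int N..int N}"
  using eventually_ge_at_top[of "nat \<bar>n\<bar>"] by eventually_elim auto

theorem jacobi_triple_product:
  assumes q: "q \<noteq> 0" "cmod q < 1" and x: "x \<noteq> 0"
  shows "qtheta q x = qpoch_inf q q * theta_prod q (- x)"
proof -
  define w where "w N n = qpoch q q (2 * N) / (qpoch q q (nat (int N + n)) * qpoch q q (nat (int N - n)))" for N n
  note Q = qpoch_tendsto[OF q(2), of q] qpoch_inf_self_nonzero[OF q(2)]
  have lim: "(\<lambda>N. w N n) \<longlonglongrightarrow> qpoch_inf q q / (qpoch_inf q q * qpoch_inf q q)" for n
    unfolding w_def using Q
    by (intro tendsto_intros tendsto_int_nat_sequences filterlim_compose[OF Q(1)] filterlim_subseq)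
       (auto simp: strict_mono_def)
  obtain B where B: "B > 0" "\<And>n. cmod (qpoch q q n) \<ge> B"
    using norm_qpoch_ge[OF q(2) self_power_neq_1[OF q(2)]] by blast
  have wb: "cmod (w N n) \<le> exp (1 / (1 - cmod q)) / (B * B)" for N n
    unfolding w_def norm_divide norm_mult
    by (intro frac_le mult_mono norm_qpoch_le) (use q B in auto)
  have "(\<lambda>N. \<Sum>n = - int N..int N. q powi (n * (n - 1) div 2) * x powi n * w N n)
     \<longlonglongrightarrow> qtheta q x * (qpoch_inf q q / (qpoch_inf q q * qpoch_inf q q))"
    unfolding qtheta_def
    by (rule tannery_weighted_sums[OF theta_abs_summable _ eventually_in_int_interval wb lim]) (use q x in auto)
  moreover have "(\<lambda>N. qpoch (- x) q N * qpoch (- (q / x)) q N) \<longlonglongrightarrow> theta_prod q (- x)"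
    unfolding theta_prod_def using qpoch_tendsto[OF q(2), of "-(q/x)"]
    by (intro tendsto_intros qpoch_tendsto q) simp
  ultimately have "qtheta q x * (qpoch_inf q q / (qpoch_inf q q * qpoch_inf q q)) = theta_prod q (- x)"
    unfolding finite_jacobi_triple_product[OF q x] w_def by (rule LIMSEQ_unique)
  then show ?thesis using Q(2) by (simp add: field_simps)
qed

lemma qtheta_holomorphic:
  assumes q: "q \<noteq> 0" "cmod q < 1"
  shows "qtheta q holomorphic_on - {0}"
  using gauss_series_holomorphic[of q 1 "\<lambda>_. 1" 1] assms by (simp add: qtheta_def[abs_def])

lemma qtheta_shift:
  fixes q x :: complex
  assumes q: "q \<noteq> 0" and x: "x \<noteq> 0"
  shows "qtheta q (x * q powi n) = qtheta q x / (q powi (n * (n - 1) div 2) * x powi n)"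
proof -
  have "qtheta q x = (\<Sum>\<^sub>\<infinity>m::int. q powi ((m + n) * (m + n - 1) div 2) * x powi (m + n))"
    unfolding qtheta_def
    by (rule infsum_reindex_bij_witness[of _ "\<lambda>m. m + n" "\<lambda>m. m - n"]) auto
  also have "\<dots> = (\<Sum>\<^sub>\<infinity>m::int. (q powi (n * (n - 1) div 2) * x powi n) * (q powi (m * (m - 1) div 2) * (x * q powi n) powi m))"
  proof (rule infsum_cong)
    fix m
    have "(q powi n) powi m = q powi (m * n)" by (simp add: power_int_mult[symmetric] mult.commute)
    then show "q powi ((m + n) * (m + n - 1) div 2) * x powi (m + n) =
        (q powi (n * (n - 1) div 2) * x powi n) * (q powi (m * (m - 1) div 2) * (x * q powi n) powi m)"
      using q x by (simp add: tri_int_add power_int_add power_int_mult_distrib mult_ac)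
  qed
  also have "\<dots> = (q powi (n * (n - 1) div 2) * x powi n) * qtheta q (x * q powi n)"
    unfolding qtheta_def by (rule infsum_cmult_right')
  finally show ?thesis using q x by simp
qed

lemma qtheta_reflect:
  fixes q x :: complex
  assumes q: "q \<noteq> 0"
  shows "qtheta q (q / x) = qtheta q x"
  unfolding qtheta_def
proof (rule infsum_reindex_bij_witness[of _ uminus uminus])
  fix n :: int
  have "(- n) * (- n - 1) div 2 = n * (n - 1) div 2 + n"
  proof -
    have "(- n) * (- n - 1) = n * (n - 1) + n * 2" by (simp add: algebra_simps)
    then show ?thesis by (metis div_mult_self1 zero_neq_numeral add.commute)
  qed
  then show "q powi (- n * (- n - 1) div 2) * x powi - n = q powi (n * (n - 1) div 2) * (q / x) powi n"
    using q by (simp add: power_int_add power_int_mult_distrib power_int_inverse power_int_minus divide_inverse)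
qed auto

lemma theta_prod_eq_0_iff:
  assumes q: "q \<noteq> 0" "cmod q < 1" and x: "x \<noteq> 0"
  shows "theta_prod q x = 0 \<longleftrightarrow> (\<exists>n. x = q powi n)"
proof
  assume "theta_prod q x = 0"
  then consider n where "x * q ^ n = 1" | n where "q / x * q ^ n = 1"
    unfolding theta_prod_def using q by (auto simp: qpoch_inf_eq_0_iff)
  then show "\<exists>n. x = q powi n"
  proof cases
    case (1 n)
    then show ?thesis using q by (intro exI[of _ "- int n"]) (simp add: power_int_minus field_simps)
  next
    case (2 n)
    then show ?thesis using q x by (intro exI[of _ "int (Suc n)"]) (simp only: power_int_of_nat, simp add: field_simps)
  qed
next
  assume "\<exists>n. x = q powi n"
  then obtain n where n: "x = q powi n" by blast
  show "theta_prod q x = 0"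
  proof (cases "n \<le> 0")
    case True
    then have "x * q ^ nat (- n) = 1"
      using n q by (cases "n = 0") (simp_all add: power_int_def power_mult_distrib[symmetric])
    then show ?thesis unfolding theta_prod_def using q by (auto simp: qpoch_inf_eq_0_iff)
  next
    case False
    moreover from this have "Suc (nat (n - 1)) = nat n" by auto
    ultimately have "x = q ^ Suc (nat (n - 1))" using n by (simp only: power_int_def) simp
    then have "q / x * q ^ nat (n - 1) = 1" using q x by simp
    then show ?thesis unfolding theta_prod_def using q by (auto simp: qpoch_inf_eq_0_iff)
  qed
qed

lemma qtheta_eq_0_iff:
  assumes "q \<noteq> 0" "cmod q < 1" "x \<noteq> 0"
  shows "qtheta q x = 0 \<longleftrightarrow> (\<exists>n. x = - (q powi n))"
proof -
  have "(- x = q powi n) = (x = - (q powi n))" for n by (metis minus_minus)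
  then show ?thesis
    using theta_prod_eq_0_iff[of q "- x"] qpoch_inf_self_nonzero[of q] assms
    by (simp add: jacobi_triple_product)
qed

lemma theta_prod_holomorphic:
  assumes "cmod q < 1"
  shows "theta_prod q holomorphic_on - {0}"
  unfolding theta_prod_def[abs_def] using assms by (intro holomorphic_intros) auto

text \<open>Quasi-periodicity moves the zero to -1, where the triple product shows the single
  vanishing factor 1 + y. The cofactor \<open>h\<close> collects the remaining factors; at the zero
  its numerator is the cube of (q;q)_infinity.\<close>

lemma qtheta_simple_zero:
  assumes q: "q \<noteq> 0" "cmod q < 1"
  obtains h where "h holomorphic_on - {0}" "h (- (q powi n)) \<noteq> 0"
    "\<And>x. x \<noteq> 0 \<Longrightarrow> qtheta q x = (x - (- (q powi n))) * h x"
proof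
  define h where "h x = qpoch_inf q q * qpoch_inf (- (x / q powi n) * q) q * qpoch_inf (- (q / (x / q powi n))) q
     / (q powi n * q powi (n * (n - 1) div 2) * (x / q powi n) powi n)" for x
  show "h holomorphic_on - {0}"
    unfolding h_def using q by (intro holomorphic_intros) auto
  show "h (- (q powi n)) \<noteq> 0"
    using q qpoch_inf_self_nonzero[of q] by (simp add: h_def)
  fix x :: complex assume x: "x \<noteq> 0"
  define y where "y = x / q powi n"
  have y: "y \<noteq> 0" "x = y * q powi n" using x q by (auto simp: y_def)
  have "qtheta q x = qtheta q y / (q powi (n * (n - 1) div 2) * y powi n)"
    unfolding y(2) by (rule qtheta_shift) (use q y in auto)
  also have "qtheta q y = qpoch_inf q q * ((1 + y) * qpoch_inf (- y * q) q * qpoch_inf (- (q / y)) q)"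
    using jacobi_triple_product[OF q y(1)] qpoch_inf_Suc[OF q(2), of "- y"] by (simp add: theta_prod_def)
  also have "1 + y = (x - (- (q powi n))) / q powi n" using y q by (simp add: field_simps)
  finally show "qtheta q x = (x - (- (q powi n))) * h x"
    unfolding h_def y_def[symmetric] by (simp add: mult_ac)
qed

section \<open>Partial fractions and the Kronecker sum\<close>

text \<open>Lagrange interpolation: with denominators cleared, both sides are polynomials of degree
  below \<open>card I\<close> that agree at the distinct points 1/alpha_i, where only the i-th
  summand of \<open>Q\<close> survives.\<close>

lemma partial_fractions:
  fixes \<alpha> :: "'i \<Rightarrow> complex"
  assumes fin: "finite I" and inj: "inj_on \<alpha> I" and nz: "\<And>i. i \<in> I \<Longrightarrow> \<alpha> i \<noteq> 0"
    and deg: "degree p < card I" and t: "\<And>i. i \<in> I \<Longrightarrow> \<alpha> i * t \<noteq> 1"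
  shows "poly p t / (\<Prod>i\<in>I. 1 - \<alpha> i * t) =
    (\<Sum>i\<in>I. poly p (1 / \<alpha> i) / (\<Prod>k\<in>I - {i}. 1 - \<alpha> k / \<alpha> i) / (1 - \<alpha> i * t))"
proof -
  define \<rho> where "\<rho> i = poly p (1 / \<alpha> i) / (\<Prod>k\<in>I - {i}. 1 - \<alpha> k / \<alpha> i)" for i
  define Q where "Q = (\<Sum>i\<in>I. smult (\<rho> i) (\<Prod>k\<in>I - {i}. [:1, - \<alpha> k:]))"
  have polyQ: "poly Q x = (\<Sum>i\<in>I. \<rho> i * (\<Prod>k\<in>I - {i}. 1 - \<alpha> k * x))" for x
    by (simp add: Q_def poly_sum poly_prod mult.commute)
  have "degree (smult (\<rho> i) (\<Prod>k\<in>I - {i}. [:1, - \<alpha> k:])) < card I" if "i \<in> I" for i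
  proof -
    have "degree (\<Prod>k\<in>I - {i}. [:1, - \<alpha> k:]) \<le> (\<Sum>k\<in>I - {i}. degree [:1, - \<alpha> k:])"
      by (rule degree_prod_sum_le[unfolded o_def]) (use fin in auto)
    also have "\<dots> \<le> (\<Sum>k\<in>I - {i}. 1)"
      by (rule sum_mono) simp
    also have "\<dots> < card I"
    proof -
      have "card I > 0" using fin that by (auto simp: card_gt_0_iff)
      then show ?thesis using fin that by simp
    qed
    finally show ?thesis using degree_smult_le le_less_trans by blast
  qed
  then have "degree Q < card I"
    unfolding Q_def using fin deg by (intro degree_sum_less) auto
  moreover have "card ((\<lambda>i. 1 / \<alpha> i) ` I) = card I"
    by (rule card_image) (use inj in \<open>auto simp: inj_on_def\<close>)
  moreover have "poly p x = poly Q x" if "x \<in> (\<lambda>i. 1 / \<alpha> i) ` I" for x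
  proof -
    from that obtain i where i: "i \<in> I" "x = 1 / \<alpha> i" by auto
    have "poly Q x = (\<Sum>j\<in>{i}. \<rho> j * (\<Prod>k\<in>I - {j}. 1 - \<alpha> k * x))"
      unfolding polyQ
    proof (rule sum.mono_neutral_right)
      show "\<forall>j\<in>I - {i}. \<rho> j * (\<Prod>k\<in>I - {j}. 1 - \<alpha> k * x) = 0"
        using i nz fin by (auto intro!: bexI[of _ i])
    qed (use fin i in auto)
    also have "\<dots> = poly p x"
    proof -
      have "(\<Prod>k\<in>I - {i}. 1 - \<alpha> k / \<alpha> i) \<noteq> 0"
        using fin inj i nz by (auto simp: inj_on_def)
      then show ?thesis using i by (simp add: \<rho>_def)
    qed
    finally show ?thesis by simp
  qed
  ultimately have "p = Q"
    using deg by (intro poly_eqI_degree[of "(\<lambda>i. 1 / \<alpha> i) ` I"]) auto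
  have "poly p t / (\<Prod>i\<in>I. 1 - \<alpha> i * t) = (\<Sum>i\<in>I. \<rho> i * (\<Prod>k\<in>I - {i}. 1 - \<alpha> k * t) / (\<Prod>i\<in>I. 1 - \<alpha> i * t))"
    using \<open>p = Q\<close> polyQ[of t] by (simp add: sum_divide_distrib)
  also have "\<dots> = (\<Sum>i\<in>I. \<rho> i / (1 - \<alpha> i * t))"
  proof (rule sum.cong)
    fix i assume i: "i \<in> I"
    have "(\<Prod>k\<in>I. 1 - \<alpha> k * t) = (1 - \<alpha> i * t) * (\<Prod>k\<in>I - {i}. 1 - \<alpha> k * t)"
      by (rule prod.remove[OF fin i])
    moreover have "(\<Prod>k\<in>I - {i}. 1 - \<alpha> k * t) \<noteq> 0" using fin t by auto
    ultimately show "\<rho> i * (\<Prod>k\<in>I - {i}. 1 - \<alpha> k * t) / (\<Prod>i\<in>I. 1 - \<alpha> i * t) = \<rho> i / (1 - \<alpha> i * t)"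
      by simp
  qed simp
  finally show ?thesis by (simp add: \<rho>_def)
qed

lemma powi_eq_1_iff:
  assumes "q \<noteq> 0" "cmod q < 1"
  shows "q powi n = 1 \<longleftrightarrow> n = 0"
proof -
  have *: "q ^ Suc m \<noteq> 1" for m
    using self_power_neq_1[OF assms(2), of m] by simp
  show ?thesis
  proof (cases n rule: int_nat_cases)
    case (nonneg m)
    show ?thesis unfolding nonneg power_int_of_nat using * by (cases m) auto
  next
    case (neg m)
    show ?thesis unfolding neg power_int_minus power_int_of_nat inverse_eq_1_iff using * by (cases m) auto
  qed
qed

lemma power_eq_power_iff:
  assumes "q \<noteq> 0" "cmod q < 1"
  shows "q ^ m = q ^ n \<longleftrightarrow> m = n"
  using powi_eq_1_iff[OF assms, of "int m - int n"] assms by (auto simp: power_int_diff)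

lemma qpoch_poly: "poly (\<Prod>j<N. [:1, - c * q ^ j:]) t = qpoch (c * t) q N"
  by (simp add: qpoch_def poly_prod mult_ac)

lemma degree_qpoch_poly: "degree (\<Prod>j<N. [:1, - c * q ^ j:]) \<le> N"
proof -
  have "degree (\<Prod>j<N. [:1, - c * q ^ j:]) \<le> (\<Sum>j<N. degree [:1, - c * q ^ j:])"
    by (rule degree_prod_sum_le[unfolded o_def]) auto
  also have "\<dots> \<le> (\<Sum>j<N. 1)" by (rule sum_mono) simp
  finally show ?thesis by simp
qed

text \<open>The denominators of the Lagrange weights for geometric nodes: the indices below m give
  the first factor, those above m the second.\<close>

lemma prod_power_remove:
  fixes q :: complex
  assumes "q \<noteq> 0" "m \<le> M"
  shows "(\<Prod>k\<in>{..M} - {m}. 1 - q ^ k / q ^ m) = qpoch (1 / q ^ m) q m * qpoch q q (M - m)"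
proof -
  have set: "{..M} - {m} = {..<m} \<union> {Suc m..M}" using assms by auto
  have "(\<Prod>k\<in>{..M} - {m}. 1 - q ^ k / q ^ m) = (\<Prod>k<m. 1 - q ^ k / q ^ m) * (\<Prod>k=Suc m..M. 1 - q ^ k / q ^ m)"
    unfolding set by (rule prod.union_disjoint) auto
  also have "(\<Prod>k<m. 1 - q ^ k / q ^ m) = qpoch (1 / q ^ m) q m"
    by (simp add: qpoch_def)
  also have "(\<Prod>k=Suc m..M. 1 - q ^ k / q ^ m) = qpoch q q (M - m)"
    unfolding qpoch_def
    by (rule prod.reindex_bij_witness[of _ "\<lambda>j. Suc m + j" "\<lambda>k. k - Suc m"])
       (use assms in \<open>auto simp: power_diff\<close>)
  finally show ?thesis .
qed

text \<open>Partial fractions in the variable y of (yz;q)_M / (y;q)_(M+1), whose numerator has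
  degree at most M and whose denominator has M + 1 simple zeros. Reflecting at the node 1/q^m
  produces the same Gaussian power and sign above and below; they cancel and leave z^m.\<close>

lemma finite_kronecker_sum:
  assumes q: "q \<noteq> 0" "cmod q < 1" and z: "z \<noteq> 0" and y: "\<And>m. m \<le> M \<Longrightarrow> y * q ^ m \<noteq> 1"
  shows "qpoch (y * z) q M / qpoch y q (Suc M) =
    (\<Sum>m\<le>M. z ^ m / (1 - y * q ^ m) * (qpoch (q / z) q m * qpoch z q (M - m) / (qpoch q q m * qpoch q q (M - m))))"
proof -
  let ?p = "\<Prod>j<M. [:1, - z * q ^ j:]"
  have "poly ?p y / (\<Prod>m\<le>M. 1 - q ^ m * y) =
    (\<Sum>m\<le>M. poly ?p (1 / q ^ m) / (\<Prod>k\<in>{..M} - {m}. 1 - q ^ k / q ^ m) / (1 - q ^ m * y))"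
    by (rule partial_fractions)
       (use q y le_less_trans[OF degree_qpoch_poly[where c = z and q = q], of M "Suc M"] in \<open>auto simp: inj_on_def power_eq_power_iff mult.commute\<close>)
  moreover have "poly ?p y = qpoch (y * z) q M" by (simp only: qpoch_poly mult.commute)
  moreover have "(\<Prod>m\<le>M. 1 - q ^ m * y) = qpoch y q (Suc M)"
    by (simp only: qpoch_def lessThan_Suc_atMost mult.commute)
  moreover have "poly ?p (1 / q ^ m) / (\<Prod>k\<in>{..M} - {m}. 1 - q ^ k / q ^ m) / (1 - q ^ m * y) =
      z ^ m / (1 - y * q ^ m) * (qpoch (q / z) q m * qpoch z q (M - m) / (qpoch q q m * qpoch q q (M - m)))"
    if m: "m \<in> {..M}" for m
  proof -
    define T where "T = q ^ (Suc m * m div 2)"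
    have T: "T \<noteq> 0" using q by (simp add: T_def)
    have r1: "qpoch (z / q ^ m) q m * T = (- z) ^ m * qpoch (q / z) q m"
      unfolding T_def by (rule qpoch_reflect) (use q z in auto)
    have r2: "qpoch (1 / q ^ m) q m * T = (- 1) ^ m * qpoch q q m"
      unfolding T_def using qpoch_reflect[of 1 q m] q by simp
    have e: "qpoch (z * (1 / q ^ m)) q M = qpoch (z / q ^ m) q m * qpoch z q (M - m)"
      using qpoch_add[of "z / q ^ m" q m "M - m"] m q by simp
    have "qpoch (z / q ^ m) q m / qpoch (1 / q ^ m) q m = (qpoch (z / q ^ m) q m * T) / (qpoch (1 / q ^ m) q m * T)"
      using T by simp
    also have "\<dots> = z ^ m * (qpoch (q / z) q m / qpoch q q m)"
      unfolding r1 r2 power_minus[of z] by simp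
    finally have "qpoch (z / q ^ m) q m / qpoch (1 / q ^ m) q m = z ^ m * (qpoch (q / z) q m / qpoch q q m)" .
    moreover have "poly ?p (1 / q ^ m) / (\<Prod>k\<in>{..M} - {m}. 1 - q ^ k / q ^ m) / (1 - q ^ m * y)
       = (qpoch (z / q ^ m) q m / qpoch (1 / q ^ m) q m) * (qpoch z q (M - m) / qpoch q q (M - m)) / (1 - y * q ^ m)"
      using m by (simp only: qpoch_poly prod_power_remove[OF q(1)] e atMost_iff) (simp add: mult.commute)
    ultimately show ?thesis by (simp add: mult_ac)
  qed
  ultimately show ?thesis by simp
qed

text \<open>For n = -m the reciprocal equals q^m / (q^m - c). Its decay like |q|^m is what lets the
  two-sided series converge for |z| > |q|.\<close>

lemma kronecker_denominator_bound:
  assumes q: "q \<noteq> 0" "cmod q < 1" and c: "c \<noteq> 0" "\<And>n. c * q powi n \<noteq> 1"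
  obtains B where "B > 0" "\<And>m. cmod (1 / (1 - c * q ^ m)) \<le> B"
    "\<And>m. cmod (1 / (1 - c * q powi (- int m))) \<le> B * cmod q ^ m"
proof -
  have "(\<lambda>m. 1 / (1 - c * q ^ m)) \<longlonglongrightarrow> 1 / (1 - c * 0)"
    by (intro tendsto_intros LIMSEQ_power_zero) (use q in auto)
  then have "Bseq (\<lambda>m. 1 / (1 - c * q ^ m))" by (intro convergent_imp_Bseq convergentI)
  then obtain B1 where B1: "B1 > 0" "\<And>m. cmod (1 / (1 - c * q ^ m)) \<le> B1" by (auto elim: BseqE)
  have "(\<lambda>m. 1 / (q ^ m - c)) \<longlonglongrightarrow> 1 / (0 - c)"
    by (intro tendsto_intros LIMSEQ_power_zero) (use q c in auto)
  then have "Bseq (\<lambda>m. 1 / (q ^ m - c))" by (intro convergent_imp_Bseq convergentI)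
  then obtain B2 where B2: "B2 > 0" "\<And>m. cmod (1 / (q ^ m - c)) \<le> B2" by (auto elim: BseqE)
  show ?thesis
  proof (rule that[of "B1 + B2"])
    show "cmod (1 / (1 - c * q ^ m)) \<le> B1 + B2" for m using B1(2)[of m] B2(1) by linarith
    fix m
    have "1 / (1 - c * q powi (- int m)) = q ^ m * (1 / (q ^ m - c))"
      using q c(2)[of "- int m"] by (simp add: power_int_minus field_simps)
    then have "cmod (1 / (1 - c * q powi (- int m))) = cmod q ^ m * cmod (1 / (q ^ m - c))"
      by (simp only: norm_mult norm_power)
    also have "\<dots> \<le> cmod q ^ m * (B1 + B2)"
      using B1(1) B2(2)[of m] by (intro mult_left_mono) auto
    finally show "cmod (1 / (1 - c * q powi (- int m))) \<le> (B1 + B2) * cmod q ^ m" by (simp add: mult.commute)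
  qed (use B1 B2 in auto)
qed

lemma kronecker_abs_summable:
  assumes q: "q \<noteq> 0" and z: "cmod q < cmod z" "cmod z < 1" and c: "c \<noteq> 0" "\<And>n. c * q powi n \<noteq> 1"
  shows "(\<lambda>n::int. norm (z powi n / (1 - c * q powi n))) summable_on UNIV"
proof -
  have q1: "cmod q < 1" and z0: "z \<noteq> 0" using z by auto
  \<comment> \<open>The two halves of the series have ratios |z| and |q|/|z|; both are below 1
    exactly in the annulus.\<close>
  define t where "t = max (cmod z) (cmod q / cmod z)"
  have t: "0 \<le> t" "t < 1" "cmod z \<le> t" "cmod q / cmod z \<le> t" using z by (auto simp: t_def le_max_iff_disj divide_less_eq)
  obtain B where B: "B > 0" "\<And>m. cmod (1 / (1 - c * q ^ m)) \<le> B"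
    "\<And>m. cmod (1 / (1 - c * q powi (- int m))) \<le> B * cmod q ^ m"
    using kronecker_denominator_bound[OF q q1 c] by blast
  show ?thesis
  proof (rule abs_summable_on_int_geometric[OF t(1,2)])
    fix n :: int
    show "norm (z powi n / (1 - c * q powi n)) \<le> B * t ^ nat \<bar>n\<bar>"
    proof (cases n rule: int_nat_cases)
      case (nonneg m)
      have "norm (z powi n / (1 - c * q powi n)) = cmod (1 / (1 - c * q ^ m)) * cmod z ^ m"
        using nonneg by (simp add: norm_divide norm_power)
      also have "\<dots> \<le> B * t ^ m" by (intro mult_mono power_mono B t) (use B in auto)
      finally show ?thesis using nonneg by simp
    next
      case (neg m)
      have "z powi n / (1 - c * q powi n) = 1 / (1 - c * q powi (- int m)) / z ^ m"
        unfolding neg power_int_minus[of z] power_int_of_nat by (simp add: divide_inverse mult.commute)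
      then have "norm (z powi n / (1 - c * q powi n)) = cmod (1 / (1 - c * q powi (- int m))) / cmod z ^ m"
        by (simp only: norm_divide norm_power)
      also have "\<dots> \<le> B * cmod q ^ m / cmod z ^ m" by (intro divide_right_mono B) auto
      also have "\<dots> = B * (cmod q / cmod z) ^ m" by (simp add: power_divide)
      also have "\<dots> \<le> B * t ^ m" by (intro mult_left_mono power_mono t) (use B in auto)
      finally show ?thesis using neg by simp
    qed
  qed
qed

lemma annulus_not_power:
  assumes "q \<noteq> 0" "cmod q < cmod z" "cmod z < 1"
  shows "z \<noteq> q powi n"
proof
  assume z: "z = q powi n"
  have q1: "0 < cmod q" "cmod q < 1" using assms by auto
  show False
  proof (cases "n \<le> 0")
    case True
    then obtain m where m: "n = - int m" by (metis nat_0_le neg_0_le_iff_le minus_minus)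
    have "cmod q ^ m \<le> 1" using q1 by (intro power_le_one) auto
    then have "1 \<le> inverse (cmod q ^ m)" using q1 by (intro one_le_inverse) auto
    moreover have "cmod z = inverse (cmod q ^ m)" unfolding z m power_int_minus by (simp add: norm_inverse norm_power)
    ultimately show False using assms by simp
  next
    case False
    then obtain m where m: "n = int (Suc m)" by (metis int_cases3 less_imp_le nat_less_iff not_le zero_less_imp_eq_int gr0_implies_Suc)
    have "cmod q ^ m \<le> 1" using q1 by (intro power_le_one) auto
    then have "cmod q * cmod q ^ m \<le> cmod q" using q1 by (simp add: mult_left_le)
    moreover have "cmod z = cmod q * cmod q ^ m" using z m by (simp only: power_int_of_nat) (simp add: norm_mult norm_power)
    ultimately show False using assms by simp
  qed
qed

text \<open>Kronecker's formula, the case b = aq of Ramanujan's 1psi1 sum. The finite identity is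
  taken at y = c/q^N with M = 2N and divided by z^N, which makes the index run symmetrically from -N
  to N; reflection turns the first N factors into those of q/(cz) and q/c.\<close>

theorem kronecker_sum:
  assumes q: "q \<noteq> 0" and z: "cmod q < cmod z" "cmod z < 1" and c: "c \<noteq> 0" "\<And>n. c * q powi n \<noteq> 1"
  shows "(\<Sum>\<^sub>\<infinity>n::int. z powi n / (1 - c * q powi n)) =
    (qpoch_inf q q)\<^sup>2 * theta_prod q (c * z) / (theta_prod q c * theta_prod q z)"
proof -
  have q1: "cmod q < 1" and z0: "z \<noteq> 0" using z by auto
  define w where "w N n = qpoch (q / z) q (nat (int N + n)) * qpoch z q (nat (int N - n))
      / (qpoch q q (nat (int N + n)) * qpoch q q (nat (int N - n)))" for N n
  have cp: "c * q ^ n \<noteq> 1" for n using c(2)[of "int n"] by simp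
  have cm: "q / c * q ^ n \<noteq> 1" for n
    using c(2)[of "- int (Suc n)"] c q by (simp add: power_int_minus field_simps del: of_nat_Suc)
  have fin: "qpoch (c * z) q N * qpoch (q / (c * z)) q N / (qpoch c q (Suc N) * qpoch (q / c) q N) =
     (\<Sum>n = - int N..int N. z powi n / (1 - c * q powi n) * w N n)" for N
  proof -
    define T where "T = q ^ (Suc N * N div 2)"
    have T: "T \<noteq> 0" using q by (simp add: T_def)
    have r1: "qpoch (c * z / q ^ N) q N * T = (- (c * z)) ^ N * qpoch (q / (c * z)) q N"
      unfolding T_def by (rule qpoch_reflect) (use q z0 c in auto)
    have r2: "qpoch (c / q ^ N) q N * T = (- c) ^ N * qpoch (q / c) q N"
      unfolding T_def by (rule qpoch_reflect) (use q c in auto)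
    have e1: "qpoch (c / q ^ N * z) q (2 * N) = qpoch (c * z / q ^ N) q N * qpoch (c * z) q N"
      using qpoch_add[of "c * z / q ^ N" q N N] q by (simp add: mult_2)
    have e2: "qpoch (c / q ^ N) q (Suc (2 * N)) = qpoch (c / q ^ N) q N * qpoch c q (Suc N)"
      using qpoch_add[of "c / q ^ N" q N "Suc N"] q by (simp add: mult_2)
    have shift: "c / q ^ N * q ^ m = c * q powi (int m - int N)" for m
      using q by (simp add: power_int_diff)
    have "qpoch (c / q ^ N * z) q (2 * N) / qpoch (c / q ^ N) q (Suc (2 * N))
      = (qpoch (c * z / q ^ N) q N * T) * qpoch (c * z) q N / ((qpoch (c / q ^ N) q N * T) * qpoch c q (Suc N))"
      unfolding e1 e2 using T by (simp add: field_simps)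
    also have "\<dots> = z ^ N * (qpoch (c * z) q N * qpoch (q / (c * z)) q N / (qpoch c q (Suc N) * qpoch (q / c) q N))"
      unfolding r1 r2 using c by (simp add: power_mult_distrib power_minus[of "c * z"] power_minus[of c] mult_ac)
    finally have "qpoch (c * z) q N * qpoch (q / (c * z)) q N / (qpoch c q (Suc N) * qpoch (q / c) q N)
      = qpoch (c / q ^ N * z) q (2 * N) / qpoch (c / q ^ N) q (Suc (2 * N)) / z ^ N"
      using z0 by simp
    also have "qpoch (c / q ^ N * z) q (2 * N) / qpoch (c / q ^ N) q (Suc (2 * N)) =
      (\<Sum>m\<le>2 * N. z ^ m / (1 - c / q ^ N * q ^ m) * (qpoch (q / z) q m * qpoch z q (2 * N - m) / (qpoch q q m * qpoch q q (2 * N - m))))"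
      by (rule finite_kronecker_sum) (use q q1 z0 c(2) shift in auto)
    also have "\<dots> / z ^ N = (\<Sum>m\<le>2 * N. z powi (int m - int N) / (1 - c * q powi (int m - int N)) * w N (int m - int N))"
      unfolding sum_divide_distrib
    proof (intro sum.cong refl)
      fix m assume m: "m \<in> {..2 * N}"
      then have "nat (int N + (int m - int N)) = m" "nat (int N - (int m - int N)) = 2 * N - m" by auto
      then show "z ^ m / (1 - c / q ^ N * q ^ m) * (qpoch (q / z) q m * qpoch z q (2 * N - m) / (qpoch q q m * qpoch q q (2 * N - m))) / z ^ N
         = z powi (int m - int N) / (1 - c * q powi (int m - int N)) * w N (int m - int N)"
        unfolding w_def shift using z0 by (simp add: power_int_diff mult_ac)
    qed
    also have "\<dots> = (\<Sum>n = - int N..int N. z powi n / (1 - c * q powi n) * w N n)"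
      by (rule sum_int_shift[symmetric])
    finally show ?thesis .
  qed
  note Q = qpoch_inf_self_nonzero[OF q1]
  define W where "W = qpoch_inf (q / z) q * qpoch_inf z q / (qpoch_inf q q * qpoch_inf q q)"
  have lim: "(\<lambda>N. w N n) \<longlonglongrightarrow> W" for n
    unfolding w_def W_def using Q
    by (intro tendsto_intros tendsto_int_nat_sequences qpoch_tendsto q1) auto
  obtain B where B: "B > 0" "\<And>n. cmod (qpoch q q n) \<ge> B"
    using norm_qpoch_ge[OF q1 self_power_neq_1[OF q1]] by blast
  define K where "K = exp (cmod (q / z) / (1 - cmod q)) * exp (cmod z / (1 - cmod q)) / (B * B)"
  have wb: "cmod (w N n) \<le> K" for N n
    unfolding w_def norm_divide norm_mult K_def
    by (intro frac_le mult_mono norm_qpoch_le) (use q1 B in \<open>auto simp: norm_divide\<close>)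
  have "(\<lambda>N. \<Sum>n = - int N..int N. z powi n / (1 - c * q powi n) * w N n)
     \<longlonglongrightarrow> (\<Sum>\<^sub>\<infinity>n::int. z powi n / (1 - c * q powi n)) * W"
    by (rule tannery_weighted_sums[OF kronecker_abs_summable[OF q z c] _ eventually_in_int_interval wb lim]) auto
  moreover have "(\<lambda>N. qpoch (c * z) q N * qpoch (q / (c * z)) q N / (qpoch c q (Suc N) * qpoch (q / c) q N))
     \<longlonglongrightarrow> theta_prod q (c * z) / (qpoch_inf c q * qpoch_inf (q / c) q)"
    unfolding theta_prod_def using cp cm
    by (intro tendsto_intros qpoch_tendsto q1 LIMSEQ_Suc) (auto simp: qpoch_inf_eq_0_iff[OF q1])
  ultimately have "(\<Sum>\<^sub>\<infinity>n::int. z powi n / (1 - c * q powi n)) * W = theta_prod q (c * z) / theta_prod q c"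
    unfolding fin theta_prod_def by (rule LIMSEQ_unique)
  moreover have W: "W = theta_prod q z / (qpoch_inf q q)\<^sup>2" by (simp add: W_def theta_prod_def power2_eq_square)
  moreover have "theta_prod q z \<noteq> 0"
    using theta_prod_eq_0_iff[OF q q1 z0] annulus_not_power[OF q z] by blast
  moreover from this have "W \<noteq> 0" using Q unfolding W by simp
  then have "(\<Sum>\<^sub>\<infinity>n::int. z powi n / (1 - c * q powi n)) = (\<Sum>\<^sub>\<infinity>n::int. z powi n / (1 - c * q powi n)) * W / W"
    by simp
  ultimately have "(\<Sum>\<^sub>\<infinity>n::int. z powi n / (1 - c * q powi n)) = theta_prod q (c * z) / theta_prod q c / W"
    by simp
  then show ?thesis unfolding W by simp
qed

section \<open>Partial fractions of the quotient of q-Pochhammer symbols\<close>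

text \<open>What remains of the coefficients once the Borel transform has cancelled the Gaussian
  factor, up to the sign (-1)^(kn). Parameters are functions of the index rather than lists, so that
  scaling them is a plain lambda term.\<close>

definition phi_coeff :: "complex \<Rightarrow> nat \<Rightarrow> nat \<Rightarrow> (nat \<Rightarrow> complex) \<Rightarrow> (nat \<Rightarrow> complex) \<Rightarrow> nat \<Rightarrow> complex" where
  "phi_coeff q r s a b n = (\<Prod>i<r. qpoch (a i) q n) / ((\<Prod>l<s. qpoch (b l) q n) * qpoch q q n)"

text \<open>\<open>dual_coeff\<close> lists the coefficients of $\Phi_j$ (its zero parameters contribute factors 1),
  and \<open>residue_coeff\<close> is the weight of $1/(1 - a_j q^m t)$ in $R(t)$ relative to $m = 0$.\<close>

definition dual_coeff :: "complex \<Rightarrow> nat \<Rightarrow> nat \<Rightarrow> (nat \<Rightarrow> complex) \<Rightarrow> (nat \<Rightarrow> complex) \<Rightarrow> nat \<Rightarrow> nat \<Rightarrow> complex" where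
  "dual_coeff q r s a b j m = qpoch (a j) q m * (\<Prod>l<s. qpoch (a j * q / b l) q m)
     / ((\<Prod>i\<in>{..<r} - {j}. qpoch (a j * q / a i) q m) * qpoch q q m)"

text \<open>The constant whose m-th power is collected when all Pochhammer symbols of R are
  reflected at the pole 1/(a_j q^m). The argument of Phi_j arises from it in the Laplace transform,
  where the sign and a_j^k are absorbed.\<close>

definition dual_arg :: "complex \<Rightarrow> nat \<Rightarrow> nat \<Rightarrow> (nat \<Rightarrow> complex) \<Rightarrow> (nat \<Rightarrow> complex) \<Rightarrow> nat \<Rightarrow> complex" where
  "dual_arg q r s a b j = (- 1) ^ (r - s - 1) * q * (\<Prod>l<s. b l) * a j ^ (r - s - 1) / (\<Prod>i<r. a i)"

definition residue_coeff :: "complex \<Rightarrow> nat \<Rightarrow> nat \<Rightarrow> (nat \<Rightarrow> complex) \<Rightarrow> (nat \<Rightarrow> complex) \<Rightarrow> nat \<Rightarrow> nat \<Rightarrow> complex" where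
  "residue_coeff q r s a b j m =
     dual_coeff q r s a b j m * dual_arg q r s a b j ^ m * (q ^ (Suc m * m div 2)) ^ (r - s - 1)"

definition connection_coeff :: "complex \<Rightarrow> nat \<Rightarrow> nat \<Rightarrow> (nat \<Rightarrow> complex) \<Rightarrow> (nat \<Rightarrow> complex) \<Rightarrow> nat \<Rightarrow> complex" where
  "connection_coeff q r s a b j = (\<Prod>i\<in>{..<r} - {j}. qpoch_inf (a i) q / qpoch_inf (a i / a j) q)
     * (\<Prod>l<s. qpoch_inf (b l / a j) q / qpoch_inf (b l) q)"

lemma bounded_inverse_1_minus:
  assumes q: "cmod q < 1" and c: "\<And>n. c * q ^ n \<noteq> 1"
  obtains B where "B > 0" "\<And>m. cmod (1 / (1 - c * q ^ m)) \<le> B"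
proof -
  have "(\<lambda>m. 1 / (1 - c * q ^ m)) \<longlonglongrightarrow> 1 / (1 - c * 0)"
    by (intro tendsto_intros LIMSEQ_power_zero) (use q in auto)
  then have "Bseq (\<lambda>m. 1 / (1 - c * q ^ m))" by (intro convergent_imp_Bseq convergentI)
  then show ?thesis using that by (auto elim: BseqE)
qed

locale qhyp_params =
  fixes q :: complex and r s :: nat and a b :: "nat \<Rightarrow> complex"
  assumes q_nz: "q \<noteq> 0" and q_lt_1: "cmod q < 1" and r_gt: "s + 1 < r"
    and a_nz: "\<And>i. i < r \<Longrightarrow> a i \<noteq> 0" and b_nz: "\<And>l. l < s \<Longrightarrow> b l \<noteq> 0"
    and b_reg: "\<And>l n. l < s \<Longrightarrow> b l * q ^ n \<noteq> 1"
    and a_reg: "\<And>i j n. i < r \<Longrightarrow> j < r \<Longrightarrow> i \<noteq> j \<Longrightarrow> a i / a j \<noteq> q powi n"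
begin

abbreviation "k \<equiv> r - s - 1"
abbreviation "u \<equiv> phi_coeff q r s a b"
abbreviation "w \<equiv> dual_coeff q r s a b"
abbreviation "X \<equiv> dual_arg q r s a b"
abbreviation "v \<equiv> residue_coeff q r s a b"
abbreviation "A \<equiv> connection_coeff q r s a b"

lemma r_eq: "r = Suc s + k"
  using r_gt by simp

lemma k_pos: "0 < k"
  using r_gt by simp

lemma ratio_reg:
  assumes "i < r" "j < r" "i \<noteq> j"
  shows "a i / a j * q ^ n \<noteq> 1" and "a j * q / a i * q ^ n \<noteq> 1"
proof -
  show "a i / a j * q ^ n \<noteq> 1"
    using a_reg[OF assms, of "- int n"] q_nz by (auto simp: power_int_minus field_simps)
  show "a j * q / a i * q ^ n \<noteq> 1"
  proof
    assume "a j * q / a i * q ^ n = 1"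
    then have "a i / a j = q ^ Suc n" using a_nz assms by (simp add: field_simps)
    then show False using a_reg[OF assms, of "int (Suc n)"] unfolding power_int_of_nat by simp
  qed
qed

text \<open>The part of the residue of the truncation at 1/(a_j q^m) that depends on N, with n = N -
  m. The last symbol has length \<open>n - 1\<close> because the product belonging to a_j has lost
  its vanishing factor.\<close>

definition tail_factor :: "nat \<Rightarrow> nat \<Rightarrow> complex" where
  "tail_factor j n = qpoch (q / a j) q n * (\<Prod>l<s. qpoch (b l / a j) q n)
     / ((\<Prod>i\<in>{..<r} - {j}. qpoch (a i / a j) q n) * qpoch q q (n - 1))"

definition tail_limit :: "nat \<Rightarrow> complex" where
  "tail_limit j = qpoch_inf (q / a j) q * (\<Prod>l<s. qpoch_inf (b l / a j) q)
     / ((\<Prod>i\<in>{..<r} - {j}. qpoch_inf (a i / a j) q) * qpoch_inf q q)"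

lemma tail_factor_tendsto:
  assumes "j < r"
  shows "tail_factor j \<longlonglongrightarrow> tail_limit j"
proof -
  have "filterlim (\<lambda>n. n - 1) sequentially sequentially"
    by (rule filterlim_minus_const_nat_at_top)
  note * = filterlim_compose[OF qpoch_tendsto[OF q_lt_1, of q] this]
  show ?thesis
    unfolding tail_factor_def[abs_def] tail_limit_def
    by (intro tendsto_intros qpoch_tendsto q_lt_1 *)
       (use assms qpoch_inf_self_nonzero[OF q_lt_1] ratio_reg in \<open>auto simp: qpoch_inf_eq_0_iff[OF q_lt_1]\<close>)
qed

lemma tail_factor_bounded:
  assumes "j < r"
  obtains K where "\<And>n. cmod (tail_factor j n) \<le> K"
proof -
  have "Bseq (tail_factor j)"
    by (rule convergent_imp_Bseq[OF convergentI[OF tail_factor_tendsto[OF assms]]])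
  then show ?thesis by (elim BseqE) (use that in blast)
qed

text \<open>Every reflected parameter contributes -1/a_j times itself. The s numerator factors
  cancel against s of the s + k denominator factors, and the surplus k yields (-1)^k a_j^k.\<close>

lemma dual_arg_eq:
  assumes "j < r"
  shows "- (q / a j) * (\<Prod>l<s. - (b l / a j)) / ((\<Prod>i\<in>{..<r} - {j}. - (a i / a j)) * - 1) = X j"
proof -
  define P where "P = (\<Prod>i\<in>{..<r} - {j}. a i)"
  define Q where "Q = (\<Prod>l<s. b l)"
  have P: "(\<Prod>i<r. a i) = a j * P" unfolding P_def using assms by (intro prod.remove) auto
  have Pnz: "P \<noteq> 0" using a_nz by (auto simp: P_def)
  have aj: "a j \<noteq> 0" by (rule a_nz[OF assms])
  have c: "card ({..<r} - {j}) = s + k" using assms r_eq by simp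
  have "(\<Prod>l<s. - (b l / a j)) = (\<Prod>l<s. (- 1 / a j) * b l)" by simp
  also have "\<dots> = (- 1 / a j) ^ s * Q" unfolding prod.distrib by (simp add: Q_def)
  finally have 1: "(\<Prod>l<s. - (b l / a j)) = (- 1 / a j) ^ s * Q" .
  have "(\<Prod>i\<in>{..<r} - {j}. - (a i / a j)) = (\<Prod>i\<in>{..<r} - {j}. (- 1 / a j) * a i)" by simp
  also have "\<dots> = (- 1 / a j) ^ (s + k) * P" unfolding prod.distrib by (simp add: P_def c)
  finally have 2: "(\<Prod>i\<in>{..<r} - {j}. - (a i / a j)) = (- 1 / a j) ^ (s + k) * P" .
  define e where "e = - 1 / a j"
  have e: "e \<noteq> 0" "1 / e ^ k = (- 1) ^ k * a j ^ k"
    using aj by (auto simp: e_def power_divide power_minus' divide_simps)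
  have "- (q / a j) * (\<Prod>l<s. - (b l / a j)) / ((\<Prod>i\<in>{..<r} - {j}. - (a i / a j)) * - 1)
     = q / a j * (e ^ s * Q) / (e ^ s * e ^ k * P)"
    unfolding 1 2 e_def[symmetric] power_add by simp
  also have "\<dots> = q * Q / (a j * P) * (1 / e ^ k)" using e(1) by simp
  also have "\<dots> = X j" unfolding e(2) dual_arg_def P Q_def[symmetric] by simp
  finally show ?thesis .
qed

text \<open>Each symbol of length N at 1/(a_j q^m) splits into m factors with negative powers of q,
  which are reflected, and N - m ordinary ones. Each reflection gives 1/T; there are s + 1 of them
  above and s + k + 1 below, whence T^k, the Gaussian factor of
  \<open>residue_coeff\<close>.\<close>

lemma truncated_residue:
  assumes j: "j < r" and m: "m < N"
  shows "qpoch (q / (a j * q ^ m)) q N * (\<Prod>l<s. qpoch (b l / (a j * q ^ m)) q N)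
     / ((\<Prod>i\<in>{..<r} - {j}. qpoch (a i / (a j * q ^ m)) q N) * (qpoch (1 / q ^ m) q m * qpoch q q (N - 1 - m)))
     = v j m * tail_factor j (N - m)"
proof -
  define T where "T = q ^ (Suc m * m div 2)"
  have T: "T \<noteq> 0" using q_nz by (simp add: T_def)
  have aj: "a j \<noteq> 0" by (rule a_nz[OF j])
  have refl: "qpoch (c / q ^ m) q m = (- c) ^ m * qpoch (q / c) q m / T" if "c \<noteq> 0" for c
    using qpoch_reflect[OF that q_nz, of m, folded T_def] T by (simp add: eq_divide_eq)
  have shift: "qpoch (c / (a j * q ^ m)) q N = (- (c / a j)) ^ m * qpoch (a j * q / c) q m * qpoch (c / a j) q (N - m) / T"
    if "c \<noteq> 0" for c
  proof -
    have "qpoch (c / (a j * q ^ m)) q N = qpoch (c / a j / q ^ m) q (m + (N - m))" using m by simp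
    also have "\<dots> = qpoch (c / a j / q ^ m) q m * qpoch (c / a j) q (N - m)"
      unfolding qpoch_add using q_nz by simp
    also have "qpoch (c / a j / q ^ m) q m = (- (c / a j)) ^ m * qpoch (a j * q / c) q m / T"
      using refl[of "c / a j"] that aj by (simp add: mult.commute)
    finally show ?thesis by simp
  qed
  have c: "card ({..<r} - {j}) = s + k" using j r_eq by simp
  define C1 where "C1 = (\<Prod>l<s. - (b l / a j))"
  define C2 where "C2 = (\<Prod>i\<in>{..<r} - {j}. - (a i / a j))"
  define W1 where "W1 = (\<Prod>l<s. qpoch (a j * q / b l) q m)"
  define W2 where "W2 = (\<Prod>i\<in>{..<r} - {j}. qpoch (a j * q / a i) q m)"
  define V1 where "V1 = (\<Prod>l<s. qpoch (b l / a j) q (N - m))"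
  define V2 where "V2 = (\<Prod>i\<in>{..<r} - {j}. qpoch (a i / a j) q (N - m))"
  have 1: "(\<Prod>l<s. qpoch (b l / (a j * q ^ m)) q N) = C1 ^ m * W1 * V1 / T ^ s"
  proof -
    have "(\<Prod>l<s. qpoch (b l / (a j * q ^ m)) q N)
       = (\<Prod>l<s. (- (b l / a j)) ^ m * qpoch (a j * q / b l) q m * qpoch (b l / a j) q (N - m) / T)"
      by (rule prod.cong) (use b_nz shift in auto)
    then show ?thesis unfolding C1_def W1_def V1_def by (simp only: prod.distrib prod_dividef prod_power_distrib) simp
  qed
  have 2: "(\<Prod>i\<in>{..<r} - {j}. qpoch (a i / (a j * q ^ m)) q N) = C2 ^ m * W2 * V2 / T ^ (s + k)"
  proof -
    have "(\<Prod>i\<in>{..<r} - {j}. qpoch (a i / (a j * q ^ m)) q N)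
       = (\<Prod>i\<in>{..<r} - {j}. (- (a i / a j)) ^ m * qpoch (a j * q / a i) q m * qpoch (a i / a j) q (N - m) / T)"
      by (rule prod.cong) (use a_nz shift in auto)
    then show ?thesis unfolding C2_def W2_def V2_def by (simp only: prod.distrib prod_dividef prod_power_distrib prod_constant c)
  qed
  have 3: "qpoch (q / (a j * q ^ m)) q N = (- (q / a j)) ^ m * qpoch (a j) q m * qpoch (q / a j) q (N - m) / T"
    using shift[OF q_nz] q_nz by simp
  have 4: "qpoch (1 / q ^ m) q m = (- 1) ^ m * qpoch q q m / T"
    using refl[of 1] by simp
  have X: "X j ^ m = (- (q / a j)) ^ m * C1 ^ m / (C2 ^ m * (- 1) ^ m)"
    unfolding dual_arg_eq[OF j, symmetric] C1_def[symmetric] C2_def[symmetric] by (simp only: power_divide power_mult_distrib)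
  have N: "N - 1 - m = N - m - 1" using m by simp
  have "v j m * tail_factor j (N - m) =
     qpoch (a j) q m * W1 / (W2 * qpoch q q m) * ((- (q / a j)) ^ m * C1 ^ m / (C2 ^ m * (- 1) ^ m)) * T ^ k
      * (qpoch (q / a j) q (N - m) * V1 / (V2 * qpoch q q (N - m - 1)))"
    unfolding residue_coeff_def dual_coeff_def tail_factor_def X T_def[symmetric]
       W1_def[symmetric] W2_def[symmetric] V1_def[symmetric] V2_def[symmetric] by simp
  also have "\<dots> = (- (q / a j)) ^ m * qpoch (a j) q m * qpoch (q / a j) q (N - m) / T * (C1 ^ m * W1 * V1 / T ^ s)
     / (C2 ^ m * W2 * V2 / T ^ (s + k) * ((- 1) ^ m * qpoch q q m / T * qpoch q q (N - m - 1)))"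
    using T by (simp add: power_add mult_ac)
  finally show ?thesis unfolding 1 2 3 4 N ..
qed

lemma truncated_partial_fractions:
  assumes N: "0 < N" and t: "\<And>i m. i < r \<Longrightarrow> a i * q ^ m * t \<noteq> 1"
  shows "qpoch (q * t) q N * (\<Prod>l<s. qpoch (b l * t) q N) / (\<Prod>i<r. qpoch (a i * t) q N) =
    (\<Sum>j<r. \<Sum>m<N. v j m / (1 - a j * q ^ m * t) * tail_factor j (N - m))"
proof -
  define p where "p = (\<Prod>j<N. [:1, - q * q ^ j:]) * (\<Prod>l<s. \<Prod>j<N. [:1, - b l * q ^ j:])"
  define \<alpha> where "\<alpha> = (\<lambda>(i, m). a i * q ^ m)"
  define I where "I = {..<r} \<times> {..<N}"
  have pp: "poly p x = qpoch (q * x) q N * (\<Prod>l<s. qpoch (b l * x) q N)" for x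
    by (simp only: p_def poly_mult poly_prod qpoch_poly) (simp only: qpoch_poly poly_prod[symmetric])
  have "degree p \<le> N + s * N"
  proof -
    have "degree (\<Prod>l<s. \<Prod>j<N. [:1, - b l * q ^ j:]) \<le> (\<Sum>l<s. degree (\<Prod>j<N. [:1, - b l * q ^ j:]))"
      by (rule degree_prod_sum_le[unfolded o_def]) auto
    also have "\<dots> \<le> (\<Sum>l<s. N)" by (rule sum_mono) (rule degree_qpoch_poly)
    finally have "degree (\<Prod>l<s. \<Prod>j<N. [:1, - b l * q ^ j:]) \<le> s * N" by simp
    then show ?thesis unfolding p_def
      using degree_mult_le degree_qpoch_poly[where c = q and q = q and N = N] by (meson add_mono order_trans)
  qed
  \<comment> \<open>Here r > s + 1 makes the truncation a proper fraction.\<close>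
  also have "N + s * N < r * N" using mult_less_mono1[of "Suc s" r N] r_gt N by simp
  finally have deg: "degree p < card I" by (simp add: I_def)
  have inj: "inj_on \<alpha> I"
  proof (rule inj_onI, safe)
    fix i m j n assume *: "(i, m) \<in> I" "(j, n) \<in> I" "\<alpha> (i, m) = \<alpha> (j, n)"
    then have nz: "a i \<noteq> 0" "a j \<noteq> 0" "i < r" "j < r" using a_nz by (auto simp: I_def)
    have "a i / a j = q powi (int n - int m)"
      using * nz q_nz by (simp add: \<alpha>_def power_int_diff field_simps)
    then have "i = j" using a_reg nz by blast
    moreover from this have "m = n" using * nz power_eq_power_iff[OF q_nz q_lt_1] by (simp add: \<alpha>_def)
    ultimately show "i = j" "m = n" by auto
  qed
  have den: "(\<Prod>x\<in>I. 1 - \<alpha> x * t) = (\<Prod>i<r. qpoch (a i * t) q N)"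
  proof -
    have "(\<Prod>x\<in>I. 1 - \<alpha> x * t) = (\<Prod>i<r. \<Prod>m<N. 1 - \<alpha> (i, m) * t)"
      unfolding I_def by (simp add: prod.cartesian_product case_prod_unfold)
    then show ?thesis by (simp add: \<alpha>_def qpoch_def mult_ac)
  qed
  have rem: "(\<Prod>x\<in>I - {(j, m)}. 1 - \<alpha> x / \<alpha> (j, m)) =
     (\<Prod>i\<in>{..<r} - {j}. qpoch (a i / (a j * q ^ m)) q N) * (qpoch (1 / q ^ m) q m * qpoch q q (N - 1 - m))"
    if j: "j < r" and m: "m < N" for j m
  proof -
    have set: "I - {(j, m)} = (({..<r} - {j}) \<times> {..<N}) \<union> ({j} \<times> ({..<N} - {m}))"
      using j m by (auto simp: I_def)
    have "(\<Prod>x\<in>I - {(j, m)}. 1 - \<alpha> x / \<alpha> (j, m)) =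
       (\<Prod>x\<in>({..<r} - {j}) \<times> {..<N}. 1 - \<alpha> x / \<alpha> (j, m)) * (\<Prod>x\<in>{j} \<times> ({..<N} - {m}). 1 - \<alpha> x / \<alpha> (j, m))"
      unfolding set by (rule prod.union_disjoint) auto
    also have "(\<Prod>x\<in>({..<r} - {j}) \<times> {..<N}. 1 - \<alpha> x / \<alpha> (j, m)) = (\<Prod>i\<in>{..<r} - {j}. qpoch (a i / (a j * q ^ m)) q N)"
    proof -
      have "(\<Prod>x\<in>({..<r} - {j}) \<times> {..<N}. 1 - \<alpha> x / \<alpha> (j, m)) = (\<Prod>i\<in>{..<r} - {j}. \<Prod>n<N. 1 - \<alpha> (i, n) / \<alpha> (j, m))"
        by (simp add: prod.cartesian_product case_prod_unfold)
      then show ?thesis by (simp add: \<alpha>_def qpoch_def)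
    qed
    also have "(\<Prod>x\<in>{j} \<times> ({..<N} - {m}). 1 - \<alpha> x / \<alpha> (j, m)) = (\<Prod>x\<in>{..<N} - {m}. 1 - \<alpha> (j, x) / \<alpha> (j, m))"
      by (rule prod.reindex_bij_witness[of _ "\<lambda>x. (j, x)" snd]) auto
    also have "\<dots> = (\<Prod>x\<in>{..N - 1} - {m}. 1 - q ^ x / q ^ m)"
      using a_nz[OF j] N by (intro prod.cong) (auto simp: \<alpha>_def)
    also have "\<dots> = qpoch (1 / q ^ m) q m * qpoch q q (N - 1 - m)"
      by (rule prod_power_remove[OF q_nz]) (use m in auto)
    finally show ?thesis .
  qed
  have "poly p t / (\<Prod>x\<in>I. 1 - \<alpha> x * t) = (\<Sum>x\<in>I. poly p (1 / \<alpha> x) / (\<Prod>y\<in>I - {x}. 1 - \<alpha> y / \<alpha> x) / (1 - \<alpha> x * t))"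
    by (rule partial_fractions[OF _ inj _ deg]) (use t a_nz q_nz in \<open>auto simp: I_def \<alpha>_def\<close>)
  also have "\<dots> = (\<Sum>(j, m)\<in>I. v j m / (1 - a j * q ^ m * t) * tail_factor j (N - m))"
  proof (rule sum.cong[OF refl], safe)
    fix j m assume "(j, m) \<in> I"
    then have j: "j < r" and m: "m < N" by (auto simp: I_def)
    have p1: "poly p (1 / \<alpha> (j, m)) = qpoch (q / (a j * q ^ m)) q N * (\<Prod>l<s. qpoch (b l / (a j * q ^ m)) q N)"
      unfolding pp by (simp add: \<alpha>_def)
    show "poly p (1 / \<alpha> (j, m)) / (\<Prod>y\<in>I - {(j, m)}. 1 - \<alpha> y / \<alpha> (j, m)) / (1 - \<alpha> (j, m) * t)
       = v j m / (1 - a j * q ^ m * t) * tail_factor j (N - m)"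
      unfolding p1 rem[OF j m] truncated_residue[OF j m] by (simp add: \<alpha>_def)
  qed
  also have "\<dots> = (\<Sum>j<r. \<Sum>m<N. v j m / (1 - a j * q ^ m * t) * tail_factor j (N - m))"
    unfolding I_def by (rule sum.cartesian_product[symmetric])
  finally show ?thesis unfolding pp den .
qed

end

section \<open>Double series with a shifted integer index\<close>

lemma summable_on_nat_geometric: "0 \<le> t \<Longrightarrow> t < 1 \<Longrightarrow> (\<lambda>n::nat. (t::real) ^ n) summable_on UNIV"
  by (intro norm_summable_imp_summable_on) auto

lemma has_sum_int_shift:
  fixes f :: "int \<Rightarrow> 'b :: {topological_semigroup_mult, t2_space, semiring_0}"
  assumes "f summable_on UNIV"
  shows "((\<lambda>n. c * f (k + n)) has_sum (c * infsum f UNIV)) UNIV"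
proof (rule has_sum_cmult_right)
  have "bij_betw (\<lambda>n. k + n) UNIV UNIV" by (rule bij_plus)
  from has_sum_reindex_bij_betw[OF this, of f] assms
  show "((\<lambda>n. f (k + n)) has_sum infsum f UNIV) UNIV" by auto
qed

text \<open>Fubini together with translation invariance: for fixed m the sum over all integers n
  does not see the shift \<open>h m\<close>, so the double sum factors. It is applied with
  \<open>h m\<close> = m for the Kronecker sums and with -m for the Laplace transform.\<close>

lemma shifted_double_sum:
  fixes c :: "nat \<Rightarrow> complex" and \<kappa> :: "int \<Rightarrow> complex" and h :: "nat \<Rightarrow> int"
  assumes cs: "(\<lambda>m. norm (c m)) summable_on UNIV" and ks: "(\<lambda>n. norm (\<kappa> n)) summable_on UNIV"
  shows "((\<lambda>n. \<Sum>\<^sub>\<infinity>m. c m * \<kappa> (h m + n)) has_sum infsum c UNIV * infsum \<kappa> UNIV) UNIV"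
proof -
  define F where "F = (\<lambda>(m, n). c m * \<kappa> (h m + n))"
  have abs: "(\<lambda>x. norm (F x)) summable_on UNIV \<times> UNIV"
  proof (rule Infinite_Sum.abs_summable_on_Sigma_iff[THEN iffD2], intro conjI ballI)
    have nF: "norm (F (m, n)) = norm (c m) * norm (\<kappa> (h m + n))" for m n
      by (simp only: F_def prod.case norm_mult)
    have hs: "((\<lambda>n. norm (F (m, n))) has_sum (norm (c m) * infsum (\<lambda>n. norm (\<kappa> n)) UNIV)) UNIV" for m
      unfolding nF by (rule has_sum_int_shift[OF ks])
    show "(\<lambda>n. norm (F (m, n))) summable_on UNIV" for m using hs has_sum_imp_summable by blast
    have "(\<lambda>m. norm (c m) * infsum (\<lambda>n. norm (\<kappa> n)) UNIV) summable_on UNIV"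
      by (rule summable_on_cmult_left[OF cs])
    then have "(\<lambda>m. \<Sum>\<^sub>\<infinity>n. norm (F (m, n))) summable_on UNIV"
      using infsumI[OF hs] by simp
    then show "(\<lambda>m. norm (\<Sum>\<^sub>\<infinity>n. norm (F (m, n)))) summable_on UNIV"
      by (simp add: infsum_nonneg)
  qed
  have tot: "(F has_sum infsum F (UNIV \<times> UNIV)) (UNIV \<times> UNIV)"
    using abs_summable_summable[OF abs] by simp
  have row: "((\<lambda>n. F (m, n)) has_sum (c m * infsum \<kappa> UNIV)) UNIV" for m
    unfolding F_def prod.case by (rule has_sum_int_shift[OF abs_summable_summable[OF ks]])
  have "((\<lambda>m. c m * infsum \<kappa> UNIV) has_sum infsum F (UNIV \<times> UNIV)) UNIV"
    by (rule has_sum_SigmaD[OF tot row])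
  moreover have "((\<lambda>m. c m * infsum \<kappa> UNIV) has_sum infsum c UNIV * infsum \<kappa> UNIV) UNIV"
    by (intro has_sum_cmult_left has_sum_infsum) (rule abs_summable_summable[OF cs])
  ultimately have val: "infsum F (UNIV \<times> UNIV) = infsum c UNIV * infsum \<kappa> UNIV"
    by (rule has_sum_unique)
  obtain B where B: "\<And>n. norm (\<kappa> n) \<le> B"
    using finite_sum_le_infsum[OF ks, of "{_}"] by (intro that[of "infsum (\<lambda>n. norm (\<kappa> n)) UNIV"]) simp
  have col: "((\<lambda>m. (\<lambda>(n, m). F (m, n)) (n, m)) has_sum (\<Sum>\<^sub>\<infinity>m. c m * \<kappa> (h m + n))) UNIV" for n
    unfolding prod.case F_def
  proof (rule has_sum_infsum, rule abs_summable_summable)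
    show "(\<lambda>m. norm (c m * \<kappa> (h m + n))) summable_on UNIV"
      by (rule Infinite_Sum.abs_summable_on_comparison_test'[OF summable_on_cmult_left[OF cs, of B]])
         (auto simp: norm_mult intro!: mult_left_mono B)
  qed
  have "((\<lambda>(n, m). F (m, n)) has_sum infsum F (UNIV \<times> UNIV)) (UNIV \<times> UNIV)"
    using tot by (rule has_sum_swap[THEN iffD1])
  from has_sum_SigmaD[OF this col] show ?thesis unfolding val .
qed

section \<open>Uniform bounds and the limit of the partial fractions\<close>

context qhyp_params
begin

text \<open>The Gaussian factor beats D^m for every D. Uniformity in the scaling factor c provides
  the majorant for the limit c to 1; the instance c = 1 gives convergence of the series in 1/z for
  all z except 0.\<close>

lemma residue_coeff_bound:
  assumes j: "j < r" and D: "0 \<le> D"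
  obtains C where "\<And>c m. 1 / 2 \<le> cmod c \<Longrightarrow> cmod c \<le> 2 \<Longrightarrow>
     cmod (residue_coeff q r s (\<lambda>i. c * a i) b j m) * D ^ m \<le> C * (1 / 2) ^ m"
proof -
  define U where "U x = exp (x / (1 - cmod q))" for x
  have U0: "0 \<le> U x" for x by (simp add: U_def)
  have U: "cmod (qpoch (c * x) q m) \<le> U (2 * cmod x)" if "cmod c \<le> 2" for c x m
    unfolding U_def by (rule norm_qpoch_le[OF q_lt_1]) (use that in \<open>simp add: norm_mult mult_right_mono\<close>)
  have "\<exists>B>0. \<forall>n. B \<le> cmod (qpoch (a j * q / a i) q n)" if "i \<in> {..<r} - {j}" for i
    using norm_qpoch_ge[OF q_lt_1, of "a j * q / a i"] ratio_reg(2)[of i j] that j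
    by (metis Diff_iff insertI1 lessThan_iff)
  then obtain L where L: "\<And>i. i \<in> {..<r} - {j} \<Longrightarrow> L i > 0"
     "\<And>i n. i \<in> {..<r} - {j} \<Longrightarrow> L i \<le> cmod (qpoch (a j * q / a i) q n)" by metis
  obtain L0 where L0: "L0 > 0" "\<And>n. L0 \<le> cmod (qpoch q q n)"
    using norm_qpoch_ge[OF q_lt_1 self_power_neq_1[OF q_lt_1]] by blast
  define Ub where "Ub l = U (2 * cmod (a j * q / b l))" for l
  define W where "W = U (2 * cmod (a j)) * (\<Prod>l<s. Ub l) / ((\<Prod>i\<in>{..<r} - {j}. L i) * L0)"
  have W0: "0 \<le> W" using L L0 U0 by (auto simp: W_def Ub_def less_imp_le intro!: divide_nonneg_pos mult_nonneg_nonneg prod_nonneg mult_pos_pos prod_pos)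
  have wb: "cmod (dual_coeff q r s (\<lambda>i. c * a i) b j m) \<le> W" if c: "1 / 2 \<le> cmod c" "cmod c \<le> 2" for c m
  proof -
    have c0: "c \<noteq> 0" using c by auto
    have Ub: "cmod (qpoch (c * (a j * q / b l)) q m) \<le> Ub l" for l
      unfolding Ub_def by (rule U[OF c(2)])
    have e: "c * a j * q / b l = c * (a j * q / b l)" "c * a j * q / (c * a i) = a j * q / a i" for l i
      using c0 by auto
    show ?thesis
      unfolding dual_coeff_def W_def norm_divide norm_mult prod_norm[symmetric] e
      by (intro frac_le mult_mono prod_mono mult_pos_pos prod_pos conjI U Ub c L0 prod_nonneg mult_nonneg_nonneg)
         (use L L0 U0 in \<open>auto simp: Ub_def intro: less_imp_le\<close>)
  qed
  \<comment> \<open>Scaling multiplies \<open>X j\<close> by c^k / c^r, which is at most 2^k 2^r in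
    modulus.\<close>
  define Y where "Y = 2 ^ k * 2 ^ r * cmod (X j)"
  have Xb: "cmod (dual_arg q r s (\<lambda>i. c * a i) b j) \<le> Y" if c: "1 / 2 \<le> cmod c" "cmod c \<le> 2" for c
  proof -
    have c0: "c \<noteq> 0" using c by auto
    have "dual_arg q r s (\<lambda>i. c * a i) b j = c ^ k * (1 / c) ^ r * X j"
      unfolding dual_arg_def prod.distrib by (simp add: power_mult_distrib power_divide)
    then have "cmod (dual_arg q r s (\<lambda>i. c * a i) b j) = cmod c ^ k * (1 / cmod c) ^ r * cmod (X j)"
      by (simp only: norm_mult norm_power norm_divide norm_one)
    also have "\<dots> \<le> Y" unfolding Y_def
      using c c0 by (intro mult_right_mono mult_mono power_mono) (auto simp: divide_le_eq)
    finally show ?thesis .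
  qed
  have Y0: "0 \<le> Y" by (simp add: Y_def)
  \<comment> \<open>The factor 2 is spent on the geometric decay (1/2)^m of the claim.\<close>
  obtain G where G: "G > 0" "\<And>n. (2 * Y * D) ^ n * cmod q ^ (n * (n - 1) div 2) \<le> G"
    by (rule gauss_power_bounded[of "cmod q" "2 * Y * D"]) (use q_lt_1 D Y0 in auto)
  show ?thesis
  proof (rule that)
    fix c m assume c: "1 / 2 \<le> cmod c" "cmod c \<le> 2"
    \<comment> \<open>One of the k Gaussian factors suffices, and k >= 1; lowering its exponent to
      m(m-1)/2 only weakens the bound.\<close>
    have "cmod q ^ (Suc m * m div 2) \<le> 1" using q_lt_1 by (intro power_le_one) auto
    then have "(cmod q ^ (Suc m * m div 2)) ^ k \<le> (cmod q ^ (Suc m * m div 2)) ^ 1"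
      using k_pos by (intro power_decreasing) auto
    also have "\<dots> \<le> cmod q ^ (m * (m - 1) div 2)"
      unfolding power_one_right tri_Suc using q_lt_1 by (intro power_decreasing) auto
    finally have T: "(cmod q ^ (Suc m * m div 2)) ^ k \<le> cmod q ^ (m * (m - 1) div 2)" .
    have "cmod (residue_coeff q r s (\<lambda>i. c * a i) b j m) =
       cmod (dual_coeff q r s (\<lambda>i. c * a i) b j m) * cmod (dual_arg q r s (\<lambda>i. c * a i) b j) ^ m * (cmod q ^ (Suc m * m div 2)) ^ k"
      unfolding residue_coeff_def by (simp only: norm_mult norm_power)
    also have "\<dots> \<le> W * Y ^ m * cmod q ^ (m * (m - 1) div 2)"
      by (intro mult_mono power_mono wb Xb c T) (use W0 Y0 in auto)
    finally have "cmod (residue_coeff q r s (\<lambda>i. c * a i) b j m) * D ^ m \<le> W * Y ^ m * cmod q ^ (m * (m - 1) div 2) * D ^ m"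
      by (rule mult_right_mono) (use D in auto)
    also have "\<dots> = W * (1 / 2) ^ m * ((2 * Y * D) ^ m * cmod q ^ (m * (m - 1) div 2))"
      by (simp add: power_mult_distrib power_divide)
    also have "\<dots> \<le> W * (1 / 2) ^ m * G"
      by (intro mult_left_mono G) (use W0 in auto)
    finally show "cmod (residue_coeff q r s (\<lambda>i. c * a i) b j m) * D ^ m \<le> (W * G) * (1 / 2) ^ m" by (simp add: mult_ac)
  qed
qed

lemma residue_coeff_summable:
  assumes "j < r" "0 \<le> D"
  shows "(\<lambda>m. cmod (v j m) * D ^ m) summable_on UNIV"
proof -
  obtain C where C: "\<And>c m. 1 / 2 \<le> cmod c \<Longrightarrow> cmod c \<le> 2 \<Longrightarrow>
     cmod (residue_coeff q r s (\<lambda>i. c * a i) b j m) * D ^ m \<le> C * (1 / 2) ^ m"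
    using residue_coeff_bound[OF assms] by blast
  have "(\<lambda>m. C * (1 / 2) ^ m) summable_on (UNIV :: nat set)"
    by (intro summable_on_cmult_right summable_on_nat_geometric) auto
  then have "(\<lambda>m. norm (cmod (v j m) * D ^ m)) summable_on UNIV"
    by (rule Infinite_Sum.abs_summable_on_comparison_test') (use C[of 1] assms in auto)
  then show ?thesis using assms by (simp add: abs_mult)
qed

lemma residue_terms_summable:
  assumes j: "j < r" and t: "\<And>m. a j * q ^ m * t \<noteq> 1"
  shows "(\<lambda>m. norm (v j m / (1 - a j * q ^ m * t))) summable_on UNIV"
proof -
  obtain B where B: "B > 0" "\<And>m. cmod (1 / (1 - a j * t * q ^ m)) \<le> B"
    using bounded_inverse_1_minus[OF q_lt_1, of "a j * t"] t by (auto simp: mult_ac)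
  have "(\<lambda>m. cmod (v j m) * 1 ^ m * B) summable_on UNIV"
    by (intro summable_on_cmult_left residue_coeff_summable j) auto
  then show ?thesis
  proof (rule Infinite_Sum.abs_summable_on_comparison_test')
    fix m
    have "norm (v j m / (1 - a j * q ^ m * t)) = cmod (v j m) * cmod (1 / (1 - a j * t * q ^ m))"
      by (simp add: norm_divide mult_ac)
    also have "\<dots> \<le> cmod (v j m) * B" by (intro mult_left_mono B) auto
    finally show "norm (v j m / (1 - a j * q ^ m * t)) \<le> cmod (v j m) * 1 ^ m * B" by simp
  qed
qed

theorem partial_fraction_expansion:
  assumes t: "\<And>i m. i < r \<Longrightarrow> a i * q ^ m * t \<noteq> 1"
  shows "qpoch_inf (q * t) q * (\<Prod>l<s. qpoch_inf (b l * t) q) / (\<Prod>i<r. qpoch_inf (a i * t) q) =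
    (\<Sum>j<r. (\<Sum>\<^sub>\<infinity>m. v j m / (1 - a j * q ^ m * t)) * tail_limit j)"
proof (rule LIMSEQ_unique)
  let ?f = "\<lambda>N. qpoch (q * t) q N * (\<Prod>l<s. qpoch (b l * t) q N) / (\<Prod>i<r. qpoch (a i * t) q N)"
  have nz: "qpoch_inf (a i * t) q \<noteq> 0" if "i < r" for i
    using t[OF that] by (auto simp: qpoch_inf_eq_0_iff[OF q_lt_1] mult_ac)
  show "?f \<longlonglongrightarrow> qpoch_inf (q * t) q * (\<Prod>l<s. qpoch_inf (b l * t) q) / (\<Prod>i<r. qpoch_inf (a i * t) q)"
    by (intro tendsto_intros qpoch_tendsto q_lt_1) (use nz in auto)
  have "(\<lambda>N. \<Sum>j<r. \<Sum>m<N. v j m / (1 - a j * q ^ m * t) * tail_factor j (N - m))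
     \<longlonglongrightarrow> (\<Sum>j<r. (\<Sum>\<^sub>\<infinity>m. v j m / (1 - a j * q ^ m * t)) * tail_limit j)"
  proof (rule tendsto_sum)
    fix j assume "j \<in> {..<r}"
    then have j: "j < r" by simp
    obtain K where K: "\<And>n. cmod (tail_factor j n) \<le> K" using tail_factor_bounded[OF j] by blast
    show "(\<lambda>N. \<Sum>m<N. v j m / (1 - a j * q ^ m * t) * tail_factor j (N - m))
       \<longlonglongrightarrow> (\<Sum>\<^sub>\<infinity>m. v j m / (1 - a j * q ^ m * t)) * tail_limit j"
    proof (rule tannery_weighted_sums[where K = K])
      show "(\<lambda>m. norm (v j m / (1 - a j * q ^ m * t))) summable_on UNIV"
        by (rule residue_terms_summable[OF j t[OF j]])
      show "\<forall>\<^sub>F N in sequentially. m \<in> {..<N}" for m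
        using eventually_gt_at_top[of m] by eventually_elim simp
      show "(\<lambda>N. tail_factor j (N - m)) \<longlonglongrightarrow> tail_limit j" for m
        by (rule filterlim_compose[OF tail_factor_tendsto[OF j] filterlim_minus_const_nat_at_top])
    qed (use K in auto)
  qed
  then show "?f \<longlonglongrightarrow> (\<Sum>j<r. (\<Sum>\<^sub>\<infinity>m. v j m / (1 - a j * q ^ m * t)) * tail_limit j)"
  proof (rule Lim_transform_eventually)
    show "\<forall>\<^sub>F N in sequentially. (\<Sum>j<r. \<Sum>m<N. v j m / (1 - a j * q ^ m * t) * tail_factor j (N - m)) = ?f N"
      using eventually_gt_at_top[of 0] by eventually_elim (use truncated_partial_fractions t in auto)
  qed
qed

lemma phi_coeff_bounded:
  obtains K where "\<And>n. cmod (u n) \<le> K"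
proof -
  have "(\<lambda>n. u n) \<longlonglongrightarrow> (\<Prod>i<r. qpoch_inf (a i) q) / ((\<Prod>l<s. qpoch_inf (b l) q) * qpoch_inf q q)"
    unfolding phi_coeff_def
    by (intro tendsto_intros qpoch_tendsto q_lt_1)
       (use b_reg qpoch_inf_self_nonzero[OF q_lt_1] in \<open>auto simp: qpoch_inf_eq_0_iff[OF q_lt_1]\<close>)
  then have "Bseq u" by (intro convergent_imp_Bseq convergentI)
  then show ?thesis by (elim BseqE) (use that in blast)
qed

lemma phi_series_summable:
  assumes "cmod z < 1"
  shows "(\<lambda>n. norm (u n * z ^ n)) summable_on UNIV"
proof -
  obtain K where K: "\<And>n. cmod (u n) \<le> K" using phi_coeff_bounded by blast
  have "(\<lambda>n. K * cmod z ^ n) summable_on UNIV"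
    by (intro summable_on_cmult_right summable_on_nat_geometric) (use assms in auto)
  then show ?thesis
    by (rule Infinite_Sum.abs_summable_on_comparison_test') (auto simp: norm_mult norm_power intro!: mult_right_mono K)
qed

text \<open>Since z^n = z^(-m) z^(m+n), each pole a_j q^m contributes the Kronecker sum of a_j
  itself, shifted by m and weighted by z^(-m). This is where powers of 1/z come from.\<close>

lemma kronecker_double_sum:
  assumes j: "j < r" and z: "cmod q < cmod z" "cmod z < 1" and gen: "\<And>n. a j * q powi n \<noteq> 1"
  shows "((\<lambda>n::int. z powi n * (\<Sum>\<^sub>\<infinity>m. v j m / (1 - a j * q ^ m * q powi n))) has_sum
     (\<Sum>\<^sub>\<infinity>m. v j m / z ^ m) * (\<Sum>\<^sub>\<infinity>n::int. z powi n / (1 - a j * q powi n))) UNIV"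
proof -
  have z0: "z \<noteq> 0" using z by auto
  define \<kappa> where "\<kappa> n = z powi n / (1 - a j * q powi n)" for n :: int
  have ks: "(\<lambda>n. norm (\<kappa> n)) summable_on UNIV"
    unfolding \<kappa>_def by (rule kronecker_abs_summable[OF q_nz z a_nz[OF j] gen])
  have "norm (v j m / z ^ m) = cmod (v j m) * (1 / cmod z) ^ m" for m
    by (simp add: norm_divide norm_power power_divide)
  then have cs: "(\<lambda>m. norm (v j m / z ^ m)) summable_on UNIV"
    using residue_coeff_summable[OF j, of "1 / cmod z"] by simp
  have e: "v j m / z ^ m * \<kappa> (int m + n) = z powi n * (v j m / (1 - a j * q ^ m * q powi n))" for m n
    using z0 q_nz by (simp add: \<kappa>_def power_int_add mult_ac)
  have "(\<Sum>\<^sub>\<infinity>m. v j m / z ^ m * \<kappa> (int m + n)) = z powi n * (\<Sum>\<^sub>\<infinity>m. v j m / (1 - a j * q ^ m * q powi n))" for n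
    unfolding e by (rule infsum_cmult_right')
  then show ?thesis
    using shifted_double_sum[OF cs ks, of int] by (simp add: \<kappa>_def)
qed

end

section \<open>Connection formula\<close>

lemma has_sum_sum_finite:
  fixes f :: "'i \<Rightarrow> 'a \<Rightarrow> 'b :: topological_comm_monoid_add"
  assumes "finite I" "\<And>i. i \<in> I \<Longrightarrow> (f i has_sum S i) B"
  shows "((\<lambda>x. \<Sum>i\<in>I. f i x) has_sum (\<Sum>i\<in>I. S i)) B"
  using assms by (induction I rule: finite_induct) (auto intro: has_sum_add)

lemma power_neq_inverse:
  fixes q c :: complex
  assumes "q \<noteq> 0" "\<And>n. c * q powi n \<noteq> 1"
  shows "c * q ^ n \<noteq> 1" "q / c * q ^ n \<noteq> 1"
proof -
  show "c * q ^ n \<noteq> 1" using assms(2)[of "int n"] by simp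
  show "q / c * q ^ n \<noteq> 1"
  proof
    assume *: "q / c * q ^ n = 1"
    then have "c \<noteq> 0" by (metis div_by_0 mult_zero_left zero_neq_one)
    with * have "c = q ^ Suc n" by (simp add: field_simps)
    then show False using assms(2)[of "- int (Suc n)"] assms(1)
      unfolding power_int_minus power_int_of_nat by (metis right_inverse power_not_zero)
  qed
qed

context qhyp_params
begin

lemma connection_generic:
  assumes gen: "\<And>i n. i < r \<Longrightarrow> a i * q powi n \<noteq> 1" and z: "cmod q < cmod z" "cmod z < 1"
  shows "(\<Sum>\<^sub>\<infinity>n. u n * z ^ n) =
    (\<Sum>j<r. A j * (theta_prod q (a j * z) / theta_prod q z) * (\<Sum>\<^sub>\<infinity>m. v j m / z ^ m))"
proof -
  have z0: "z \<noteq> 0" using z by auto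
  define R where "R t = qpoch_inf (q * t) q * (\<Prod>l<s. qpoch_inf (b l * t) q) / (\<Prod>i<r. qpoch_inf (a i * t) q)" for t
  define V where "V j = (\<Sum>\<^sub>\<infinity>m. v j m / z ^ m)" for j
  define K where "K j = (\<Sum>\<^sub>\<infinity>n::int. z powi n / (1 - a j * q powi n))" for j
  have expand: "R (q powi n) = (\<Sum>j<r. (\<Sum>\<^sub>\<infinity>m. v j m / (1 - a j * q ^ m * q powi n)) * tail_limit j)" for n
    unfolding R_def
  proof (rule partial_fraction_expansion)
    show "a i * q ^ m * q powi n \<noteq> 1" if "i < r" for i m
      using gen[OF that, of "int m + n"] q_nz by (simp add: power_int_add mult_ac)
  qed
  have sum1: "((\<lambda>n. z powi n * R (q powi n)) has_sum (\<Sum>j<r. V j * K j * tail_limit j)) UNIV"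
    unfolding expand sum_distrib_left mult.assoc[symmetric]
    by (intro has_sum_sum_finite has_sum_cmult_left)
       (use kronecker_double_sum[OF _ z] gen in \<open>auto simp: V_def K_def mult.assoc\<close>)
  have anz: "qpoch (a i) q n \<noteq> 0" "qpoch_inf (a i) q \<noteq> 0" "qpoch_inf (q / a i) q \<noteq> 0" if "i < r" for i n
    using power_neq_inverse[OF q_nz gen[OF that]] by (auto simp: qpoch_eq_0_iff qpoch_inf_eq_0_iff[OF q_lt_1])
  have bnz: "qpoch (b l) q n \<noteq> 0" "qpoch_inf (b l) q \<noteq> 0" if "l < s" for l n
    using b_reg[OF that] by (auto simp: qpoch_eq_0_iff qpoch_inf_eq_0_iff[OF q_lt_1])
  note qnz = qpoch_self_nonzero[OF q_lt_1] qpoch_inf_self_nonzero[OF q_lt_1]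
  have quot: "qpoch_inf (c * q ^ n) q = qpoch_inf c q / qpoch c q n" if "qpoch c q n \<noteq> 0" for c n
    using qpoch_inf_split[OF q_lt_1, of c n] that by simp
  have pos: "R (q ^ n) = R 1 * u n" for n
  proof -
    have "(\<Prod>i<r. qpoch_inf (a i * q ^ n) q) = (\<Prod>i<r. qpoch_inf (a i) q) / (\<Prod>i<r. qpoch (a i) q n)"
      unfolding prod_dividef[symmetric] by (rule prod.cong) (use anz quot in auto)
    moreover have "(\<Prod>l<s. qpoch_inf (b l * q ^ n) q) = (\<Prod>l<s. qpoch_inf (b l) q) / (\<Prod>l<s. qpoch (b l) q n)"
      unfolding prod_dividef[symmetric] by (rule prod.cong) (use bnz quot in auto)
    moreover have "qpoch_inf (q * q ^ n) q = qpoch_inf q q / qpoch q q n"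
      by (rule quot) (rule qnz)
    ultimately show ?thesis by (simp add: R_def phi_coeff_def mult_ac)
  qed
  have neg: "R (q powi (- int (Suc n))) = 0" for n
  proof -
    have "q * q powi (- int (Suc n)) * q ^ n = 1"
      unfolding power_int_minus power_int_of_nat using q_nz by (simp add: field_simps)
    then have "qpoch_inf (q * q powi (- int (Suc n))) q = 0"
      using qpoch_inf_eq_0_iff[OF q_lt_1] by blast
    then show ?thesis by (simp add: R_def)
  qed
  have "((\<lambda>n. z powi n * R (q powi n)) has_sum (\<Sum>j<r. V j * K j * tail_limit j)) (range int)"
  proof (rule has_sum_cong_neutral[THEN iffD1, OF _ _ _ sum1])
    fix n :: int assume "n \<in> UNIV - range int"
    then show "z powi n * R (q powi n) = 0" using neg by (cases n) auto
  qed auto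
  then have "((\<lambda>n. R 1 * (u n * z ^ n)) has_sum (\<Sum>j<r. V j * K j * tail_limit j)) UNIV"
    by (subst (asm) has_sum_reindex) (auto simp: o_def pos mult_ac)
  moreover have "((\<lambda>n. R 1 * (u n * z ^ n)) has_sum R 1 * (\<Sum>\<^sub>\<infinity>n. u n * z ^ n)) UNIV"
    by (intro has_sum_cmult_right has_sum_infsum) (rule abs_summable_summable[OF phi_series_summable[OF z(2)]])
  ultimately have eq: "R 1 * (\<Sum>\<^sub>\<infinity>n. u n * z ^ n) = (\<Sum>j<r. V j * K j * tail_limit j)"
    by (rule has_sum_unique[symmetric])
  have R1: "R 1 \<noteq> 0" using anz bnz qnz by (auto simp: R_def)
  \<comment> \<open>The Kronecker sum brings the denominator (a_j;q)_infinity (q/a_j;q)_infinity.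
    The first factor is cancelled by 1/R(1), the second by \<open>tail_limit j\<close>, so the
    coefficient stays finite when a_j becomes a power of q.\<close>
  have coeff: "K j * tail_limit j / R 1 = A j * (theta_prod q (a j * z) / theta_prod q z)" if j: "j < r" for j
  proof -
    define P where "P = (\<Prod>i\<in>{..<r} - {j}. qpoch_inf (a i) q)"
    define P' where "P' = (\<Prod>i\<in>{..<r} - {j}. qpoch_inf (a i / a j) q)"
    define B where "B = (\<Prod>l<s. qpoch_inf (b l) q)"
    define B' where "B' = (\<Prod>l<s. qpoch_inf (b l / a j) q)"
    have pr: "(\<Prod>i<r. qpoch_inf (a i) q) = qpoch_inf (a j) q * P"
      unfolding P_def using j by (intro prod.remove) auto
    have "K j = (qpoch_inf q q)\<^sup>2 * theta_prod q (a j * z) / (theta_prod q (a j) * theta_prod q z)"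
      unfolding K_def by (rule kronecker_sum[OF q_nz z a_nz[OF j] gen[OF j]])
    moreover have "theta_prod q (a j) = qpoch_inf (a j) q * qpoch_inf (q / a j) q" by (simp add: theta_prod_def)
    moreover have "tail_limit j = qpoch_inf (q / a j) q * B' / (P' * qpoch_inf q q)"
      by (simp add: tail_limit_def B'_def P'_def)
    moreover have "R 1 = qpoch_inf q q * B / (qpoch_inf (a j) q * P)"
      by (simp add: R_def pr B_def)
    moreover have "A j = P / P' * (B' / B)"
      by (simp add: connection_coeff_def P_def P'_def B_def B'_def prod_dividef)
    moreover have "B \<noteq> 0" "P \<noteq> 0" using anz bnz by (auto simp: B_def P_def)
    ultimately show ?thesis using anz[OF j] qnz
      by (simp add: power2_eq_square mult_ac)
  qed
  have "(\<Sum>\<^sub>\<infinity>n. u n * z ^ n) = (\<Sum>j<r. V j * K j * tail_limit j) / R 1"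
    using eq R1 by (simp add: eq_divide_eq mult.commute)
  also have "\<dots> = (\<Sum>j<r. V j * (K j * tail_limit j / R 1))"
    by (simp add: sum_divide_distrib mult.assoc)
  also have "\<dots> = (\<Sum>j<r. A j * (theta_prod q (a j * z) / theta_prod q z) * V j)"
    by (intro sum.cong refl) (simp only: coeff lessThan_iff mult.commute)
  finally show ?thesis unfolding V_def .
qed

text \<open>Scaling all $a_i$ by a common factor keeps the ratios $a_i / a_j$, so no denominator of the
  connection formula changes and the limit back to the original parameters is uniform.\<close>

lemma scaled_params:
  assumes "c \<noteq> 0"
  shows "qhyp_params q r s (\<lambda>i. c * a i) b"
  by unfold_locales (use assms q_nz q_lt_1 r_gt a_nz b_nz b_reg a_reg in auto)

text \<open>The forbidden scalings form a countable set, and no disc is countable.\<close>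

lemma generic_scaling_sequence:
  obtains c where "c \<longlonglongrightarrow> 1" "\<And>N. 1 / 2 \<le> cmod (c N)" "\<And>N. cmod (c N) \<le> 2"
    "\<And>N i n. i < r \<Longrightarrow> c N * a i * q powi n \<noteq> 1"
proof -
  define S where "S = (\<Union>i<r. range (\<lambda>n::int. 1 / (a i * q powi n)))"
  have "countable S" unfolding S_def by (intro countable_UN countable_image) auto
  \<comment> \<open>Radii 1/(2 + N) tend to 0 and never exceed 1/2, which keeps |c| between 1/2 and
    2.\<close>
  then have "\<not> ball 1 (1 / (2 + real N)) \<subseteq> S" for N
    using uncountable_ball[of "1 / (2 + real N)" "1::complex"] countable_subset by fastforce
  then have "\<forall>N. \<exists>c. c \<in> ball 1 (1 / (2 + real N)) \<and> c \<notin> S" by blast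
  then obtain c where c: "\<And>N. c N \<in> ball 1 (1 / (2 + real N))" "\<And>N. c N \<notin> S"
    by metis
  have d: "cmod (c N - 1) \<le> 1 / (2 + real N)" for N
    using c(1)[of N] by (simp add: dist_norm norm_minus_commute)
  have d2: "cmod (c N - 1) \<le> 1 / 2" for N
    by (rule order_trans[OF d]) (simp add: divide_le_eq)
  show ?thesis
  proof (rule that[of c])
    have "(\<lambda>N. 1 / (2 + real N)) \<longlonglongrightarrow> 0" by real_asymp
    then have "(\<lambda>N. c N - 1) \<longlonglongrightarrow> 0"
      by (rule Lim_null_comparison[rotated]) (use d in auto)
    then show "c \<longlonglongrightarrow> 1" by (simp add: LIM_zero_iff)
    show "1 / 2 \<le> cmod (c N)" "cmod (c N) \<le> 2" for N
      using d2[of N] norm_triangle_ineq2[of 1 "c N"] norm_triangle_ineq2[of "c N" 1] by (simp_all add: norm_minus_commute)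
    show "c N * a i * q powi n \<noteq> 1" if "i < r" for N i n
    proof
      assume "c N * a i * q powi n = 1"
      then have "c N = 1 / (a i * q powi n)" using a_nz[OF that] q_nz by (simp add: field_simps)
      then show False using c(2)[of N] that by (auto simp: S_def)
    qed
  qed
qed

lemma phi_coeff_scaled_bound:
  obtains K where "\<And>c n. cmod c \<le> 2 \<Longrightarrow> cmod (phi_coeff q r s (\<lambda>i. c * a i) b n) \<le> K"
proof -
  define U where "U i = exp (2 * cmod (a i) / (1 - cmod q))" for i
  have U: "cmod (qpoch (c * a i) q m) \<le> U i" if "cmod c \<le> 2" for c i m
    unfolding U_def by (rule norm_qpoch_le[OF q_lt_1]) (use that in \<open>simp add: norm_mult mult_right_mono\<close>)
  have "\<exists>B>0. \<forall>n. B \<le> cmod (qpoch (b l) q n)" if "l < s" for l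
    using norm_qpoch_ge[OF q_lt_1, of "b l"] b_reg[OF that] by metis
  then obtain L where L: "\<And>l. l < s \<Longrightarrow> L l > 0" "\<And>l n. l < s \<Longrightarrow> L l \<le> cmod (qpoch (b l) q n)"
    by metis
  obtain L0 where L0: "L0 > 0" "\<And>n. L0 \<le> cmod (qpoch q q n)"
    using norm_qpoch_ge[OF q_lt_1 self_power_neq_1[OF q_lt_1]] by blast
  show ?thesis
  proof (rule that)
    fix c n assume c: "cmod c \<le> 2"
    show "cmod (phi_coeff q r s (\<lambda>i. c * a i) b n) \<le> (\<Prod>i<r. U i) / ((\<Prod>l<s. L l) * L0)"
      unfolding phi_coeff_def norm_divide norm_mult prod_norm[symmetric]
      by (intro frac_le mult_mono prod_mono mult_pos_pos prod_pos conjI U c L0 prod_nonneg)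
         (use L L0 in \<open>auto simp: U_def intro: less_imp_le\<close>)
  qed
qed

text \<open>Both sides are limits of the generic formula along the scaling sequence. The series may
  be passed to the limit termwise, with majorants K |z|^n on the left and C / 2^m on the right that
  hold for all scalings used.\<close>

lemma connection_annulus:
  assumes z: "cmod q < cmod z" "cmod z < 1"
  shows "(\<Sum>\<^sub>\<infinity>n. u n * z ^ n) =
    (\<Sum>j<r. A j * (theta_prod q (a j * z) / theta_prod q z) * (\<Sum>\<^sub>\<infinity>m. v j m / z ^ m))"
proof -
  have z0: "z \<noteq> 0" using z by auto
  obtain c where c: "c \<longlonglongrightarrow> 1" "\<And>N. 1 / 2 \<le> cmod (c N)" "\<And>N. cmod (c N) \<le> 2"
    "\<And>N i n. i < r \<Longrightarrow> c N * a i * q powi n \<noteq> 1"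
    using generic_scaling_sequence by blast
  have c0: "c N \<noteq> 0" for N using c(2)[of N] by auto
  have qp: "(\<lambda>N. qpoch (f N) q n) \<longlonglongrightarrow> qpoch x q n" if "f \<longlonglongrightarrow> x" for f x n
    unfolding qpoch_def by (intro tendsto_intros that)
  have ca: "(\<lambda>N. c N * x) \<longlonglongrightarrow> x" for x using tendsto_mult[OF c(1) tendsto_const, of x] by simp
  have bnz: "qpoch (b l) q n \<noteq> 0" "qpoch_inf (b l) q \<noteq> 0" if "l < s" for l n
    using b_reg[OF that] by (auto simp: qpoch_eq_0_iff qpoch_inf_eq_0_iff[OF q_lt_1])
  have rnz: "qpoch (a j * q / a i) q n \<noteq> 0" "qpoch_inf (a i / a j) q \<noteq> 0" if "i < r" "j < r" "i \<noteq> j" for i j n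
    using ratio_reg[OF that] by (auto simp: qpoch_eq_0_iff qpoch_inf_eq_0_iff[OF q_lt_1])
  obtain K where K: "\<And>c n. cmod c \<le> 2 \<Longrightarrow> cmod (phi_coeff q r s (\<lambda>i. c * a i) b n) \<le> K"
    using phi_coeff_scaled_bound by blast
  have left: "(\<lambda>N. \<Sum>\<^sub>\<infinity>n. phi_coeff q r s (\<lambda>i. c N * a i) b n * z ^ n) \<longlonglongrightarrow> (\<Sum>\<^sub>\<infinity>n. u n * z ^ n)"
  proof (rule infsum_tannery)
    show "(\<lambda>N. phi_coeff q r s (\<lambda>i. c N * a i) b n * z ^ n) \<longlonglongrightarrow> u n * z ^ n" for n
      unfolding phi_coeff_def
      by (intro tendsto_intros qp ca) (use bnz qpoch_self_nonzero[OF q_lt_1] in auto)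
    show "norm (phi_coeff q r s (\<lambda>i. c N * a i) b n * z ^ n) \<le> K * cmod z ^ n" for N n
      by (simp only: norm_mult norm_power) (intro mult_right_mono K c zero_le_power norm_ge_zero)
    show "(\<lambda>n. K * cmod z ^ n) summable_on UNIV"
      by (intro summable_on_cmult_right summable_on_nat_geometric) (use z in auto)
  qed
  have right: "(\<lambda>N. \<Sum>j<r. connection_coeff q r s (\<lambda>i. c N * a i) b j * (theta_prod q (c N * a j * z) / theta_prod q z)
       * (\<Sum>\<^sub>\<infinity>m. residue_coeff q r s (\<lambda>i. c N * a i) b j m / z ^ m))
     \<longlonglongrightarrow> (\<Sum>j<r. A j * (theta_prod q (a j * z) / theta_prod q z) * (\<Sum>\<^sub>\<infinity>m. v j m / z ^ m))"
  proof (rule tendsto_sum, intro tendsto_mult)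
    fix j assume "j \<in> {..<r}"
    then have j: "j < r" by simp
    note aj = a_nz[OF j]
    have rat: "c N * a i / (c N * a j) = a i / a j" "c N * a j * q / (c N * a i) = a j * q / a i" for N i
      using c0[of N] by auto
    have inv: "(\<lambda>N. x / (c N * a j)) \<longlonglongrightarrow> x / a j" for x
      by (intro tendsto_intros ca aj)
    show "(\<lambda>N. connection_coeff q r s (\<lambda>i. c N * a i) b j) \<longlonglongrightarrow> A j"
      unfolding connection_coeff_def rat
      by (intro tendsto_intros ca inv q_lt_1) (use bnz rnz j in auto)
    have th: "theta_prod q z \<noteq> 0"
      using theta_prod_eq_0_iff[OF q_nz q_lt_1 z0] annulus_not_power[OF q_nz z] by blast
    have inv2: "(\<lambda>N. q / (c N * a j * z)) \<longlonglongrightarrow> q / (a j * z)"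
      by (intro tendsto_intros ca) (use aj z0 in auto)
    show "(\<lambda>N. theta_prod q (c N * a j * z) / theta_prod q z) \<longlonglongrightarrow> theta_prod q (a j * z) / theta_prod q z"
      unfolding theta_prod_def[of q "_ * _"]
      by (intro tendsto_intros ca inv2 q_lt_1 th)
    obtain C where C: "\<And>c m. 1 / 2 \<le> cmod c \<Longrightarrow> cmod c \<le> 2 \<Longrightarrow>
       cmod (residue_coeff q r s (\<lambda>i. c * a i) b j m) * (1 / cmod z) ^ m \<le> C * (1 / 2) ^ m"
      using residue_coeff_bound[OF j, of "1 / cmod z"] by auto
    show "(\<lambda>N. \<Sum>\<^sub>\<infinity>m. residue_coeff q r s (\<lambda>i. c N * a i) b j m / z ^ m) \<longlonglongrightarrow> (\<Sum>\<^sub>\<infinity>m. v j m / z ^ m)"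
    proof (rule infsum_tannery)
      have prodnz: "(\<Prod>i<r. a i) \<noteq> 0" using a_nz by auto
      have ca2: "(\<lambda>N. c N * a j * q / x) \<longlonglongrightarrow> a j * q / x" if "x \<noteq> 0" for x
        by (intro tendsto_intros ca that)
      show "(\<lambda>N. residue_coeff q r s (\<lambda>i. c N * a i) b j m / z ^ m) \<longlonglongrightarrow> v j m / z ^ m" for m
        unfolding residue_coeff_def dual_coeff_def dual_arg_def rat
        by (intro tendsto_intros qp ca ca2) (use prodnz rnz[OF _ j] z0 b_nz qpoch_self_nonzero[OF q_lt_1] in auto)
      show "norm (residue_coeff q r s (\<lambda>i. c N * a i) b j m / z ^ m) \<le> C * (1 / 2) ^ m" for N m
        using C[OF c(2,3), of N m] by (simp add: norm_divide norm_power power_divide)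
      show "(\<lambda>m. C * (1 / 2) ^ m) summable_on (UNIV :: nat set)"
        by (intro summable_on_cmult_right summable_on_nat_geometric) auto
    qed
  qed
  have "(\<Sum>\<^sub>\<infinity>n. phi_coeff q r s (\<lambda>i. c N * a i) b n * z ^ n) =
     (\<Sum>j<r. connection_coeff q r s (\<lambda>i. c N * a i) b j * (theta_prod q (c N * a j * z) / theta_prod q z)
       * (\<Sum>\<^sub>\<infinity>m. residue_coeff q r s (\<lambda>i. c N * a i) b j m / z ^ m))" for N
  proof -
    interpret sc: qhyp_params q r s "\<lambda>i. c N * a i" b by (rule scaled_params[OF c0])
    show ?thesis by (rule sc.connection_generic[OF c(4) z])
  qed
  then show ?thesis using LIMSEQ_unique[OF left] right by simp
qed

end

section \<open>Theta quotients along spirals and domination by theta\<close>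

lemma open_theta_prod_nonzero:
  assumes "q \<noteq> 0" "cmod q < 1"
  shows "open {z. z \<noteq> 0 \<and> theta_prod q z \<noteq> 0}"
proof -
  have "open (- {0} \<inter> theta_prod q -` (- {0}))"
    by (rule continuous_open_preimage[OF holomorphic_on_imp_continuous_on[OF theta_prod_holomorphic]]) (use assms in auto)
  moreover have "- {0} \<inter> theta_prod q -` (- {0}) = {z. z \<noteq> 0 \<and> theta_prod q z \<noteq> 0}" by auto
  ultimately show ?thesis by simp
qed

text \<open>For connectedness: a connected open subset of the plane stays connected when a countable
  set is removed, so no geometry of the spiral of zeros is needed for analytic continuation.\<close>

lemma countable_theta_prod_zeros:
  assumes "q \<noteq> 0" "cmod q < 1"
  shows "countable {z. z = 0 \<or> theta_prod q z = 0}"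
proof (rule countable_subset)
  show "{z. z = 0 \<or> theta_prod q z = 0} \<subseteq> insert 0 (range (\<lambda>n::int. q powi n))"
    using theta_prod_eq_0_iff[OF assms] by auto
qed auto

lemma theta_prod_conv_qtheta:
  assumes "q \<noteq> 0" "cmod q < 1" "x \<noteq> 0"
  shows "theta_prod q x = qtheta q (- x) / qpoch_inf q q"
  using jacobi_triple_product[of q "- x"] qpoch_inf_self_nonzero[of q] assms by simp

text \<open>Numerator and denominator acquire the same Gaussian factor under the shift; it cancels,
  and only a geometric factor remains. This is the source of the moderate growth along
  spirals.\<close>

lemma theta_prod_ratio_shift:
  assumes q: "q \<noteq> 0" "cmod q < 1" and c: "c \<noteq> 0" and z: "z \<noteq> 0"
  shows "theta_prod q (c * (z * q powi n)) / theta_prod q (z * q powi n) =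
    c powi (- n) * (theta_prod q (c * z) / theta_prod q z)"
proof -
  have *: "theta_prod q (x * q powi n) = theta_prod q x / (q powi (n * (n - 1) div 2) * (- x) powi n)" if "x \<noteq> 0" for x
    using qtheta_shift[OF q(1), of "- x" n] that q by (simp add: theta_prod_conv_qtheta)
  have "theta_prod q (c * (z * q powi n)) = theta_prod q (c * z) / (q powi (n * (n - 1) div 2) * (c powi n * (- z) powi n))"
    using *[of "c * z"] c z by (simp add: mult.assoc power_int_mult_distrib[symmetric])
  then show ?thesis
    unfolding *[OF z] power_int_minus using q c z by (simp add: divide_inverse mult_ac)
qed

lemma theta_prod_shift_eq_0_iff:
  assumes q: "q \<noteq> 0" "cmod q < 1" and x: "x \<noteq> 0"
  shows "theta_prod q (x * q powi n) = 0 \<longleftrightarrow> theta_prod q x = 0"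
  using qtheta_shift[OF q(1), of "- x" n] assms by (simp add: theta_prod_conv_qtheta)

lemma infsum_nat_eq_suminf:
  fixes f :: "nat \<Rightarrow> 'a :: banach"
  assumes "(\<lambda>n. norm (f n)) summable_on UNIV"
  shows "infsum f UNIV = suminf f" "summable f"
proof -
  have "f sums infsum f UNIV"
    by (rule has_sum_imp_sums[OF has_sum_infsum[OF abs_summable_summable[OF assms]]])
  then show "infsum f UNIV = suminf f" "summable f" by (auto simp: sums_iff)
qed

lemma powi_norm_le:
  assumes "x \<noteq> 0" "norm x \<le> D" "1 / D \<le> norm x" "1 \<le> (D::real)"
  shows "norm ((x :: 'a :: real_normed_field) powi n) \<le> D ^ nat \<bar>n\<bar>"
proof (cases n rule: int_nat_cases)
  case (nonneg m)
  show ?thesis unfolding nonneg power_int_of_nat using assms by (auto simp: norm_power intro!: power_mono)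
next
  case (neg m)
  have "1 / norm x \<le> D" using assms by (simp add: field_simps)
  then have "(1 / norm x) ^ m \<le> D ^ m" by (intro power_mono) auto
  then show ?thesis unfolding neg power_int_minus power_int_of_nat
    by (simp add: norm_inverse norm_power power_divide divide_inverse power_inverse)
qed

text \<open>For positive arguments one term bounds the theta series from below. At y t^n the term
  with index -n is 1/T with T = t^(n(n-1)/2) y^n, and it outgrows every geometric sequence in |n|.
  Taking \<open>C + 1\<close> instead of \<open>C\<close> makes the inequality strict.\<close>

lemma theta_dominates:
  fixes t D B :: real
  assumes t: "0 < t" "t < 1" and D: "1 \<le> D" and B: "0 \<le> B"
  obtains L where "L > 0" "\<And>y n. 1 / D \<le> y \<Longrightarrow> y \<le> D \<Longrightarrow> B ^ nat \<bar>n\<bar> < L * qtheta t (y * t powi n)"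
proof -
  obtain C where C: "C > 0" "\<And>n. (B * D) ^ nat \<bar>n\<bar> * norm (t powi (n * (n - 1) div 2) * 1 powi n) \<le> C"
    by (rule gauss_powi_bounded[of t 1 "B * D"]) (use t D B in auto)
  show ?thesis
  proof (rule that[of "C + 1"])
    fix y :: real and n :: int assume y: "1 / D \<le> y" "y \<le> D"
    have "0 < 1 / D" using D by simp
    then have y0: "y > 0" using y by linarith
    define z where "z = y * t powi n"
    have z0: "z > 0" using y0 t by (simp add: z_def)
    define T where "T = t powi (n * (n - 1) div 2) * y powi n"
    have T0: "T > 0" using t y0 by (simp add: T_def)
    have "((- n) * (- n - 1)) div 2 + n * (- n) = - (n * (n - 1) div 2)"
      using tri_int_add[of n "- n"] by simp
    then have e: "t powi ((- n) * (- n - 1) div 2) * t powi (n * (- n)) = inverse (t powi (n * (n - 1) div 2))"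
      using t by (simp add: power_int_add[symmetric] power_int_minus[symmetric])
    have "t powi ((- n) * (- n - 1) div 2) * z powi (- n) = t powi ((- n) * (- n - 1) div 2) * t powi (n * (- n)) * y powi (- n)"
      unfolding z_def power_int_mult_distrib power_int_mult by (simp only: mult_ac)
    also have "\<dots> = 1 / T"
      unfolding e T_def by (simp add: power_int_minus divide_inverse)
    finally have tm: "t powi ((- n) * (- n - 1) div 2) * z powi (- n) = 1 / T" .
    have "(\<Sum>m\<in>{- n}. t powi (m * (m - 1) div 2) * z powi m) \<le> qtheta t z"
      unfolding qtheta_def
    proof (rule finite_sum_le_infsum)
      have "(\<lambda>m. norm (t powi (m * (m - 1) div 2) * z powi m)) summable_on UNIV"
        by (rule theta_abs_summable) (use t z0 in auto)
      then show "(\<lambda>m. t powi (m * (m - 1) div 2) * z powi m) summable_on UNIV"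
        by (rule abs_summable_summable)
    qed (use t z0 in auto)
    then have th: "1 / T \<le> qtheta t z" using tm by simp
    have "y powi n \<le> D ^ nat \<bar>n\<bar>" using powi_norm_le[of y D n] y y0 D by simp
    then have "B ^ nat \<bar>n\<bar> * T \<le> B ^ nat \<bar>n\<bar> * (t powi (n * (n - 1) div 2) * D ^ nat \<bar>n\<bar>)"
      unfolding T_def using t B by (intro mult_left_mono) auto
    also have "\<dots> \<le> C" using C(2)[of n] t by (simp add: power_mult_distrib mult_ac)
    finally have "B ^ nat \<bar>n\<bar> \<le> C * (1 / T)" using T0 by (simp add: field_simps)
    also have "\<dots> \<le> C * qtheta t z" using th C(1) by (intro mult_left_mono) auto
    also have "\<dots> < (C + 1) * qtheta t z"
    proof -
      have "0 < 1 / T" using T0 by simp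
      then have "0 < qtheta t z" using th by linarith
      then show ?thesis by (simp add: distrib_right)
    qed
    finally show "B ^ nat \<bar>n\<bar> < (C + 1) * qtheta t (y * t powi n)" by (simp add: z_def)
  qed (use C in auto)
qed

section \<open>The continuation to the punctured plane and its growth\<close>

context qhyp_params
begin

definition dual_series :: "nat \<Rightarrow> complex \<Rightarrow> complex" where
  "dual_series j z = (\<Sum>\<^sub>\<infinity>m. v j m / z ^ m)"

text \<open>At a power of q the division by 0 returns 0, so the value there is meaningless, even
  inside the unit disc where the singularity is removable. All statements therefore exclude these
  points.\<close>

definition continuation :: "complex \<Rightarrow> complex" where
  "continuation z = (\<Sum>j<r. A j * (theta_prod q (a j * z) / theta_prod q z) * dual_series j z)"

lemma dual_series_abs_summable:
  assumes "j < r"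
  shows "(\<lambda>m. norm (v j m / z ^ m)) summable_on UNIV"
proof -
  have "norm (v j m / z ^ m) = cmod (v j m) * (1 / cmod z) ^ m" for m
    by (simp add: norm_divide norm_power power_divide)
  then show ?thesis using residue_coeff_summable[OF assms, of "1 / cmod z"] by simp
qed

lemma dual_series_holomorphic:
  assumes j: "j < r"
  shows "dual_series j holomorphic_on - {0}"
proof -
  have "(\<lambda>z. \<Sum>m. v j m * z ^ m) \<circ> inverse holomorphic_on - {0}"
  proof (rule holomorphic_on_compose_gen[OF _ entire_power_series_holomorphic[of _ UNIV]])
    show "summable (\<lambda>m. v j m * x ^ m)" if "x \<noteq> 0" for x
      using infsum_nat_eq_suminf(2)[OF dual_series_abs_summable[OF j, of "inverse x"]]
      by (simp add: power_inverse divide_inverse)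
  qed (auto intro!: holomorphic_intros)
  then show ?thesis
  proof (rule holomorphic_transform)
    fix z
    show "((\<lambda>z. \<Sum>m. v j m * z ^ m) \<circ> inverse) z = dual_series j z"
      unfolding dual_series_def infsum_nat_eq_suminf(1)[OF dual_series_abs_summable[OF j]]
      by (simp add: divide_inverse power_inverse)
  qed
qed

lemma continuation_holomorphic: "continuation holomorphic_on {z. z \<noteq> 0 \<and> theta_prod q z \<noteq> 0}"
proof -
  have th: "(\<lambda>z. theta_prod q (c * z)) holomorphic_on {z. z \<noteq> 0 \<and> theta_prod q z \<noteq> 0}" if "c \<noteq> 0" for c
  proof -
    have "theta_prod q \<circ> (\<lambda>z. c * z) holomorphic_on {z. z \<noteq> 0 \<and> theta_prod q z \<noteq> 0}"
      by (rule holomorphic_on_compose_gen[OF _ theta_prod_holomorphic[OF q_lt_1]])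
         (use that in \<open>auto intro!: holomorphic_intros\<close>)
    then show ?thesis by (simp add: o_def)
  qed
  show ?thesis
    unfolding continuation_def[abs_def]
    by (intro holomorphic_intros th holomorphic_on_subset[OF dual_series_holomorphic]
          holomorphic_on_subset[OF theta_prod_holomorphic[OF q_lt_1]]) (use a_nz in auto)
qed

lemma phi_conv_radius: "1 \<le> fps_conv_radius (Abs_fps u)"
  unfolding fps_conv_radius_def
proof (rule conv_radius_geI_ex)
  fix \<rho> :: real assume "0 < \<rho>" "ereal \<rho> < 1"
  then have "cmod (of_real \<rho>) < 1" by simp
  from infsum_nat_eq_suminf(2)[OF phi_series_summable[OF this]]
  show "\<exists>z. cmod z = \<rho> \<and> summable (\<lambda>n. fps_nth (Abs_fps u) n * z ^ n)"
    using \<open>0 < \<rho>\<close> by (intro exI[of _ "of_real \<rho>"]) simp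
qed

lemma phi_holomorphic: "eval_fps (Abs_fps u) holomorphic_on ball 0 1"
  by (rule holomorphic_on_eval_fps, rule ball_eball_mono) (use phi_conv_radius in \<open>simp add: one_ereal_def\<close>)

text \<open>The identity theorem carries the equality from the annulus over the punctured disc
  without the powers of q. Besides justifying the name, it controls the continuation near 0, where
  bounds on the series in 1/z are useless.\<close>

theorem continuation_eq_phi:
  assumes z: "z \<noteq> 0" "cmod z < 1" "theta_prod q z \<noteq> 0"
  shows "continuation z = eval_fps (Abs_fps u) z"
proof (rule analytic_continuation_open[where f = continuation and g = "eval_fps (Abs_fps u)" and s = "{z. cmod q < cmod z \<and> cmod z < 1}" and s' = "ball 0 1 \<inter> {z. z \<noteq> 0 \<and> theta_prod q z \<noteq> 0}"])
  let ?S = "{z. z \<noteq> 0 \<and> theta_prod q z \<noteq> 0}"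
  let ?T = "{z. cmod q < cmod z \<and> cmod z < 1}"
  have "?T = - cball 0 (cmod q) \<inter> ball 0 1" by (auto simp: not_le)
  then show "open ?T" by (simp add: open_Int open_Compl)
  show "open (ball 0 1 \<inter> ?S)" using open_theta_prod_nonzero[OF q_nz q_lt_1] by blast
  obtain x where "cmod q < x" "x < 1" using dense[OF q_lt_1] by blast
  then have "of_real x \<in> ?T" using norm_ge_zero[of q] by (simp del: norm_ge_zero)
  then show "?T \<noteq> {}" by blast
  have "ball 0 1 \<inter> ?S = ball 0 1 - {z. z = 0 \<or> theta_prod q z = 0}" by auto
  then show "connected (ball 0 1 \<inter> ?S)"
    using connected_open_diff_countable[of "ball 0 1" "{z. z = 0 \<or> theta_prod q z = 0}"]
      countable_theta_prod_zeros[OF q_nz q_lt_1] by simp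
  show "?T \<subseteq> ball 0 1 \<inter> ?S"
  proof
    fix w assume "w \<in> ?T"
    then have w: "cmod q < cmod w" "cmod w < 1" by auto
    then have "w \<noteq> 0" by auto
    with w show "w \<in> ball 0 1 \<inter> ?S"
      using theta_prod_eq_0_iff[OF q_nz q_lt_1] annulus_not_power[OF q_nz w] by auto
  qed
  show "continuation holomorphic_on ball 0 1 \<inter> ?S"
    by (rule holomorphic_on_subset[OF continuation_holomorphic]) auto
  show "eval_fps (Abs_fps u) holomorphic_on ball 0 1 \<inter> ?S"
    by (rule holomorphic_on_subset[OF phi_holomorphic]) auto
  show "continuation w = eval_fps (Abs_fps u) w" if "w \<in> ?T" for w
  proof -
    have w: "cmod q < cmod w" "cmod w < 1" using that by auto
    have "eval_fps (Abs_fps u) w = (\<Sum>\<^sub>\<infinity>n. u n * w ^ n)"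
      unfolding infsum_nat_eq_suminf(1)[OF phi_series_summable[OF w(2)]] by (simp add: eval_fps_def)
    then show ?thesis
      unfolding connection_annulus[OF w] continuation_def dual_series_def ..
  qed
  show "z \<in> ball 0 1 \<inter> ?S" using z by simp
qed

text \<open>Two regimes. For large n the point lies in a small disc, where the function is the
  bounded power series. For the other n it stays away from 0, the series in 1/z are uniformly
  bounded, and growth comes only from the factors a_j^(-n) of the theta quotients.\<close>

lemma continuation_growth:
  assumes K: "compact K" "K \<subseteq> {z. z \<noteq> 0 \<and> theta_prod q z \<noteq> 0}"
  obtains C B where "0 \<le> C" "1 \<le> B" "\<And>x n. x \<in> K \<Longrightarrow> cmod (continuation (x * q powi n)) \<le> C * B ^ nat \<bar>n\<bar>"
proof -
  have "bounded K" using K(1) by (rule compact_imp_bounded)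
  then obtain M where M: "M > 0" "\<And>x. x \<in> K \<Longrightarrow> cmod x \<le> M" by (auto simp: bounded_pos)
  obtain d where d: "d > 0" "\<And>x. x \<in> K \<Longrightarrow> d \<le> cmod x"
  proof -
    have "closed K" "0 \<notin> K" using K compact_imp_closed by auto
    from separate_point_closed[OF this] show ?thesis using that by auto
  qed
  have "(\<lambda>n. M * cmod q ^ n) \<longlonglongrightarrow> M * 0"
    by (intro tendsto_intros) (use q_lt_1 in auto)
  then have "\<forall>\<^sub>F n in sequentially. M * cmod q ^ n < 1 / 2"
    by (rule order_tendstoD) simp
  then obtain n0 where n0: "M * cmod q ^ n0 < 1 / 2" by (auto simp: eventually_sequentially)
  have "compact (eval_fps (Abs_fps u) ` cball 0 (1/2))"
    by (intro compact_continuous_image holomorphic_on_imp_continuous_on holomorphic_on_subset[OF phi_holomorphic]) auto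
  then obtain C1 where C1: "C1 > 0" "\<And>z. cmod z \<le> 1 / 2 \<Longrightarrow> cmod (eval_fps (Abs_fps u) z) \<le> C1"
    by (auto dest!: compact_imp_bounded simp: bounded_pos)
  \<comment> \<open>An upper bound for 1/|x q^n| over all x in \<open>K\<close> and n < n0.\<close>
  define D where "D = 1 / (d * cmod q ^ n0)"
  have D0: "0 < D" using d q_nz by (simp add: D_def)
  define S where "S j = (\<Sum>\<^sub>\<infinity>m. cmod (v j m) * D ^ m)" for j
  have S0: "0 \<le> S j" for j unfolding S_def using D0 by (intro infsum_nonneg) auto
  have "\<exists>E. \<forall>x\<in>K. cmod (theta_prod q (a j * x) / theta_prod q x) \<le> E" if j: "j < r" for j
  proof -
    have "(\<lambda>x. a j * x) ` K \<subseteq> - {0}" using K a_nz[OF j] by auto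
    then have "theta_prod q \<circ> (\<lambda>x. a j * x) holomorphic_on K"
      by (intro holomorphic_on_compose_gen[OF _ theta_prod_holomorphic[OF q_lt_1]] holomorphic_intros)
    then have "(\<lambda>x. theta_prod q (a j * x)) holomorphic_on K" by (simp add: o_def)
    then have "(\<lambda>x. theta_prod q (a j * x) / theta_prod q x) holomorphic_on K"
      by (intro holomorphic_intros holomorphic_on_subset[OF theta_prod_holomorphic[OF q_lt_1]]) (use K in auto)
    then have "compact ((\<lambda>x. theta_prod q (a j * x) / theta_prod q x) ` K)"
      by (intro compact_continuous_image holomorphic_on_imp_continuous_on K)
    then show ?thesis by (auto dest!: compact_imp_bounded simp: bounded_iff)
  qed
  then obtain E where E: "\<And>j x. j < r \<Longrightarrow> x \<in> K \<Longrightarrow> cmod (theta_prod q (a j * x) / theta_prod q x) \<le> E j"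
    by metis
  \<comment> \<open>Dominates each |a_j| and its reciprocal, since n takes both signs; the 1 ensures
    \<open>B\<close> >= 1.\<close>
  define B where "B = 1 + (\<Sum>j<r. cmod (a j) + 1 / cmod (a j))"
  have Bsum: "cmod (a j) + 1 / cmod (a j) \<le> (\<Sum>j<r. cmod (a j) + 1 / cmod (a j))" if "j < r" for j
    by (rule member_le_sum) (use that in auto)
  have B1: "1 \<le> B" unfolding B_def by (simp add: sum_nonneg)
  have ab: "cmod (a j powi (- n)) \<le> B ^ nat \<bar>n\<bar>" if j: "j < r" for j n
  proof -
    have "0 \<le> cmod (a j)" "0 \<le> 1 / cmod (a j)" by simp_all
    then have s: "cmod (a j) \<le> B" "1 / cmod (a j) \<le> B" using Bsum[OF j] unfolding B_def by linarith+
    have "1 / B \<le> cmod (a j)" using s(2) B1 a_nz[OF j] by (simp add: field_simps)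
    then show ?thesis using powi_norm_le[OF a_nz[OF j] s(1), of "- n"] B1 by simp
  qed
  define C where "C = C1 + (\<Sum>j<r. cmod (A j) * \<bar>E j\<bar> * S j)"
  have sum0: "0 \<le> (\<Sum>j<r. cmod (A j) * \<bar>E j\<bar> * S j)" by (intro sum_nonneg mult_nonneg_nonneg S0) auto
  show ?thesis
  proof (rule that[of C B])
    show "0 \<le> C" using C1 sum0 by (simp add: C_def)
    show "1 \<le> B" by (rule B1)
    fix x n assume x: "x \<in> K"
    have x0: "x \<noteq> 0" "theta_prod q x \<noteq> 0" using K x by auto
    have Bn: "1 \<le> B ^ nat \<bar>n\<bar>" using B1 by simp
    show "cmod (continuation (x * q powi n)) \<le> C * B ^ nat \<bar>n\<bar>"
    proof (cases "n \<ge> int n0")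
      case True
      then have m: "n = int (nat n)" "nat n \<ge> n0" by linarith+
      define m where "m = nat n"
      note m = m[folded m_def]
      have "cmod (x * q powi n) = cmod x * cmod q ^ m" using m by (simp add: norm_mult norm_power)
      also have "\<dots> \<le> M * cmod q ^ n0"
        using M x m q_lt_1 by (intro mult_mono power_decreasing) auto
      finally have sm: "cmod (x * q powi n) \<le> 1 / 2" using n0 by simp
      have "continuation (x * q powi n) = eval_fps (Abs_fps u) (x * q powi n)"
        by (rule continuation_eq_phi) (use sm x0 q_nz theta_prod_shift_eq_0_iff[OF q_nz q_lt_1 x0(1)] in auto)
      then have "cmod (continuation (x * q powi n)) \<le> C1" using C1(2)[OF sm] by simp
      also have "\<dots> \<le> C * 1" using sum0 by (simp add: C_def)
      also have "\<dots> \<le> C * B ^ nat \<bar>n\<bar>" using Bn C1 sum0 by (intro mult_left_mono) (auto simp: C_def)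
      finally show ?thesis .
    next
      case False
      have "cmod q ^ n0 = cmod q powi (int n0)" by simp
      also have "\<dots> \<le> cmod q powi n"
        using False q_nz q_lt_1 by (intro power_int_decreasing) auto
      finally have qn: "cmod q ^ n0 \<le> cmod q powi n" .
      have low: "d * cmod q ^ n0 \<le> cmod (x * q powi n)"
        unfolding norm_mult norm_power_int using d x qn by (intro mult_mono) auto
      have ds: "cmod (dual_series j (x * q powi n)) \<le> S j" if j: "j < r" for j
        unfolding dual_series_def S_def
      proof (rule norm_infsum_le[OF has_sum_infsum has_sum_infsum])
        show "(\<lambda>m. v j m / (x * q powi n) ^ m) summable_on UNIV"
          by (rule abs_summable_summable[OF dual_series_abs_summable[OF j]])
        show "(\<lambda>m. cmod (v j m) * D ^ m) summable_on UNIV"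
          by (rule residue_coeff_summable[OF j]) (use D0 in auto)
        fix m
        have "1 / cmod (x * q powi n) \<le> D"
          unfolding D_def using low d q_nz by (intro divide_left_mono) (auto intro!: mult_pos_pos simp: x0)
        then have "(1 / cmod (x * q powi n)) ^ m \<le> D ^ m" by (intro power_mono) auto
        then have "cmod (v j m) * (1 / cmod (x * q powi n)) ^ m \<le> cmod (v j m) * D ^ m"
          by (rule mult_left_mono) auto
        then show "norm (v j m / (x * q powi n) ^ m) \<le> cmod (v j m) * D ^ m"
          by (simp add: norm_divide norm_power power_divide)
      qed
      have "cmod (continuation (x * q powi n)) \<le> (\<Sum>j<r. cmod (A j * (theta_prod q (a j * (x * q powi n)) / theta_prod q (x * q powi n)) * dual_series j (x * q powi n)))"
        unfolding continuation_def by (rule norm_sum)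
      also have "\<dots> \<le> (\<Sum>j<r. cmod (A j) * (B ^ nat \<bar>n\<bar> * \<bar>E j\<bar>) * S j)"
      proof (rule sum_mono)
        fix j assume "j \<in> {..<r}"
        then have j: "j < r" by simp
        have "cmod (theta_prod q (a j * x) / theta_prod q x) \<le> \<bar>E j\<bar>"
          using E[OF j x] by linarith
        then show "cmod (A j * (theta_prod q (a j * (x * q powi n)) / theta_prod q (x * q powi n)) * dual_series j (x * q powi n))
           \<le> cmod (A j) * (B ^ nat \<bar>n\<bar> * \<bar>E j\<bar>) * S j"
          unfolding theta_prod_ratio_shift[OF q_nz q_lt_1 a_nz[OF j] x0(1)]
          unfolding norm_mult
          using B1 by (intro mult_mono ab ds j) (auto intro!: mult_nonneg_nonneg)
      qed
      also have "\<dots> = (\<Sum>j<r. cmod (A j) * \<bar>E j\<bar> * S j) * B ^ nat \<bar>n\<bar>"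
        unfolding sum_distrib_right by (intro sum.cong) (simp_all add: mult_ac)
      also have "\<dots> \<le> C * B ^ nat \<bar>n\<bar>"
        using C1 B1 by (intro mult_right_mono) (auto simp: C_def)
      finally show ?thesis .
    qed
  qed
qed

end

section \<open>Continuation along the spiral\<close>

text \<open>Membership in \<open>H_space\<close> asks for one connected domain around the whole
  spiral, so separate discs do not suffice. A path from lam to \<open>lam * p\<close> inside S is
  thickened and moved by all powers of p. The compact set \<open>K\<close> represents the result up
  to these powers, so growth has to be bounded only along orbits starting in
  \<open>K\<close>.\<close>

lemma spiral_neighbourhood:
  fixes lam p :: complex
  assumes p: "p \<noteq> 0" and lam: "lam \<noteq> 0" and S: "open S" "path_connected S" "0 \<notin> S" "lam \<in> S"
    and inv: "\<And>x n. x \<in> S \<Longrightarrow> x * p powi n \<in> S"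
  obtains \<Omega> K \<epsilon> where "open \<Omega>" "connected \<Omega>" "compact K" "K \<subseteq> S" "\<epsilon> > 0"
    "\<And>m. ball (lam * p powi m) (\<epsilon> * cmod (p powi m * lam)) \<subseteq> \<Omega>"
    "\<And>x. x \<in> \<Omega> \<Longrightarrow> \<exists>y\<in>K. \<exists>n. x = y * p powi n"
proof -
  have "lam * p \<in> S" using inv[OF S(4), of 1] by simp
  with S obtain \<gamma> where \<gamma>: "path \<gamma>" "path_image \<gamma> \<subseteq> S" "pathstart \<gamma> = lam" "pathfinish \<gamma> = lam * p"
    unfolding path_connected_def by metis
  define C where "C = path_image \<gamma>"
  have C: "compact C" "connected C" "C \<subseteq> S" "lam \<in> C" "lam * p \<in> C"
    using \<gamma> pathstart_in_path_image[of \<gamma>] pathfinish_in_path_image[of \<gamma>]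
    by (auto simp: C_def compact_path_image connected_path_image)
  obtain e where e: "e > 0" "(\<Union>x\<in>C. cball x e) \<subseteq> S"
    using compact_subset_open_imp_cball_epsilon_subset[OF C(1) S(1) C(3)] by blast
  obtain M where M: "M > 0" "\<And>x. x \<in> C \<Longrightarrow> cmod x \<le> M"
    using compact_imp_bounded[OF C(1)] by (auto simp: bounded_pos)
  \<comment> \<open>Relative radius \<open>e / M\<close> means absolute radius at most
    \<open>e\<close> at every point of the path.\<close>
  define \<epsilon> where "\<epsilon> = e / M"
  have \<epsilon>: "\<epsilon> > 0" using e M by (simp add: \<epsilon>_def)
  have \<epsilon>e: "\<epsilon> * cmod y \<le> e" if "y \<in> C" for y
    using M(2)[OF that] M(1) e(1) by (simp add: \<epsilon>_def divide_le_eq)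
  \<comment> \<open>Large enough to contain, after division by p^n, the part of the domain that
    comes from the n-th copy of the path; compact as a sum of two compact sets.\<close>
  define K where "K = (\<Union>x\<in>C. cball x e)"
  have K: "compact K"
  proof -
    have "K = {x + y | x y. x \<in> C \<and> y \<in> cball (0 :: complex) e}"
    proof safe
      fix z assume "z \<in> K"
      then obtain x where "x \<in> C" "dist x z \<le> e" by (auto simp: K_def)
      then show "\<exists>x y. z = x + y \<and> x \<in> C \<and> y \<in> cball (0 :: complex) e"
        by (intro exI[of _ x] exI[of _ "z - x"]) (auto simp: dist_norm norm_minus_commute)
    next
      fix x y :: complex assume "x \<in> C" "y \<in> cball 0 e"
      then show "x + y \<in> K" by (auto simp: K_def dist_norm intro!: bexI[of _ x])
    qed
    then show ?thesis using compact_sums[OF C(1) compact_cball[of 0 e]] by simp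
  qed
  \<comment> \<open>Consecutive copies of the path share the point lam p^(n+1), which links the
    whole union.\<close>
  define \<Omega> where "\<Omega> = (\<Union>n::int. \<Union>y\<in>C. ball (y * p powi n) (\<epsilon> * cmod (y * p powi n)))"
  have C0: "y \<noteq> 0" if "y \<in> C" for y using that C(3) S(3) by auto
  have inO: "y * p powi n \<in> \<Omega>" if "y \<in> C" for y n
    unfolding \<Omega>_def using that \<epsilon> C0[OF that] p by (intro UN_I[of n] UN_I[of y]) auto
  have T: "connected_component \<Omega> (x * p powi n) (y * p powi n)" if "x \<in> C" "y \<in> C" for x y n
  proof -
    have "connected ((\<lambda>y. y * p powi n) ` C)"
      by (intro connected_continuous_image C continuous_intros)
    then show ?thesis unfolding connected_component_def using that inO by blast
  qed
  have step: "connected_component \<Omega> (lam * p powi n) (lam * p powi (n + 1))" for n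
    using T[OF C(4) C(5), of n] p by (simp add: power_int_add mult_ac)
  have base: "connected_component \<Omega> (lam * p powi 0) (lam * p powi n)" for n
  proof (induction n rule: int_induct[where k = 0])
    case base
    show ?case using inO[OF C(4), of 0] by simp
  next
    case (step1 i)
    show ?case by (rule connected_component_trans[OF step1(2) step])
  next
    case (step2 i)
    have "connected_component \<Omega> (lam * p powi i) (lam * p powi (i - 1))"
      using connected_component_sym[OF step[of "i - 1"]] by simp
    then show ?case by (rule connected_component_trans[OF step2(2)])
  qed
  have all: "connected_component \<Omega> lam x" if "x \<in> \<Omega>" for x
  proof -
    obtain n y where y: "y \<in> C" "x \<in> ball (y * p powi n) (\<epsilon> * cmod (y * p powi n))"
      using \<open>x \<in> \<Omega>\<close> unfolding \<Omega>_def by blast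
    have "ball (y * p powi n) (\<epsilon> * cmod (y * p powi n)) \<subseteq> \<Omega>" using y(1) by (auto simp: \<Omega>_def)
    moreover have "y * p powi n \<in> ball (y * p powi n) (\<epsilon> * cmod (y * p powi n))"
      using \<epsilon> C0[OF y(1)] p by simp
    ultimately have "connected_component \<Omega> (y * p powi n) x"
      unfolding connected_component_def using y(2) connected_ball by blast
    then show ?thesis using base[of n] T[OF C(4) y(1), of n] connected_component_trans by (metis mult_1_right power_int_0_right)
  qed
  show ?thesis
  proof (rule that[of \<Omega> K \<epsilon>])
    show "open \<Omega>" unfolding \<Omega>_def by blast
    show "connected \<Omega>"
      unfolding connected_iff_connected_component using all connected_component_sym connected_component_trans by metis
    show "compact K" by (rule K)
    show "K \<subseteq> S" unfolding K_def by (rule e(2))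
    show "\<epsilon> > 0" by (rule \<epsilon>)
    show "ball (lam * p powi m) (\<epsilon> * cmod (p powi m * lam)) \<subseteq> \<Omega>" for m
      using C(4) by (auto simp: \<Omega>_def mult.commute[of "p powi m"])
    fix x assume "x \<in> \<Omega>"
    then obtain n y where yb: "y \<in> C" "x \<in> ball (y * p powi n) (\<epsilon> * cmod (y * p powi n))"
      unfolding \<Omega>_def by blast
    then have y: "y \<in> C" "dist (y * p powi n) x < \<epsilon> * cmod (y * p powi n)" by auto
    have "cmod (y - x / p powi n) * cmod (p powi n) = cmod (y * p powi n - x)"
      using p by (simp add: norm_mult[symmetric] left_diff_distrib)
    also have "\<dots> < \<epsilon> * cmod y * cmod (p powi n)" using y(2) by (simp add: dist_norm norm_mult)
    finally have "cmod (y - x / p powi n) < \<epsilon> * cmod y" using p by simp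
    then have "x / p powi n \<in> K" unfolding K_def using \<epsilon>e[OF y(1)] y(1)
      by (intro UN_I[of y]) (auto simp: dist_norm)
    then show "\<exists>y\<in>K. \<exists>n. x = y * p powi n"
      using p by (intro bexI[of _ "x / p powi n"] exI[of _ n]) auto
  qed
qed

locale qhyp_spiral = qhyp_params +
  fixes lam :: complex
  assumes lam_nz: "lam \<noteq> 0" and lam_notin: "lam \<notin> qspiral ((- 1) ^ (r - s - 1)) q"
begin

definition p :: complex where "p = q ^ k"
definition \<sigma> :: complex where "\<sigma> = (- 1) ^ k"

definition borel_fun :: "complex \<Rightarrow> complex" where
  "borel_fun x = eval_fps (Abs_fps u) (\<sigma> * x)"

definition G :: "complex \<Rightarrow> complex" where
  "G x = continuation (\<sigma> * x)"

definition regular :: "complex set" where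
  "regular = {x. x \<noteq> 0 \<and> theta_prod q (\<sigma> * x) \<noteq> 0}"

lemma sigma_square [simp]: "\<sigma> * \<sigma> = 1"
  by (simp add: \<sigma>_def power_mult_distrib[symmetric])

lemma sigma_nz [simp]: "\<sigma> \<noteq> 0"
  by (simp add: \<sigma>_def)

lemma norm_sigma [simp]: "cmod \<sigma> = 1"
  by (simp add: \<sigma>_def norm_power)

lemma p_nz: "p \<noteq> 0"
  using q_nz by (simp add: p_def)

lemma p_lt_1: "cmod p < 1"
  unfolding p_def norm_power using k_pos q_lt_1 by (simp add: power_less_one_iff)

lemma p_powi: "p powi n = q powi (int k * n)"
  unfolding p_def power_int_mult power_int_of_nat ..


lemma countable_not_regular: "countable (- regular)"
proof -
  have "- regular \<subseteq> (\<lambda>x. \<sigma> * x) ` {z. z = 0 \<or> theta_prod q z = 0}"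
  proof
    fix x assume "x \<in> - regular"
    then show "x \<in> (\<lambda>x. \<sigma> * x) ` {z. z = 0 \<or> theta_prod q z = 0}"
      by (intro image_eqI[of _ _ "\<sigma> * x"]) (auto simp: regular_def mult.assoc[symmetric])
  qed
  then show ?thesis
    by (rule countable_subset) (intro countable_image countable_theta_prod_zeros q_nz q_lt_1)
qed

lemma open_regular: "open regular"
proof -
  have "open ((\<lambda>x. \<sigma> * x) -` {z. z \<noteq> 0 \<and> theta_prod q z \<noteq> 0})"
    by (rule open_vimage[OF open_theta_prod_nonzero[OF q_nz q_lt_1]]) (intro continuous_intros)
  moreover have "(\<lambda>x. \<sigma> * x) -` {z. z \<noteq> 0 \<and> theta_prod q z \<noteq> 0} = regular"
    by (auto simp: regular_def)
  ultimately show ?thesis by simp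
qed

lemma path_connected_regular: "path_connected regular"
proof -
  have "path_connected (UNIV - - regular)"
    by (rule path_connected_open_diff_countable) (use countable_not_regular in auto)
  then show ?thesis by (simp add: Compl_eq_Diff_UNIV[symmetric])
qed

lemma lam_regular: "lam \<in> regular"
proof -
  have "\<sigma> * lam \<noteq> q powi n" for n
  proof
    assume "\<sigma> * lam = q powi n"
    then have "\<sigma> * (\<sigma> * lam) = \<sigma> * q powi n" by simp
    then have "lam = \<sigma> * q powi n" by (simp only: mult.assoc[symmetric] sigma_square) simp
    then show False using lam_notin by (auto simp: qspiral_def \<sigma>_def)
  qed
  then show ?thesis
    using theta_prod_eq_0_iff[OF q_nz q_lt_1, of "\<sigma> * lam"] lam_nz by (auto simp: regular_def)
qed

lemma regular_shift: "x \<in> regular \<Longrightarrow> x * p powi n \<in> regular"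
  unfolding p_powi regular_def
  using theta_prod_shift_eq_0_iff[OF q_nz q_lt_1, of "\<sigma> * x"] q_nz by (auto simp: mult.assoc)

lemma G_holomorphic: "G holomorphic_on regular"
proof -
  have "continuation \<circ> (\<lambda>x. \<sigma> * x) holomorphic_on regular"
    by (rule holomorphic_on_compose_gen[OF _ continuation_holomorphic])
       (auto simp: regular_def intro!: holomorphic_intros)
  then show ?thesis by (simp add: o_def G_def[abs_def])
qed

lemma G_eq_borel_fun: "x \<in> regular \<Longrightarrow> cmod x < 1 \<Longrightarrow> G x = borel_fun x"
  unfolding G_def borel_fun_def
  by (rule continuation_eq_phi) (auto simp: regular_def norm_mult)

lemma borel_fun_analytic: "borel_fun analytic_on ball 0 1"
proof -
  have "eval_fps (Abs_fps u) \<circ> (\<lambda>x. \<sigma> * x) holomorphic_on ball 0 1"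
    by (rule holomorphic_on_compose_gen[OF _ phi_holomorphic]) (auto simp: norm_mult intro!: holomorphic_intros)
  then show ?thesis by (simp add: o_def borel_fun_def[abs_def] analytic_on_open)
qed

lemma G_growth:
  assumes "compact K" "K \<subseteq> regular"
  obtains C B where "0 \<le> C" "1 \<le> B" "\<And>x n. x \<in> K \<Longrightarrow> cmod (G (x * p powi n)) \<le> C * B ^ nat \<bar>n\<bar>"
proof -
  have "compact ((\<lambda>x. \<sigma> * x) ` K)" by (intro compact_continuous_image assms continuous_intros)
  moreover have "(\<lambda>x. \<sigma> * x) ` K \<subseteq> {z. z \<noteq> 0 \<and> theta_prod q z \<noteq> 0}"
    using assms(2) by (auto simp: regular_def)
  ultimately obtain C B where CB: "0 \<le> C" "1 \<le> B"
    "\<And>x n. x \<in> (\<lambda>x. \<sigma> * x) ` K \<Longrightarrow> cmod (continuation (x * q powi n)) \<le> C * B ^ nat \<bar>n\<bar>"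
    using continuation_growth by blast
  show ?thesis
  proof (rule that[of C "B ^ k"])
    show "1 \<le> B ^ k" using CB(2) by simp
    fix x n assume "x \<in> K"
    then have "cmod (continuation (\<sigma> * x * q powi (int k * n))) \<le> C * B ^ nat \<bar>int k * n\<bar>"
      by (intro CB(3)) auto
    moreover have "nat \<bar>int k * n\<bar> = k * nat \<bar>n\<bar>" by (simp add: abs_mult nat_mult_distrib)
    ultimately show "cmod (G (x * p powi n)) \<le> C * (B ^ k) ^ nat \<bar>n\<bar>"
      unfolding G_def p_powi by (simp only: power_mult mult.assoc)
  qed (rule CB(1))
qed

lemma spiral_continuation_G: "spiral_continuation p lam borel_fun G"
proof -
  have inv: "x * p powi n \<in> regular" if "x \<in> regular" for x n by (rule regular_shift[OF that])
  have "0 \<notin> regular" by (simp add: regular_def)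
  then obtain \<Omega> K \<epsilon> where \<Omega>: "open \<Omega>" "connected \<Omega>" "compact K" "K \<subseteq> regular" "\<epsilon> > 0"
    "\<And>m. ball (lam * p powi m) (\<epsilon> * cmod (p powi m * lam)) \<subseteq> \<Omega>"
    "\<And>x. x \<in> \<Omega> \<Longrightarrow> \<exists>y\<in>K. \<exists>n. x = y * p powi n"
    using spiral_neighbourhood[OF p_nz lam_nz open_regular path_connected_regular _ lam_regular inv] by metis
  have sub: "\<Omega> \<subseteq> regular" using \<Omega>(4,7) inv by blast
  obtain C B where CB: "0 \<le> C" "1 \<le> B" "\<And>x n. x \<in> K \<Longrightarrow> cmod (G (x * p powi n)) \<le> C * B ^ nat \<bar>n\<bar>"
    using G_growth[OF \<Omega>(3,4)] by blast
  \<comment> \<open>\<open>theta_dominates\<close> needs the moduli on \<open>K\<close> in an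
    interval from 1/D to D; compactness and the absence of 0 supply it.\<close>
  obtain D where D: "1 \<le> D" "\<And>y. y \<in> K \<Longrightarrow> 1 / D \<le> cmod y \<and> cmod y \<le> D"
  proof -
    obtain M where M: "M > 0" "\<And>x. x \<in> K \<Longrightarrow> cmod x \<le> M"
      using compact_imp_bounded[OF \<Omega>(3)] by (auto simp: bounded_pos)
    have "closed K" "0 \<notin> K" using \<Omega>(3,4) compact_imp_closed \<open>0 \<notin> regular\<close> by auto
    from separate_point_closed[OF this] obtain d where d: "d > 0" "\<And>x. x \<in> K \<Longrightarrow> d \<le> cmod x" by auto
    show ?thesis
    proof (rule that[of "1 + M + 1 / d"])
      show "1 \<le> 1 + M + 1 / d" using M d by simp
      fix y assume y: "y \<in> K"
      have "1 / d \<le> 1 + M + 1 / d" using M by simp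
      moreover have d0: "0 < 1 / d" using d by simp
      ultimately have bd: "1 / (1 + M + 1 / d) \<le> 1 / (1 / d)" by (intro divide_left_mono) (auto intro!: mult_pos_pos simp: add_pos_pos M d)
      show "1 / (1 + M + 1 / d) \<le> cmod y \<and> cmod y \<le> 1 + M + 1 / d"
      proof -
        have "1 / (1 / d) = d" by simp
        then show ?thesis
          using bd d(2)[OF y] M(2)[OF y] d0 by linarith
      qed
    qed
  qed
  obtain L where L: "L > 0" "\<And>y n. 1 / D \<le> y \<Longrightarrow> y \<le> D \<Longrightarrow> B ^ nat \<bar>n\<bar> < L * qtheta (cmod p) (y * cmod p powi n)"
    by (rule theta_dominates[of "cmod p" D B]) (use p_nz p_lt_1 D CB in auto)
  \<comment> \<open>The growth rate is already absorbed in \<open>L\<close>, so M = 1 serves as the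
    scale inside theta; \<open>C + 1\<close> keeps the inequality strict if \<open>C\<close> is
    0.\<close>
  have bound: "cmod (G x) < (C + 1) * L * qtheta (cmod p) (1 * cmod x)" if "x \<in> \<Omega>" for x
  proof -
    obtain y n where y: "y \<in> K" "x = y * p powi n" using \<Omega>(7)[OF \<open>x \<in> \<Omega>\<close>] by blast
    have l: "B ^ nat \<bar>n\<bar> < L * qtheta (cmod p) (cmod x)"
      using L(2)[of "cmod y" n] D(2)[OF y(1)] by (simp add: y(2) norm_mult norm_power_int)
    have "cmod (G x) \<le> C * B ^ nat \<bar>n\<bar>" using CB(3)[OF y(1)] y(2) by simp
    also have "\<dots> < (C + 1) * B ^ nat \<bar>n\<bar>" using CB(2) by (simp add: distrib_right)
    also have "\<dots> < (C + 1) * (L * qtheta (cmod p) (cmod x))" using l CB(1) by (intro mult_strict_left_mono) auto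
    finally show ?thesis by (simp add: mult.assoc)
  qed
  have spir: "{x. x \<noteq> 0 \<and> cmod (x - lam * p powi m) < \<epsilon> * cmod (p powi m * lam)} \<subseteq> \<Omega>" for m
    using \<Omega>(6)[of m] by (auto simp: dist_norm norm_minus_commute)
  have 1: "borel_fun analytic_on ball 0 1 - {0}"
    by (rule analytic_on_subset[OF borel_fun_analytic]) auto
  have 2: "(\<Union>m::int. {x. x \<noteq> 0 \<and> cmod (x - lam * p powi m) < \<epsilon> * cmod (p powi m * lam)}) \<subseteq> \<Omega>"
    using spir by blast
  have "G analytic_on regular" using G_holomorphic open_regular by (simp add: analytic_on_open)
  then have 3: "G analytic_on \<Omega>" by (rule analytic_on_subset[OF _ sub])
  have 4: "\<forall>x\<in>\<Omega> \<inter> (ball 0 1 - {0}). G x = borel_fun x"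
    using sub G_eq_borel_fun by auto
  have 5: "\<exists>L>0. \<exists>M>0. \<forall>x\<in>\<Omega> - {0}. cmod (G x) < L * qtheta (cmod p) (M * cmod x)"
    by (rule exI[of _ "(C + 1) * L"], intro conjI, simp add: CB(1) L(1) add_nonneg_pos, rule exI[of _ 1])
       (use bound in auto)
  show ?thesis
    unfolding spiral_continuation_def
    by (rule exI[of _ 1], intro conjI zero_less_one 1, rule exI[of _ \<epsilon>], intro conjI \<Omega>(5), rule exI[of _ \<Omega>])
       (intro conjI \<Omega> 2 3 4 5)
qed

text \<open>The Laplace transform uses whatever \<open>SOME\<close> selects. An admissible
  \<open>g\<close> lives on a domain of its own, but removing the countable singular set of
  \<open>G\<close> leaves that domain connected, and near 0 both functions coincide with
  \<open>borel_fun\<close>.\<close>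

lemma spiral_continuation_unique:
  assumes "spiral_continuation p lam borel_fun g"
  shows "g (lam * p powi n) = G (lam * p powi n)"
proof -
  obtain \<delta> \<epsilon> \<Omega> where \<delta>: "\<delta> > 0" and \<epsilon>: "\<epsilon> > 0" and \<Omega>: "open \<Omega>" "connected \<Omega>"
      "(\<Union>m::int. {x. x \<noteq> 0 \<and> cmod (x - lam * p powi m) < \<epsilon> * cmod (p powi m * lam)}) \<subseteq> \<Omega>"
    and g: "g analytic_on \<Omega>" "\<And>x. x \<in> \<Omega> \<inter> (ball 0 \<delta> - {0}) \<Longrightarrow> g x = borel_fun x"
    using assms unfolding spiral_continuation_def by blast
  have on_spiral: "lam * p powi m \<in> \<Omega> \<inter> regular" for m
  proof -
    have "lam * p powi m \<in> {x. x \<noteq> 0 \<and> cmod (x - lam * p powi m) < \<epsilon> * cmod (p powi m * lam)}"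
      using lam_nz p_nz \<epsilon> by simp
    then show ?thesis using \<Omega>(3) regular_shift[OF lam_regular] by blast
  qed
  \<comment> \<open>The spiral accumulates at 0, so the set on which both functions are known to
    agree is nonempty.\<close>
  have small: "0 < min \<delta> 1 / cmod lam" using \<delta> lam_nz by simp
  obtain m where "cmod p ^ m < min \<delta> 1 / cmod lam"
    using real_arch_pow_inv[OF small p_lt_1] by blast
  then have m: "cmod (lam * p powi (int m)) < min \<delta> 1"
    using lam_nz by (simp add: norm_mult norm_power field_simps)
  show ?thesis
  proof (rule analytic_continuation_open[where f = g and g = G and s = "\<Omega> \<inter> regular \<inter> ball 0 (min \<delta> 1)" and s' = "\<Omega> \<inter> regular"])
    show "open (\<Omega> \<inter> regular \<inter> ball 0 (min \<delta> 1))" "open (\<Omega> \<inter> regular)"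
      using \<Omega>(1) open_regular by auto
    show "\<Omega> \<inter> regular \<inter> ball 0 (min \<delta> 1) \<noteq> {}"
      using on_spiral[of "int m"] m by (auto simp del: power_int_of_nat)
    have "\<Omega> \<inter> regular = \<Omega> - (- regular)" by auto
    then show "connected (\<Omega> \<inter> regular)"
      using connected_open_diff_countable[OF _ \<Omega>(1,2) countable_not_regular] by simp
    show "g holomorphic_on \<Omega> \<inter> regular"
      using analytic_imp_holomorphic[OF g(1)] holomorphic_on_subset by blast
    show "G holomorphic_on \<Omega> \<inter> regular"
      using G_holomorphic holomorphic_on_subset by blast
    show "lam * p powi n \<in> \<Omega> \<inter> regular" by (rule on_spiral)
    show "g x = G x" if "x \<in> \<Omega> \<inter> regular \<inter> ball 0 (min \<delta> 1)" for x
    proof -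
      have "x \<noteq> 0" using that by (auto simp: regular_def)
      then show ?thesis using that g(2)[of x] G_eq_borel_fun[of x] by auto
    qed
  qed auto
qed

lemma continued_eq: "continued p lam borel_fun (lam * p powi n) = G (lam * p powi n)"
  unfolding continued_def
  by (rule spiral_continuation_unique) (rule someI[of _ G], rule spiral_continuation_G)

end

section \<open>The Laplace transform\<close>

context qhyp_params
begin

lemma dual_coeff_bounded:
  assumes "j < r"
  obtains K where "\<And>m. cmod (w j m) \<le> K"
proof -
  have nz: "qpoch_inf (a j * q / a i) q \<noteq> 0" if "i \<in> {..<r} - {j}" for i
    using ratio_reg(2)[of i j] that assms unfolding qpoch_inf_eq_0_iff[OF q_lt_1] by blast
  have "(\<lambda>m. w j m) \<longlonglongrightarrow> qpoch_inf (a j) q * (\<Prod>l<s. qpoch_inf (a j * q / b l) q)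
     / ((\<Prod>i\<in>{..<r} - {j}. qpoch_inf (a j * q / a i) q) * qpoch_inf q q)"
    unfolding dual_coeff_def
    by (intro tendsto_intros qpoch_tendsto q_lt_1)
       (use nz qpoch_inf_self_nonzero[OF q_lt_1] in \<open>simp add: prod_zero_iff\<close>)
  then have "Bseq (w j)" by (intro convergent_imp_Bseq convergentI)
  then show ?thesis by (elim BseqE) (use that in blast)
qed

lemma dual_coeff_series_summable:
  assumes "j < r" "cmod W < 1"
  shows "(\<lambda>m. norm (w j m * W ^ m)) summable_on UNIV"
proof -
  obtain K where K: "\<And>m. cmod (w j m) \<le> K" using dual_coeff_bounded[OF assms(1)] by blast
  have "(\<lambda>m. K * cmod W ^ m) summable_on UNIV"
    by (intro summable_on_cmult_right summable_on_nat_geometric) (use assms in auto)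
  then show ?thesis
    by (rule Infinite_Sum.abs_summable_on_comparison_test') (auto simp: norm_mult norm_power intro!: mult_right_mono K)
qed

end

context qhyp_spiral
begin

lemma G_spiral_bound:
  obtains C B where "1 \<le> B" "\<And>n. cmod (G (lam * p powi n)) \<le> C * B ^ nat \<bar>n\<bar>"
proof (rule G_growth[of "{lam}"])
  fix C B :: real
  assume "1 \<le> B" and *: "\<And>x n. x \<in> {lam} \<Longrightarrow> cmod (G (x * p powi n)) \<le> C * B ^ nat \<bar>n\<bar>"
  show thesis by (rule that[OF \<open>1 \<le> B\<close> *[OF singletonI]])
qed (use lam_regular in auto)

lemma plaplace_term_eq:
  assumes "x \<noteq> 0"
  shows "plaplace_term p lam borel_fun x n =
    G (lam * p powi n) * p powi (n * (n - 1) div 2) * (lam / x) powi n / qtheta p (lam / x)"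
proof -
  have "lam * p powi n / x = lam / x * p powi n" by simp
  then have "qtheta p (lam * p powi n / x) = qtheta p (lam / x) / (p powi (n * (n - 1) div 2) * (lam / x) powi n)"
    by (rule ssubst) (rule qtheta_shift; use p_nz lam_nz assms in simp)
  then show ?thesis
    unfolding plaplace_term_def continued_eq by (simp only: divide_divide_eq_right mult.assoc)
qed

lemma plaplace_numerator_eq:
  "plaplace_numerator p lam borel_fun x = (\<Sum>\<^sub>\<infinity>n::int. G (lam * p powi n) * p powi (n * (n - 1) div 2) * (lam / x) powi n)"
  unfolding plaplace_numerator_def continued_eq ..

lemma numerator_summable:
  assumes "x \<noteq> 0"
  shows "(\<lambda>n. norm (G (lam * p powi n) * p powi (n * (n - 1) div 2) * (lam / x) powi n)) summable_on UNIV"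
proof -
  obtain C B where CB: "1 \<le> B" "\<And>n. cmod (G (lam * p powi n)) \<le> C * B ^ nat \<bar>n\<bar>"
    using G_spiral_bound by blast
  show ?thesis
    by (rule gauss_series_abs_summable[OF _ _ _ _ CB(2)]) (use p_nz p_lt_1 lam_nz assms CB in auto)
qed

lemma plaplace_term_summable:
  assumes "x \<noteq> 0"
  shows "plaplace_term p lam borel_fun x summable_on UNIV"
proof -
  have "(\<lambda>n. G (lam * p powi n) * p powi (n * (n - 1) div 2) * (lam / x) powi n / qtheta p (lam / x)) summable_on UNIV"
    unfolding divide_inverse[of _ "qtheta p (lam / x)"]
    by (rule summable_on_cmult_left[OF abs_summable_summable[OF numerator_summable[OF assms]]])
  then show ?thesis unfolding plaplace_term_eq[OF assms, abs_def, symmetric] .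
qed

text \<open>Also correct on the pole spiral in the convention x / 0 = 0: every term and the quotient
  vanish there.\<close>

lemma plaplace_eq:
  assumes "x \<noteq> 0"
  shows "plaplace p lam borel_fun x = plaplace_numerator p lam borel_fun x / qtheta p (lam / x)"
  unfolding plaplace_def plaplace_term_eq[OF assms] plaplace_numerator_eq divide_inverse[of _ "qtheta p (lam / x)"]
  by (rule infsum_cmult_left')

lemma numerator_holomorphic: "plaplace_numerator p lam borel_fun holomorphic_on - {0}"
proof -
  obtain C B where CB: "1 \<le> B" "\<And>n. cmod (G (lam * p powi n)) \<le> C * B ^ nat \<bar>n\<bar>"
    using G_spiral_bound by blast
  have "(\<lambda>y. \<Sum>\<^sub>\<infinity>n::int. G (lam * p powi n) * p powi (n * (n - 1) div 2) * y powi n) holomorphic_on - {0}"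
    by (rule gauss_series_holomorphic[OF _ _ _ CB(2)]) (use p_nz p_lt_1 CB in auto)
  then have "(\<lambda>y. \<Sum>\<^sub>\<infinity>n::int. G (lam * p powi n) * p powi (n * (n - 1) div 2) * y powi n) \<circ> (\<lambda>x. lam / x) holomorphic_on - {0}"
    by (rule holomorphic_on_compose_gen[rotated]) (use lam_nz in \<open>auto intro!: holomorphic_intros\<close>)
  then show ?thesis by (simp add: o_def plaplace_numerator_eq[abs_def])
qed

lemma theta_denominator_holomorphic: "(\<lambda>x. qtheta p (lam / x)) holomorphic_on - {0}"
proof -
  have "qtheta p \<circ> (\<lambda>x. lam / x) holomorphic_on - {0}"
    by (rule holomorphic_on_compose_gen[OF _ qtheta_holomorphic[OF p_nz p_lt_1]])
       (use lam_nz in \<open>auto intro!: holomorphic_intros\<close>)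
  then show ?thesis by (simp add: o_def)
qed

lemma in_pole_spiral_iff:
  assumes "x \<noteq> 0"
  shows "x \<in> qspiral (- lam) p \<longleftrightarrow> qtheta p (lam / x) = 0"
proof -
  have *: "lam / x = - (p powi n) \<longleftrightarrow> x = - lam * p powi (- n)" for n
  proof -
    have P: "p powi n \<noteq> 0" using p_nz by simp
    have "lam / x = - (p powi n) \<longleftrightarrow> lam = - (p powi n * x)" using assms by (simp add: divide_eq_eq)
    also have "\<dots> \<longleftrightarrow> x = - lam * inverse (p powi n)"
    proof
      assume "lam = - (p powi n * x)"
      then show "x = - lam * inverse (p powi n)" using P by simp
    next
      assume "x = - lam * inverse (p powi n)"
      then show "lam = - (p powi n * x)" using P by simp
    qed
    finally show ?thesis by (simp only: power_int_minus)
  qed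
  have "qtheta p (lam / x) = 0 \<longleftrightarrow> (\<exists>n. x = - lam * p powi (- n))"
    using qtheta_eq_0_iff[OF p_nz p_lt_1, of "lam / x"] lam_nz assms unfolding * by simp
  also have "\<dots> \<longleftrightarrow> x \<in> qspiral (- lam) p"
    unfolding qspiral_def by (auto intro: exI[of _ "- _"])
  finally show ?thesis ..
qed

lemma zero_notin_pole_spiral: "0 \<notin> qspiral (- lam) p"
  using p_nz lam_nz by (auto simp: qspiral_def)

lemma plaplace_analytic: "plaplace p lam borel_fun analytic_on (UNIV - {0} - qspiral (- lam) p)"
proof -
  let ?T = "- {0} \<inter> (\<lambda>x. qtheta p (lam / x)) -` (- {0})"
  have T: "UNIV - {0} - qspiral (- lam) p = ?T" using in_pole_spiral_iff by auto
  have "open ?T"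
    by (rule continuous_open_preimage[OF holomorphic_on_imp_continuous_on[OF theta_denominator_holomorphic]]) auto
  moreover have "plaplace p lam borel_fun holomorphic_on ?T"
  proof (rule holomorphic_transform)
    show "(\<lambda>x. plaplace_numerator p lam borel_fun x / qtheta p (lam / x)) holomorphic_on ?T"
      by (intro holomorphic_intros holomorphic_on_subset[OF numerator_holomorphic]
          holomorphic_on_subset[OF theta_denominator_holomorphic]) auto
  qed (use plaplace_eq in auto)
  ultimately show ?thesis unfolding T by (simp add: analytic_on_open)
qed

text \<open>The denominator has a simple zero, so a pole occurs exactly when the numerator does not
  vanish. It can vanish: if some a_i is 1 the series is the constant 1, and the numerator is the
  theta function itself.\<close>

lemma plaplace_at_spiral:
  assumes x0: "x0 \<in> qspiral (- lam) p"
  shows "if plaplace_numerator p lam borel_fun x0 \<noteq> 0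
    then is_pole (plaplace p lam borel_fun) x0 \<and> zorder (plaplace p lam borel_fun) x0 = -1
    else \<exists>c. (plaplace p lam borel_fun \<longlongrightarrow> c) (at x0)"
proof -
  let ?N = "plaplace_numerator p lam borel_fun"
  have x0_nz: "x0 \<noteq> 0" using x0 zero_notin_pole_spiral by blast
  obtain n where n: "lam / x0 = - (p powi n)"
    using in_pole_spiral_iff[OF x0_nz] x0 qtheta_eq_0_iff[OF p_nz p_lt_1, of "lam / x0"] x0_nz lam_nz by auto
  obtain h where h: "h holomorphic_on - {0}" "h (- (p powi n)) \<noteq> 0"
    "\<And>y. y \<noteq> 0 \<Longrightarrow> qtheta p y = (y - (- (p powi n))) * h y"
    using qtheta_simple_zero[OF p_nz p_lt_1] by blast
  \<comment> \<open>The simple zero is known in the variable lam / x; the extra factor comes from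
    lam/x - lam/x0 = (x - x0) (-lam / (x x0)).\<close>
  define H where "H x = - lam / (x * x0) * h (lam / x)" for x
  have "h \<circ> (\<lambda>x. lam / x) holomorphic_on - {0}"
    by (rule holomorphic_on_compose_gen[OF _ h(1)]) (use lam_nz in \<open>auto intro!: holomorphic_intros\<close>)
  then have "(\<lambda>x. h (lam / x)) holomorphic_on - {0}" by (simp add: o_def)
  then have H: "H holomorphic_on - {0}"
    unfolding H_def by (intro holomorphic_intros) (use x0_nz in auto)
  have Hx0: "H x0 \<noteq> 0" using h(2) x0_nz lam_nz by (simp add: H_def n)
  have theta: "qtheta p (lam / x) = (x - x0) * H x" if "x \<noteq> 0" for x
  proof -
    have "qtheta p (lam / x) = (lam / x - lam / x0) * h (lam / x)"
      using h(3)[of "lam / x"] that lam_nz unfolding n by simp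
    also have "lam / x - lam / x0 = (x - x0) * (- lam / (x * x0))"
      using that x0_nz by (simp add: field_simps)
    finally show ?thesis by (simp add: H_def)
  qed
  define g where "g x = ?N x / H x" for x
  define T where "T = - {0} \<inter> H -` (- {0})"
  have T: "open T" "x0 \<in> T" unfolding T_def
    by (rule continuous_open_preimage[OF holomorphic_on_imp_continuous_on[OF H]]) (use Hx0 x0_nz in auto)
  have g: "g holomorphic_on T"
    unfolding g_def T_def
    by (intro holomorphic_intros holomorphic_on_subset[OF numerator_holomorphic] holomorphic_on_subset[OF H]) auto
  have f: "plaplace p lam borel_fun x = g x / (x - x0)" if "x \<in> T" for x
    using plaplace_eq[of x] theta[of x] that by (auto simp: T_def g_def)
  have ev: "\<forall>\<^sub>F x in at x0. g x / (x - x0) = plaplace p lam borel_fun x"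
    using eventually_at_in_open'[OF T] by eventually_elim (use f in auto)
  show ?thesis
  proof (cases "?N x0 = 0")
    case False
    then have gx0: "g x0 \<noteq> 0" using Hx0 by (simp add: g_def)
    have "is_pole (\<lambda>x. g x / (x - x0) ^ 1) x0"
      by (rule is_pole_basic[OF g T gx0]) simp
    then have "is_pole (plaplace p lam borel_fun) x0"
      using is_pole_cong[OF ev refl] by simp
    moreover have "zorder (plaplace p lam borel_fun) x0 = -1"
    proof (rule zorder_eqI[OF T g gx0])
      show "plaplace p lam borel_fun x = g x * (x - x0) powi - 1" if "x \<in> T" "x \<noteq> x0" for x
        using f[OF that(1)] by (simp add: divide_inverse)
    qed
    ultimately show ?thesis using False by simp
  next
    case True
    then have gx0: "g x0 = 0" by (simp add: g_def)
    \<comment> \<open>With \<open>g x0 = 0\<close>, the quotient g(x) / (x - x0) is the difference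
      quotient of \<open>g\<close>, so its limit is the derivative.\<close>
    have "(g has_field_derivative deriv g x0) (at x0)"
      by (rule holomorphic_derivI[OF g T])
    then have "((\<lambda>x. g x / (x - x0)) \<longlongrightarrow> deriv g x0) (at x0)"
      by (simp add: has_field_derivative_iff gx0)
    then have "(plaplace p lam borel_fun \<longlongrightarrow> deriv g x0) (at x0)"
      by (rule Lim_transform_eventually[OF _ ev])
    then show ?thesis using True by auto
  qed
qed

text \<open>The Gaussian factor p^(m(m+1)/2) of the m-th coefficient and the p^(-mn) from the power
  of 1/z turn p^(n(n-1)/2) into the Gaussian factor of n - m. Each m thus gives the same theta
  series with shifted index, and its coefficient is left without Gaussian factor.\<close>

lemma laplace_of_dual_series:
  assumes j: "j < r" and x: "x \<noteq> 0" and W: "W = q * (\<Prod>l<s. b l) / ((\<Prod>i<r. a i) * x)" "cmod W < 1"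
  shows "((\<lambda>n::int. a j powi (- (int k * n)) * dual_series j (\<sigma> * (lam * p powi n)) * p powi (n * (n - 1) div 2) * (lam / x) powi n)
    has_sum (\<Sum>\<^sub>\<infinity>m. w j m * W ^ m) * qtheta p (lam / (a j ^ k * x))) UNIV"
proof -
  \<comment> \<open>The theta quotients contribute a_j^(-kn), which is absorbed into the variable of
    theta_p.\<close>
  define y where "y = lam / (a j ^ k * x)"
  have aj: "a j \<noteq> 0" by (rule a_nz[OF j])
  have y0: "y \<noteq> 0" using lam_nz x aj by (simp add: y_def)
  define \<kappa> where "\<kappa> n = p powi (n * (n - 1) div 2) * y powi n" for n :: int
  have ks: "(\<lambda>n. norm (\<kappa> n)) summable_on UNIV"
    unfolding \<kappa>_def by (rule theta_abs_summable) (use p_nz p_lt_1 y0 in auto)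
  have cs: "(\<lambda>m. norm (w j m * W ^ m)) summable_on UNIV"
    by (rule dual_coeff_series_summable[OF j W(2)])
  have e: "a j powi (- (int k * n)) * dual_series j (\<sigma> * (lam * p powi n)) * p powi (n * (n - 1) div 2) * (lam / x) powi n
    = (\<Sum>\<^sub>\<infinity>m. w j m * W ^ m * \<kappa> (- int m + n))" for n
  proof -
    define T where "T = p powi (n * (n - 1) div 2)"
    have "(a j ^ k) powi n = a j powi (int k * n)" unfolding power_int_mult by simp
    then have yn: "a j powi (- (int k * n)) * (lam / x) powi n = y powi n"
      unfolding y_def using aj
      by (simp add: power_int_divide_distrib power_int_mult_distrib power_int_minus power_int_inverse divide_inverse mult_ac)
    have "a j powi (- (int k * n)) * dual_series j (\<sigma> * (lam * p powi n)) * T * (lam / x) powi n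
      = T * (a j powi (- (int k * n)) * (lam / x) powi n) * dual_series j (\<sigma> * (lam * p powi n))"
      by (simp only: mult_ac)
    also have "\<dots> = (\<Sum>\<^sub>\<infinity>m. T * y powi n * (v j m / (\<sigma> * (lam * p powi n)) ^ m))"
      unfolding yn dual_series_def by (rule infsum_cmult_right'[symmetric])
    also have "\<dots> = (\<Sum>\<^sub>\<infinity>m. w j m * W ^ m * \<kappa> (- int m + n))"
    proof (rule infsum_cong)
      fix m
      have tri: "(- int m + n) * (- int m + n - 1) div 2 = n * (n - 1) div 2 + (- int m) * (- int m - 1) div 2 - int m * n"
        using tri_int_add[of "- int m" n] by simp
      have k1: "\<kappa> (- int m + n) = T * p ^ (Suc m * m div 2) / (p powi n) ^ m * (y powi n / y ^ m)"
      proof -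
        have "p powi ((- int m + n) * (- int m + n - 1) div 2) = T * p ^ (Suc m * m div 2) / p powi (int m * n)"
          unfolding tri T_def using p_nz by (simp only: power_int_add power_int_diff tri_int_neg simp_thms)
        moreover have "p powi (int m * n) = (p powi n) ^ m"
          by (simp add: mult.commute[of "int m"] power_int_mult)
        moreover have "y powi (- int m + n) = y powi n / y ^ m"
          using y0 by (simp add: power_int_diff)
        ultimately show ?thesis by (simp add: \<kappa>_def)
      qed
      \<comment> \<open>The index shift costs y^(-m); the argument of Phi_j is therefore
        \<open>X j * y / (\<sigma> * lam)\<close>, in which the sign, a_j^k and lam all
        disappear.\<close>
      have XW: "X j / (\<sigma> * lam) = W / y"
      proof -
        have "X j = \<sigma> * q * (\<Prod>l<s. b l) * a j ^ k / (\<Prod>i<r. a i)" by (simp add: dual_arg_def \<sigma>_def)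
        then show ?thesis unfolding W(1) y_def using x lam_nz by simp
      qed
      have "v j m = w j m * X j ^ m * p ^ (Suc m * m div 2)"
        unfolding residue_coeff_def p_def power_mult[symmetric] by (simp only: mult.commute[of k])
      then have "v j m / (\<sigma> * (lam * p powi n)) ^ m = w j m * (X j / (\<sigma> * lam)) ^ m * p ^ (Suc m * m div 2) / (p powi n) ^ m"
        by (simp only: mult.assoc[symmetric, of \<sigma>] power_mult_distrib power_divide times_divide_eq_left times_divide_eq_right divide_divide_eq_left)
      also have "\<dots> = w j m * (W ^ m / y ^ m) * p ^ (Suc m * m div 2) / (p powi n) ^ m"
        unfolding XW power_divide ..
      finally show "T * y powi n * (v j m / (\<sigma> * (lam * p powi n)) ^ m) = w j m * W ^ m * \<kappa> (- int m + n)"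
        unfolding k1 by (simp add: mult_ac)
    qed
    finally show ?thesis by (simp only: T_def)
  qed
  show ?thesis
    unfolding e
    using shifted_double_sum[OF cs ks, of "\<lambda>m. - int m"] by (simp add: \<kappa>_def y_def qtheta_def)
qed

theorem plaplace_formula:
  assumes x: "x \<noteq> 0" and W: "W = q * (\<Prod>l<s. b l) / ((\<Prod>i<r. a i) * x)" "cmod W < 1"
  shows "plaplace p lam borel_fun x = (\<Sum>j<r. A j * (qtheta p (p * a j ^ k * x / lam) / qtheta p (p * x / lam))
     * (qtheta q (- \<sigma> * a j * lam) / qtheta q (- \<sigma> * lam)) * (\<Sum>\<^sub>\<infinity>m. w j m * W ^ m))"
proof -
  define \<rho> where "\<rho> j = theta_prod q (a j * (\<sigma> * lam)) / theta_prod q (\<sigma> * lam)" for j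
  have sl: "\<sigma> * lam \<noteq> 0" using lam_nz by simp
  have G: "G (lam * p powi n) = (\<Sum>j<r. A j * \<rho> j * (a j powi (- (int k * n)) * dual_series j (\<sigma> * (lam * p powi n))))" for n
    unfolding G_def continuation_def
  proof (rule sum.cong[OF refl])
    fix j assume "j \<in> {..<r}"
    then have "a j \<noteq> 0" using a_nz by simp
    then have "theta_prod q (a j * (\<sigma> * (lam * p powi n))) / theta_prod q (\<sigma> * (lam * p powi n)) = a j powi (- (int k * n)) * \<rho> j"
      using theta_prod_ratio_shift[OF q_nz q_lt_1 _ sl, of "a j" "int k * n"] by (simp add: p_powi \<rho>_def mult.assoc)
    then show "A j * (theta_prod q (a j * (\<sigma> * (lam * p powi n))) / theta_prod q (\<sigma> * (lam * p powi n))) * dual_series j (\<sigma> * (lam * p powi n))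
       = A j * \<rho> j * (a j powi (- (int k * n)) * dual_series j (\<sigma> * (lam * p powi n)))"
      by (simp only: mult_ac)
  qed
  have "((\<lambda>n. G (lam * p powi n) * p powi (n * (n - 1) div 2) * (lam / x) powi n) has_sum
     (\<Sum>j<r. A j * \<rho> j * ((\<Sum>\<^sub>\<infinity>m. w j m * W ^ m) * qtheta p (lam / (a j ^ k * x))))) UNIV"
  proof -
    have "G (lam * p powi n) * p powi (n * (n - 1) div 2) * (lam / x) powi n =
      (\<Sum>j<r. A j * \<rho> j * (a j powi (- (int k * n)) * dual_series j (\<sigma> * (lam * p powi n)) * p powi (n * (n - 1) div 2) * (lam / x) powi n))" for n
      unfolding G sum_distrib_right by (intro sum.cong refl) (simp only: mult.assoc)
    then show ?thesis
      using has_sum_sum_finite[OF _ has_sum_cmult_right[OF laplace_of_dual_series[OF _ x W]], of "{..<r}"] by simp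
  qed
  then have N: "plaplace_numerator p lam borel_fun x = (\<Sum>j<r. A j * \<rho> j * ((\<Sum>\<^sub>\<infinity>m. w j m * W ^ m) * qtheta p (lam / (a j ^ k * x))))"
    unfolding plaplace_numerator_eq by (rule infsumI)
  \<comment> \<open>The inversion x to p/x moves x into the numerator of the theta arguments, as in
    the displayed formula.\<close>
  have refl1: "qtheta p (lam / z) = qtheta p (p * z / lam)" for z
    using qtheta_reflect[OF p_nz, of "lam / z"] by simp
  \<comment> \<open>Passing from \<open>theta_prod\<close> to \<open>qtheta\<close> negates the
    argument; the constant (q;q)_infinity cancels in the quotient.\<close>
  have rho: "\<rho> j = qtheta q (- \<sigma> * a j * lam) / qtheta q (- \<sigma> * lam)" if "j < r" for j
    unfolding \<rho>_def using theta_prod_conv_qtheta[OF q_nz q_lt_1, of "a j * (\<sigma> * lam)"]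
      theta_prod_conv_qtheta[OF q_nz q_lt_1 sl] sl a_nz[OF that] qpoch_inf_self_nonzero[OF q_lt_1] by (simp add: mult_ac)
  have "plaplace p lam borel_fun x = (\<Sum>j<r. A j * \<rho> j * ((\<Sum>\<^sub>\<infinity>m. w j m * W ^ m) * qtheta p (lam / (a j ^ k * x))) / qtheta p (lam / x))"
    unfolding plaplace_eq[OF x] N sum_divide_distrib ..
  also have "\<dots> = (\<Sum>j<r. A j * (qtheta p (p * a j ^ k * x / lam) / qtheta p (p * x / lam))
     * (qtheta q (- \<sigma> * a j * lam) / qtheta q (- \<sigma> * lam)) * (\<Sum>\<^sub>\<infinity>m. w j m * W ^ m))"
  proof (rule sum.cong[OF refl])
    fix j assume "j \<in> {..<r}"
    then have j: "j < r" by simp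
    show "A j * \<rho> j * ((\<Sum>\<^sub>\<infinity>m. w j m * W ^ m) * qtheta p (lam / (a j ^ k * x))) / qtheta p (lam / x) =
      A j * (qtheta p (p * a j ^ k * x / lam) / qtheta p (p * x / lam))
       * (qtheta q (- \<sigma> * a j * lam) / qtheta q (- \<sigma> * lam)) * (\<Sum>\<^sub>\<infinity>m. w j m * W ^ m)"
      unfolding refl1 rho[OF j] by (simp add: mult_ac)
  qed
  finally show ?thesis .
qed

end

section \<open>Translation from parameter lists to indexed parameters\<close>

lemma prod_list_nth: "(\<Prod>c\<leftarrow>xs. f c) = (\<Prod>i<length xs. f (xs ! i))"
  by (simp add: prod.list_conv_set_nth atLeast0LessThan)

text \<open>The series carries ((-1)^n q^(n(n-1)/2))^(-k), and the Borel weight in base q^k cancels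
  its power of q. The sign survives and becomes a change of variable by (-1)^k.\<close>

lemma pborel_qhyp_fps:
  assumes "q \<noteq> 0" "length a = r" "length b = s" "s + 1 < r"
  shows "pborel (q ^ (r - s - 1)) (qhyp_fps a b q) =
    Abs_fps (\<lambda>n. phi_coeff q r s ((!) a) ((!) b) n * ((- 1) ^ (r - s - 1)) ^ n)"
proof (rule fps_ext)
  fix n :: nat
  let ?k = "r - s - 1" and ?T = "n * (n - 1) div 2"
  have "1 + int (length b) - int (length a) = - int ?k" using assms by simp
  then have "((- 1) ^ n * q ^ ?T) powi (1 + int (length b) - int (length a)) * (q ^ ?k) ^ ?T
     = inverse (((- 1) ^ n * q ^ ?T) ^ ?k) * (q ^ ?k) ^ ?T"
    by (simp only: power_int_minus power_int_of_nat)
  also have "\<dots> = ((- 1) ^ ?k) ^ n"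
  proof -
    have "(q ^ ?k) ^ ?T = (q ^ ?T) ^ ?k" by (simp only: power_mult[symmetric] mult.commute)
    moreover have "((- 1 :: complex) ^ ?k) ^ n = ((- 1) ^ n) ^ ?k" by (simp only: power_mult[symmetric] mult.commute)
    moreover have "inverse (((- 1 :: complex) ^ n) ^ ?k) = ((- 1) ^ n) ^ ?k"
      by (simp add: power_inverse[symmetric])
    ultimately show ?thesis using assms(1) by (simp add: power_mult_distrib)
  qed
  finally show "fps_nth (pborel (q ^ ?k) (qhyp_fps a b q)) n =
      fps_nth (Abs_fps (\<lambda>n. phi_coeff q r s ((!) a) ((!) b) n * ((- 1) ^ ?k) ^ n)) n"
    unfolding pborel_def qhyp_fps_def fps_nth_Abs_fps prod_list_nth assms(2,3) phi_coeff_def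
    by (simp only: mult.assoc)
qed

text \<open>The zeros pad the numerator to 1 + s + k = r parameters against r - 1 below. The
  exponent of the Gaussian factor is then 0, and an ordinary power series remains.\<close>

lemma Phi_eq:
  assumes "length a = r" "length b = s" "s + 1 < r" "j < r"
  shows "Phi a b q j x = (\<Sum>m. dual_coeff q r s ((!) a) ((!) b) j m * (q * prod_list b / (prod_list a * x)) ^ m)"
proof -
  let ?A = "a ! j # map (\<lambda>c. a ! j * q / c) b @ replicate (length a - length b - 1) 0"
  let ?B = "map (\<lambda>i. a ! j * q / a ! i) (filter (\<lambda>i. i \<noteq> j) [0..<length a])"
  have set: "set (filter (\<lambda>i. i \<noteq> j) [0..<length a]) = {..<r} - {j}" using assms by auto
  have "length (filter (\<lambda>i. i \<noteq> j) [0..<length a]) = card ({..<r} - {j})"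
    unfolding set[symmetric] by (rule distinct_card[symmetric]) simp
  then have lenB: "length ?B = r - 1" using assms by simp
  have lenA: "length ?A = r" using assms by simp
  have e: "1 + int (length ?B) - int (length ?A) = 0" unfolding lenA lenB using assms by simp
  have prodA: "(\<Prod>c\<leftarrow>?A. qpoch c q n) = qpoch (a ! j) q n * (\<Prod>l<s. qpoch (a ! j * q / b ! l) q n)" for n
  proof -
    have "(\<Prod>c\<leftarrow>replicate N 0. qpoch c q n) = 1" for N by (induction N) auto
    moreover have "(\<Prod>c\<leftarrow>map (\<lambda>c. a ! j * q / c) b. qpoch c q n) = (\<Prod>l<s. qpoch (a ! j * q / b ! l) q n)"
      using prod_list_nth[of "\<lambda>c. qpoch (a ! j * q / c) q n" b] assms by (simp add: o_def)
    ultimately show ?thesis by simp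
  qed
  have prodB: "(\<Prod>c\<leftarrow>?B. qpoch c q n) = (\<Prod>i\<in>{..<r} - {j}. qpoch (a ! j * q / a ! i) q n)" for n
    unfolding set[symmetric] by (subst prod.distinct_set_conv_list) (simp_all add: o_def)
  show ?thesis
    unfolding Phi_def eval_fps_def qhyp_fps_def fps_nth_Abs_fps e prodA prodB dual_coeff_def by simp
qed

theorem theorem3p1:
  fixes q p lam :: complex and r s k :: nat and a b :: "complex list"
  assumes "0 < cmod q" and "cmod q < 1"
    and "r > s + 1" and "k = r - s - 1" and "p = q ^ k"
    and "length a = r" and "length b = s"
    and "\<forall>i<r. a ! i \<noteq> 0"
    and "\<forall>l<s. b ! l \<noteq> 0"
    and "\<forall>l<s. \<forall>n::nat. b ! l \<noteq> q powi (- int n)"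
    and "\<forall>i<r. \<forall>j<r. i \<noteq> j \<longrightarrow> (\<forall>n::int. a ! i / a ! j \<noteq> q powi n)"
    and "lam \<noteq> 0" and "lam \<notin> qspiral ((-1) ^ k) q"
  shows "spiral_summable p lam (qhyp_fps a b q) \<and>
    (\<forall>x. x \<noteq> 0 \<and> x \<notin> qspiral (- lam) p \<longrightarrow>
       plaplace_term p lam (eval_fps (pborel p (qhyp_fps a b q))) x summable_on UNIV) \<and>
    spiral_sum p lam (qhyp_fps a b q) analytic_on (UNIV - {0} - qspiral (- lam) p) \<and>
    (\<forall>x. x \<noteq> 0 \<and> x \<notin> qspiral (- lam) p \<and> cmod (q * prod_list b / (prod_list a * x)) < 1 \<longrightarrow>
       spiral_sum p lam (qhyp_fps a b q) x =
       (\<Sum>j<r. (\<Prod>i\<in>{..<r} - {j}. qpoch_inf (a ! i) q / qpoch_inf (a ! i / a ! j) q)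
          * (\<Prod>l<s. qpoch_inf (b ! l / a ! j) q / qpoch_inf (b ! l) q)
          * (qtheta p (p * (a ! j) ^ k * x / lam) / qtheta p (p * x / lam))
          * (qtheta q ((-1) powi (1 - int k) * a ! j * lam) / qtheta q ((-1) powi (1 - int k) * lam))
          * Phi a b q j x)) \<and>
    (\<forall>x0\<in>qspiral (- lam) p.
       if plaplace_numerator p lam (eval_fps (pborel p (qhyp_fps a b q))) x0 \<noteq> 0
       then is_pole (spiral_sum p lam (qhyp_fps a b q)) x0 \<and>
            zorder (spiral_sum p lam (qhyp_fps a b q)) x0 = -1
       else \<exists>c. (spiral_sum p lam (qhyp_fps a b q) \<longlongrightarrow> c) (at x0))"
proof -
  have q0: "q \<noteq> 0" using assms(1) by auto
  interpret H: qhyp_spiral q r s "(!) a" "(!) b" lam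
  proof unfold_locales
    show "b ! l * q ^ n \<noteq> 1" if "l < s" for l n
    proof
      assume "b ! l * q ^ n = 1"
      then have "b ! l = q powi (- int n)" using q0 by (simp add: power_int_minus field_simps)
      then show False using assms(10) that by blast
    qed
  qed (use assms q0 in auto)
  have p: "H.p = p" using assms by (simp add: H.p_def)
  have k: "r - s - 1 = k" using assms by simp
  have borel: "pborel p (qhyp_fps a b q) = Abs_fps (\<lambda>n. phi_coeff q r s ((!) a) ((!) b) n * H.\<sigma> ^ n)"
    using pborel_qhyp_fps[OF q0 assms(6,7)] assms by (simp add: H.\<sigma>_def)
  have F: "eval_fps (pborel p (qhyp_fps a b q)) = H.borel_fun"
    unfolding borel by (rule ext) (simp add: H.borel_fun_def eval_fps_def power_mult_distrib mult.assoc)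
  have sum: "spiral_sum p lam (qhyp_fps a b q) = plaplace p lam H.borel_fun"
    unfolding spiral_sum_def[abs_def] F by simp
  have radius: "fps_conv_radius (pborel p (qhyp_fps a b q)) \<ge> 1"
    unfolding borel fps_conv_radius_def
  proof (rule conv_radius_geI_ex)
    fix \<rho> :: real assume \<rho>: "0 < \<rho>" "ereal \<rho> < 1"
    then have "cmod (H.\<sigma> * of_real \<rho>) < 1" by (simp add: norm_mult)
    from infsum_nat_eq_suminf(2)[OF H.phi_series_summable[OF this]]
    show "\<exists>z. cmod z = \<rho> \<and> summable (\<lambda>n. fps_nth (Abs_fps (\<lambda>n. phi_coeff q r s ((!) a) ((!) b) n * H.\<sigma> ^ n)) n * z ^ n)"
      using \<rho> by (intro exI[of _ "of_real \<rho>"]) (simp add: power_mult_distrib mult.assoc)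
  qed
  have summable: "spiral_summable p lam (qhyp_fps a b q)"
    unfolding spiral_summable_def F H_space_def
    using radius H.spiral_continuation_G[unfolded p] by (auto intro: less_le_trans[of 0 "1::ereal"])
  have formula: "spiral_sum p lam (qhyp_fps a b q) x =
       (\<Sum>j<r. (\<Prod>i\<in>{..<r} - {j}. qpoch_inf (a ! i) q / qpoch_inf (a ! i / a ! j) q)
          * (\<Prod>l<s. qpoch_inf (b ! l / a ! j) q / qpoch_inf (b ! l) q)
          * (qtheta p (p * (a ! j) ^ k * x / lam) / qtheta p (p * x / lam))
          * (qtheta q ((-1) powi (1 - int k) * a ! j * lam) / qtheta q ((-1) powi (1 - int k) * lam))
          * Phi a b q j x)"
    if x: "x \<noteq> 0" "cmod (q * prod_list b / (prod_list a * x)) < 1" for x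
  proof -
    have pl: "prod_list a = (\<Prod>i<r. a ! i)" "prod_list b = (\<Prod>l<s. b ! l)"
      using prod_list_nth[of "\<lambda>x. x" a] prod_list_nth[of "\<lambda>x. x" b] assms by simp_all
    \<comment> \<open>The prefactor (-1)^(1-k) of the theorem is the negated sign
      \<open>H.\<sigma>\<close> that occurs in \<open>H.plaplace_formula\<close>.\<close>
    have "(- 1 :: complex) powi (1 - int k) = - 1 / (- 1) ^ k" by (simp add: power_int_diff)
    also have "\<dots> = - ((- 1) ^ k)" by (cases "even k") auto
    finally have sg: "(- 1 :: complex) powi (1 - int k) = - H.\<sigma>" unfolding H.\<sigma>_def k .
    have Phi: "Phi a b q j x = (\<Sum>\<^sub>\<infinity>m. dual_coeff q r s ((!) a) ((!) b) j m * (q * prod_list b / (prod_list a * x)) ^ m)"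
      if "j < r" for j
      unfolding infsum_nat_eq_suminf(1)[OF H.dual_coeff_series_summable[OF that x(2)]]
      by (rule Phi_eq) (use assms that in auto)
    show ?thesis
      unfolding sum H.plaplace_formula[OF x(1) _ x(2), unfolded pl, OF refl, unfolded p k] sg
      by (intro sum.cong refl) (simp add: Phi connection_coeff_def pl)
  qed
  show ?thesis
  proof (intro conjI allI impI ballI)
    show "spiral_summable p lam (qhyp_fps a b q)" by (rule summable)
    show "plaplace_term p lam (eval_fps (pborel p (qhyp_fps a b q))) x summable_on UNIV"
      if "x \<noteq> 0 \<and> x \<notin> qspiral (- lam) p" for x
      unfolding F by (rule H.plaplace_term_summable[unfolded p]) (use that in simp)
    show "spiral_sum p lam (qhyp_fps a b q) analytic_on (UNIV - {0} - qspiral (- lam) p)"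
      unfolding sum by (rule H.plaplace_analytic[unfolded p])
    show "if plaplace_numerator p lam (eval_fps (pborel p (qhyp_fps a b q))) x0 \<noteq> 0
       then is_pole (spiral_sum p lam (qhyp_fps a b q)) x0 \<and>
            zorder (spiral_sum p lam (qhyp_fps a b q)) x0 = -1
       else \<exists>c. (spiral_sum p lam (qhyp_fps a b q) \<longlongrightarrow> c) (at x0)"
      if "x0 \<in> qspiral (- lam) p" for x0
      unfolding sum F by (rule H.plaplace_at_spiral[unfolded p, OF that])
  qed (rule formula; simp)
qed

end
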